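(* Suppose that for each $w\in\mathbb{R}^d_{\ge0}$ the weighted sum scalarization $\mathsf{WS}(w)$ of a MOMILP instance $I$ can be solved in time in $\mathcal{O}(\mathsf{poly}(\langle I,w\rangle))$. Then the inner approximation algorithm described in the context, using $\mathsf{hpO}\text{-}\mathsf{WS}$ as the plane separating oracle, can be used to construct a multi-objective convex fully polynomial-time approximation scheme (cFPTAS).
   Context: MOMILP. For $d,m,n\in\mathbb{N}_{>0}$, $Q\in\mathbb{Q}^{d\times n}$, $A\in\mathbb{Q}^{m\times n}$, $b\in\mathbb{Q}^m$ and $n_{\mathbb{R}},n_{\mathbb{Z}}\in\mathbb{N}_{\ge 0}$ with $n_{\mathbb{R}}+n_{\mathbb{Z}}=n$, a multi-objective mixed-integer linear program (MOMILP) is the problem $\min f(x)=Qx$ subject to $Ax\ge b$, $x\in\mathbb{R}^{n_{\mathbb{R}}}\times\mathbb{Z}^{n_{\mathbb{Z}}}$. $X$ denotes its set of feasible solutions and $Y=\{f(x):x\in X\}\subseteq\mathbb{R}^d$ its set of images. An instance $I$ need not be explicitly encoded in this form. Standing assumptions: $X\ne\emptyset$, $Y\subseteq\mathbb{R}^d_{\ge 0}$, and the number $d$ of objectives is a constant. $\langle\cdot\rangle$ denotes binary encoding length; inequalities between vectors are componentwise; sums of sets are Minkowski sums; $\mathsf{conv}$ is the convex hull. Convex approximation. A set $R\subseteq X$ is a $(1+\varepsilon)$-convex approximation set if for each $x\in X$ there is $v\in\mathsf{conv}\{f(x^* ):x^*\in R\}$ with $v\le(1+\varepsilon)f(x)$.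 A multi-objective convex approximation scheme is an algorithm that takes a MOMILP instance $I$ and $\varepsilon\in\mathbb{Q}_{>0}$ and outputs a $(1+\varepsilon)$-convex approximation set; it is a cFPTAS if its running time is in $\mathcal{O}(\mathsf{poly}(\langle I\rangle,\varepsilon^{-1}))$. Weighted sum oracle. For $w\in\mathbb{R}^d_{\ge0}$, $\mathsf{WS}(w)$ is the single-objective problem $\min\{w^{\mathsf T}f(x):x\in X\}$; the same symbol denotes an algorithm solving it, whose returned solutions are assumed to have encoding length in $\mathcal{O}(\mathsf{poly}(\langle I\rangle))$. The oracle $\mathsf{hpO}\text{-}\mathsf{WS}$, given $H=\{z\in\mathbb{R}^d:w^{\mathsf T}z\ge c\}$, computes $x^*\gets\mathsf{WS}(w)$ and returns $(\textit{inside},\emptyset)$ if $w^{\mathsf T}f(x^* )\ge c$ and $(\textit{not inside},x^* )$ otherwise. Facet-supporting halfspaces. For a polyhedron $\mathcal{P}$, $\mathcal{H}(\mathcal{P})$ is the set of halfspaces that contain $\mathcal{P}$ and whose boundary contains a facet of $\mathcal{P}$. Inner approximation algorithm (with oracle $\mathsf{hpO}$, factor $1+\varepsilon$ and initial solution $x^{\mathrm{init}}\in X$ with encoding length in $\mathcal{O}(\mathsf{poly}(\langle I\rangle))$). Initialize $R=\{x^{\mathrm{init}}\}$, $k=1$, $F=\emptyset$, $\mathcal{A}^{(1)}=\{f(x^{\mathrm{init}})\}+\mathbb{R}^d_{\ge0}$. While $\mathcal{H}(\mathcal{A}^{(k)})\setminus F\ne\emptyset$: pick an arbitrary halfspace $H=\{z\in\mathbb{R}^d:w^{\mathsf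 T}z\ge c\}\in\mathcal{H}(\mathcal{A}^{(k)})\setminus F$; set $H_{1+\varepsilon}=\{z\in\mathbb{R}^d:(1+\varepsilon)w^{\mathsf T}z\ge c\}$; call $\mathsf{hpO}(H_{1+\varepsilon})$. If it returns $(\textit{not inside},x^* )$, set $R\gets R\cup\{x^*\}$, $k\gets k+1$, $\mathcal{A}^{(k)}\gets\mathsf{conv}\{f(x):x\in R\}+\mathbb{R}^d_{\ge0}$; otherwise set $F\gets F\cup\{H\}$. The output is $R$ at termination.
   Formalization: The running time proved is poly(⟨I⟩,1/ε)+poly(⟨ε⟩), since reading ε (e.g. ε=1+2^{-k}) already exceeds poly(⟨I⟩,1/ε); for instances not encoded explicitly, f(x) is assumed computable in polynomial time from I and x, as the oracle's test requires. *)

theory Defs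
  imports
    "HOL-Analysis.Analysis"
    "HOL-Computational_Algebra.Polynomial"
    "HOL-Library.Log_Nat"
begin

section \<open>Model of computation\<close>

text \<open>
  Algorithms are programs of a small first-order language over integers and pairs under a
  logarithmic cost measure: every operation, including copying a value, is charged the bit
  length of the data it touches. In particular the output of a run is never longer than its
  running time, and running times agree with those of multitape Turing machines up to a
  polynomial.
\<close>

datatype val = Num int | Pr val val

fun len :: "val \<Rightarrow> nat" where
  "len (Num i) = nat (bitlen \<bar>i\<bar>) + 1"
| "len (Pr u v) = len u + len v + 1"

datatype prim = Id | Const int | Fst | Snd | IsPair | Add | Sub | Mul | Div | Leq

text \<open>Applied to arguments of the wrong shape, a primitive returns \<open>Num 0\<close>.\<close>

fun prim_val :: "prim \<Rightarrow> val \<Rightarrow> val" where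
  "prim_val Id v = v"
| "prim_val (Const i) v = Num i"
| "prim_val Fst (Pr u v) = u"
| "prim_val Snd (Pr u v) = v"
| "prim_val IsPair (Pr u v) = Num 1"
| "prim_val Add (Pr (Num i) (Num j)) = Num (i + j)"
| "prim_val Sub (Pr (Num i) (Num j)) = Num (i - j)"
| "prim_val Mul (Pr (Num i) (Num j)) = Num (i * j)"
| "prim_val Div (Pr (Num i) (Num j)) = Num (i div j)"
| "prim_val Leq (Pr (Num i) (Num j)) = Num (if i \<le> j then 1 else 0)"
| "prim_val _ _ = Num 0"

datatype prog =
    Prim prim
  | Seq prog prog
  | Fork prog prog
  | If prog prog prog
  | While prog prog

text \<open>
  \<open>run P v u t\<close>: started on \<open>v\<close>, the program \<open>P\<close> halts with result \<open>u\<close> after time \<open>t\<close>.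
  As a condition, every value other than \<open>Num 0\<close> counts as true.
\<close>

inductive run :: "prog \<Rightarrow> val \<Rightarrow> val \<Rightarrow> nat \<Rightarrow> bool" where
  run_Prim: "run (Prim f) v (prim_val f v) (len v + len (prim_val f v))"
| run_Seq: "run P v u s \<Longrightarrow> run Q u w t \<Longrightarrow> run (Seq P Q) v w (s + t)"
| run_Fork: "run P v u s \<Longrightarrow> run Q v w t \<Longrightarrow>
    run (Fork P Q) v (Pr u w) (s + t + len v + len (Pr u w))"
| run_If_true: "run B v u s \<Longrightarrow> u \<noteq> Num 0 \<Longrightarrow> run P v w t \<Longrightarrow>
    run (If B P Q) v w (s + t + len v)"
| run_If_false: "run B v (Num 0) s \<Longrightarrow> run Q v w t \<Longrightarrow>
    run (If B P Q) v w (s + t + len v)"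
| run_While_stop: "run B v (Num 0) s \<Longrightarrow> run (While B P) v v (s + len v)"
| run_While_step: "run B v u s \<Longrightarrow> u \<noteq> Num 0 \<Longrightarrow> run P v w t \<Longrightarrow> run (While B P) w z r \<Longrightarrow>
    run (While B P) v z (s + t + r + len v)"

lemma run_deterministic:
  assumes "run P v u s" and "run P v u' s'"
  shows "u = u' \<and> s = s'"
  using assms
proof (induction arbitrary: u' s' rule: run.induct)
  case (run_Prim f v)
  then show ?case by (auto elim: run.cases)
next
  case (run_Seq P v u s Q w t)
  from run_Seq.prems show ?case
    by (cases rule: run.cases) (use run_Seq.IH in blast)
next
  case (run_Fork P v u s Q w t)
  from run_Fork.prems show ?case
    by (cases rule: run.cases) (use run_Fork.IH in blast)
next
  case (run_If_true B v u s P w t Q)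
  from run_If_true.prems show ?case
    by (cases rule: run.cases) (use run_If_true.IH run_If_true.hyps in blast)+
next
  case (run_If_false B v s Q w t P)
  from run_If_false.prems show ?case
    by (cases rule: run.cases) (use run_If_false.IH run_If_false.hyps in blast)+
next
  case (run_While_stop B v s P)
  from run_While_stop.prems show ?case
    by (cases rule: run.cases) (use run_While_stop.IH run_While_stop.hyps in blast)+
next
  case (run_While_step B v u s P w t z r)
  from run_While_step.prems show ?case
    by (cases rule: run.cases) (use run_While_step.IH run_While_step.hyps in blast)+
qed

lemma len_pos: "0 < len v"
  by (cases v) auto

text \<open>A run has to write down its result, so the result cannot be longer than the run.\<close>

lemma len_result_le_time: "run P v u t \<Longrightarrow> len u \<le> t"
  by (induction rule: run.induct) auto

subsection \<open>Encodings\<close>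

fun enc_list :: "val list \<Rightarrow> val" where
  "enc_list [] = Num 0"
| "enc_list (v # vs) = Pr v (enc_list vs)"

definition enc_rat :: "rat \<Rightarrow> val" where
  "enc_rat r = (case quotient_of r of (p, q) \<Rightarrow> Pr (Num p) (Num q))"

definition enc_sol :: "rat list \<Rightarrow> val" where
  "enc_sol x = enc_list (map enc_rat x)"

text \<open>The library enumeration \<open>from_nat_into UNIV\<close> fixes the order of the coordinates.\<close>

definition enc_vec :: "rat ^ 'd \<Rightarrow> val" where
  "enc_vec w = enc_list (map (\<lambda>i. enc_rat (w $ from_nat_into UNIV i)) [0..<CARD('d)])"

definition real_vec :: "rat ^ 'd \<Rightarrow> real ^ 'd" where
  "real_vec w = (\<chi> i. of_rat (w $ i))"

abbreviation real_sol :: "rat list \<Rightarrow> real list" where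
  "real_sol x \<equiv> map of_rat x"

section \<open>Multi-objective mixed-integer linear programs\<close>

text \<open>
  The objectives are indexed by the type \<open>'d\<close>, so their number is a constant. The dimensions
  \<open>n\<close> and \<open>m\<close> vary with the instance; the matrix entries are only used at indices below them.
\<close>

record 'd momilp =
  num_real :: nat
  num_int :: nat
  num_rows :: nat
  Qmat :: "'d \<Rightarrow> nat \<Rightarrow> rat"
  Amat :: "nat \<Rightarrow> nat \<Rightarrow> rat"
  bvec :: "nat \<Rightarrow> rat"

definition num_vars :: "('d::finite) momilp \<Rightarrow> nat" where
  "num_vars M = num_real M + num_int M"

definition objective :: "('d::finite) momilp \<Rightarrow> real list \<Rightarrow> real ^ 'd" where
  "objective M x = (\<chi> i. \<Sum>j<num_vars M. of_rat (Qmat M i j) * x ! j)"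

definition feasible :: "('d::finite) momilp \<Rightarrow> real list set" where
  "feasible M = {x. length x = num_vars M \<and>
     (\<forall>i<num_rows M. (\<Sum>j<num_vars M. of_rat (Amat M i j) * x ! j) \<ge> of_rat (bvec M i)) \<and>
     (\<forall>j. num_real M \<le> j \<and> j < num_vars M \<longrightarrow> x ! j \<in> \<int>)}"

definition images :: "('d::finite) momilp \<Rightarrow> (real ^ 'd) set" where
  "images M = objective M ` feasible M"

definition admissible :: "('d::finite) momilp \<Rightarrow> bool" where
  "admissible M \<longleftrightarrow> num_vars M > 0 \<and> num_rows M > 0 \<and>
     feasible M \<noteq> {} \<and> (\<forall>y\<in>images M. 0 \<le> y)"

text \<open>
  A class of encoded instances consists of a set \<open>D\<close> of codes and a map \<open>mip\<close> that assigns to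
  each code the program it stands for. The code need not list \<open>Q\<close>, \<open>A\<close> and \<open>b\<close>, but the
  objective has to be readable from it: the image of a rational feasible solution can be
  computed in polynomial time. (For explicitly listed \<open>Q\<close> this is a matrix-vector product.)
\<close>

definition momilp_encoding :: "val set \<Rightarrow> (val \<Rightarrow> ('d::finite) momilp) \<Rightarrow> bool" where
  "momilp_encoding D mip \<longleftrightarrow>
     (\<forall>I\<in>D. admissible (mip I)) \<and>
     (\<exists>P (p :: real poly). \<forall>I\<in>D. \<forall>x. real_sol x \<in> feasible (mip I) \<longrightarrow>
        (\<exists>y t. real_vec y = objective (mip I) (real_sol x) \<and>
           run P (Pr I (enc_sol x)) (enc_vec y) t \<and>
           real t \<le> poly p (real (len I + len (enc_sol x)))))"

section \<open>Convex approximation schemes\<close>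

definition convex_approx_set :: "('d::finite) momilp \<Rightarrow> rat \<Rightarrow> real list set \<Rightarrow> bool" where
  "convex_approx_set M \<epsilon> R \<longleftrightarrow> R \<subseteq> feasible M \<and>
     (\<forall>x\<in>feasible M. \<exists>v\<in>convex hull (objective M ` R). v \<le> of_rat (1 + \<epsilon>) *\<^sub>R objective M x)"

definition convex_approx_scheme :: "val set \<Rightarrow> (val \<Rightarrow> ('d::finite) momilp) \<Rightarrow> prog \<Rightarrow> bool" where
  "convex_approx_scheme D mip P \<longleftrightarrow>
     (\<forall>I\<in>D. \<forall>\<epsilon>>0. \<exists>Rs t. run P (Pr I (enc_rat \<epsilon>)) (enc_list (map enc_sol Rs)) t \<and>
        convex_approx_set (mip I) \<epsilon> (real_sol ` set Rs))"

text \<open>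
  A bound polynomial in two nonnegative quantities is the same as one polynomial in their sum.
  The summand \<open>poly q\<close> pays for reading the rational number \<open>\<epsilon>\<close> and calculating with it: the
  bit length of \<open>\<epsilon>\<close> is not bounded in terms of \<open>1 / \<epsilon>\<close>, so no program that reads its input
  could do without it.
\<close>

definition cFPTAS :: "val set \<Rightarrow> (val \<Rightarrow> ('d::finite) momilp) \<Rightarrow> prog \<Rightarrow> bool" where
  "cFPTAS D mip P \<longleftrightarrow> convex_approx_scheme D mip P \<and>
     (\<exists>p q :: real poly. \<forall>I\<in>D. \<forall>\<epsilon>>0. \<forall>u t. run P (Pr I (enc_rat \<epsilon>)) u t \<longrightarrow>
        real t \<le> poly p (real (len I) + 1 / of_rat \<epsilon>) + poly q (real (len (enc_rat \<epsilon>))))"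

section \<open>The weighted sum scalarization\<close>

definition solves_weighted_sum :: "('d::finite) momilp \<Rightarrow> real ^ 'd \<Rightarrow> real list \<Rightarrow> bool" where
  "solves_weighted_sum M w x \<longleftrightarrow> x \<in> feasible M \<and>
     (\<forall>x'\<in>feasible M. w \<bullet> objective M x \<le> w \<bullet> objective M x')"

text \<open>
  \<open>WS I w\<close> is the solution that the algorithm returns for instance \<open>I\<close> and weight \<open>w\<close>. Only
  rational weights have an encoding and can be handed to an algorithm.
\<close>

definition WS_algorithm ::
  "val set \<Rightarrow> (val \<Rightarrow> ('d::finite) momilp) \<Rightarrow> (val \<Rightarrow> rat ^ 'd \<Rightarrow> rat list) \<Rightarrow> bool" where
  "WS_algorithm D mip WS \<longleftrightarrow>
     (\<forall>I\<in>D. \<forall>w\<ge>0. solves_weighted_sum (mip I) (real_vec w) (real_sol (WS I w))) \<and>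
     (\<exists>p :: real poly. \<forall>I\<in>D. \<forall>w\<ge>0. real (len (enc_sol (WS I w))) \<le> poly p (real (len I)))"

definition poly_time_WS ::
  "val set \<Rightarrow> (val \<Rightarrow> rat ^ ('d::finite) \<Rightarrow> rat list) \<Rightarrow> bool" where
  "poly_time_WS D WS \<longleftrightarrow>
     (\<exists>P (p :: real poly). \<forall>I\<in>D. \<forall>w\<ge>0. \<exists>t.
        run P (Pr I (enc_vec w)) (enc_sol (WS I w)) t \<and>
        real t \<le> poly p (real (len I + len (enc_vec w))))"

section \<open>The inner approximation algorithm\<close>

definition halfspace :: "real ^ 'd \<Rightarrow> real \<Rightarrow> (real ^ 'd) set" where
  "halfspace w c = {z. w \<bullet> z \<ge> c}"

definition facet_halfspaces :: "(real ^ ('d::finite)) set \<Rightarrow> (real ^ 'd) set set" where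
  "facet_halfspaces S = {H. \<exists>w c. w \<noteq> 0 \<and> H = halfspace w c \<and> S \<subseteq> H \<and>
     (\<exists>F. F facet_of S \<and> F \<subseteq> {z. w \<bullet> z = c})}"

definition inner_set :: "('s \<Rightarrow> real ^ ('d::finite)) \<Rightarrow> 's set \<Rightarrow> (real ^ 'd) set" where
  "inner_set f R = {y + r | y r. y \<in> convex hull (f ` R) \<and> 0 \<le> r}"

text \<open>
  An oracle receives a halfspace through its normal vector and right-hand side. It answers
  \<open>None\<close> for ``inside'' and \<open>Some x\<close> for ``not inside'' with solution \<open>x\<close>.
\<close>

definition hpO_WS ::
  "('s \<Rightarrow> real ^ ('d::finite)) \<Rightarrow> (rat ^ 'd \<Rightarrow> 's) \<Rightarrow> rat ^ 'd \<Rightarrow> real \<Rightarrow> 's option" where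
  "hpO_WS f ws w c = (let x = ws w in if real_vec w \<bullet> f x \<ge> c then None else Some x)"

text \<open>
  One pass through the loop, acting on the pair of \<open>R\<close> and \<open>F\<close>; the counter \<open>k\<close> only numbers
  the successive values of \<open>inner_set f R\<close>. The halfspace \<open>H\<close> and its rational representation
  \<open>w\<close>, \<open>c\<close> are arbitrary.
\<close>

inductive inner_step ::
  "('s \<Rightarrow> real ^ ('d::finite)) \<Rightarrow> (rat ^ 'd \<Rightarrow> real \<Rightarrow> 's option) \<Rightarrow> rat \<Rightarrow>
   's set \<times> (real ^ 'd) set set \<Rightarrow> 's set \<times> (real ^ 'd) set set \<Rightarrow> bool"
  for f hpO \<epsilon> where
  not_inside: "H \<in> facet_halfspaces (inner_set f R) - F \<Longrightarrow> H = halfspace (real_vec w) c \<Longrightarrow>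
    hpO ((1 + \<epsilon>) *s w) c = Some x \<Longrightarrow> inner_step f hpO \<epsilon> (R, F) (insert x R, F)"
| inside: "H \<in> facet_halfspaces (inner_set f R) - F \<Longrightarrow> H = halfspace (real_vec w) c \<Longrightarrow>
    hpO ((1 + \<epsilon>) *s w) c = None \<Longrightarrow> inner_step f hpO \<epsilon> (R, F) (R, insert H F)"

definition inner_approx_output ::
  "('s \<Rightarrow> real ^ ('d::finite)) \<Rightarrow> (rat ^ 'd \<Rightarrow> real \<Rightarrow> 's option) \<Rightarrow> rat \<Rightarrow> 's \<Rightarrow> 's set \<Rightarrow> bool" where
  "inner_approx_output f hpO \<epsilon> x_init R \<longleftrightarrow>
     (\<exists>F. (inner_step f hpO \<epsilon>)\<^sup>*\<^sup>* ({x_init}, {}) (R, F) \<and>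
          facet_halfspaces (inner_set f R) - F = {})"

text \<open>
  The program carries out the inner approximation algorithm with oracle \<open>hpO_WS\<close>, factor
  \<open>1 + \<epsilon>\<close> and some initial solution of polynomial encoding length.
\<close>

definition implements_inner_approx ::
  "val set \<Rightarrow> (val \<Rightarrow> ('d::finite) momilp) \<Rightarrow> (val \<Rightarrow> rat ^ 'd \<Rightarrow> rat list) \<Rightarrow> prog \<Rightarrow> bool" where
  "implements_inner_approx D mip WS P \<longleftrightarrow>
     (\<exists>p :: real poly. \<forall>I\<in>D. \<forall>\<epsilon>>0. \<exists>x_init Rs t.
        real_sol x_init \<in> feasible (mip I) \<and>
        real (len (enc_sol x_init)) \<le> poly p (real (len I)) \<and>
        run P (Pr I (enc_rat \<epsilon>)) (enc_list (map enc_sol Rs)) t \<and>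
        inner_approx_output (objective (mip I))
          (hpO_WS (objective (mip I)) (\<lambda>w. real_sol (WS I w))) \<epsilon>
          (real_sol x_init) (real_sol ` set Rs))"

end

theory Submission
  imports Defs
begin

text \<open>
  The algorithm keeps a set \<open>R\<close> of solutions and the polyhedron
  \<open>S = conv f(R) + \<real>\<^sup>d\<^sub>\<ge>\<^sub>0\<close>. That it computes a convex
  approximation set is a statement about the facets of \<open>S\<close>. When every facet \<open>w \<bullet> z \<ge> c\<close>
  passes the test, \<open>WS(w)\<close> certifies \<open>(1 + \<epsilon>) w \<bullet> f(x) \<ge> c\<close> for \<^emph>\<open>all\<close> feasible \<open>x\<close>; a polyhedron is
  the intersection of its facet halfspaces (\<open>Inter_facet_halfspaces_upper_hull\<close>), so
  \<open>(1 + \<epsilon>) f(x)\<close> lies in \<open>S\<close>, that is, above a point of \<open>conv f(R)\<close> (\<open>no_violators\<close>).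

  The number of rounds is bounded by a grid argument. A new solution \<open>x\<^sup>*\<close> violates a facet of \<open>S\<close>
  even after scaling its image by \<open>1 + \<epsilon>\<close>; hence \<open>(1 + \<epsilon>) f(x\<^sup>*)\<close> lies above no earlier image
  (\<open>violator_step\<close>). All images have polynomial encoding length \<open>L\<close>, so their nonzero coordinates lie
  between \<open>2\<^sup>-\<^sup>L\<close> and \<open>2\<^sup>L\<close>, and rounding the logarithms to base \<open>1 + \<epsilon>\<close> puts them into
  \<open>O(L (1 + 1 / \<epsilon>))\<close> classes per coordinate. Two images in the same cell of this grid are within the
  factor \<open>1 + \<epsilon>\<close> of each other in every coordinate (\<open>le_of_cell_eq\<close>), so \<open>R\<close> has at most one solution
  per cell (\<open>card_le_of_inj_on_cell\<close>). As \<open>d\<close> is a constant, this is polynomial in \<open>L\<close> and \<open>1 / \<epsilon>\<close>.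

  For one round the facets have to be found. Homogenising turns the points \<open>y \<in> f(R)\<close> into \<open>(y, 1)\<close> and
  the unit directions into \<open>(e\<^sub>i, 0)\<close>; a facet normal is a nonnegative functional on these generators
  that is determined up to a factor by the generators on which it vanishes (\<open>facet_normal\<close>). It
  is therefore the solution of \<open>d\<close> of these linear equations, and since \<open>d\<close> is constant, all
  selections of \<open>d\<close> generators can be tried: \<open>d\<close> elimination steps over the integers, each branching over
  the generators and the pivots, yield all candidates (\<open>normals_sound\<close>, \<open>normals_complete\<close>).
  Each step is a polynomial-time function of its input, and polynomial-time functions are closed under
  composition, so a constant number of steps keeps both the lists and the numbers in them polynomial
  (\<open>ptime_normals\<close>).

  The algorithm may pick facets in any order. The program adds solutions as long as any candidate is
  violated, with \<open>F\<close> still empty; when none is left, the current facets are put into \<open>F\<close> one after the other, and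
  the run ends. Facets have integral normals \<open>w\<close> here; written as the halfspace of
  \<open>w / (1 + \<epsilon>)\<close>, the oracle query for such a facet is exactly the call \<open>WS(w)\<close>.

  Programs are not written out. The relation \<open>ptime A e f\<close> says that the code \<open>f a\<close> can be computed from
  the code \<open>e a\<close> in polynomial time, and closure rules for it produce every program except
  the main loop, whose number of iterations is the one that the grid argument bounds.
\<close>

section \<open>Polynomial-time computability\<close>

text \<open>
  Functions on an arbitrary index type are compared through their codes: \<open>e\<close> is the code of the input,
  \<open>f\<close> the code of the output. This makes computability a preorder on encodings (\<open>ptime_id\<close>,
  \<open>ptime_trans\<close>), and functions that are only computable on part of their domain are covered
  by the set \<open>A\<close>. The time bound is a single power of a number that is at least two, so that constants
  and sums are absorbed by the exponent.
\<close>

definition ptime :: "'a set \<Rightarrow> ('a \<Rightarrow> val) \<Rightarrow> ('a \<Rightarrow> val) \<Rightarrow> bool" where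
  "ptime A e f \<longleftrightarrow> (\<exists>P k. \<forall>a\<in>A. \<exists>t. run P (e a) (f a) t \<and> t \<le> (len (e a) + 1) ^ k)"

lemma ptimeI:
  "(\<And>a. a \<in> A \<Longrightarrow> \<exists>t. run P (e a) (f a) t \<and> t \<le> (len (e a) + 1) ^ k) \<Longrightarrow> ptime A e f"
  unfolding ptime_def by blast

lemma len_ge_1: "1 \<le> len v"
  using len_pos[of v] by simp

lemma const_le_power: "2 \<le> (n :: nat) \<Longrightarrow> c \<le> n ^ c"
  by (metis less_exp less_imp_le order_trans power_mono zero_le)

lemma sum_powers_le:
  fixes n :: nat
  assumes "2 \<le> n"
  shows "n ^ i + n ^ j \<le> n ^ (i + j + 1)"
proof -
  have "n ^ i \<le> n ^ (i + j)" "n ^ j \<le> n ^ (i + j)"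
    using assms by (auto intro!: power_increasing)
  then have "n ^ i + n ^ j \<le> 2 * n ^ (i + j)" by simp
  also have "\<dots> \<le> n * n ^ (i + j)" using assms by (intro mult_right_mono) auto
  finally show ?thesis by simp
qed

lemma poly_le_power:
  fixes p :: "real poly"
  shows "\<exists>k. \<forall>n. poly p (real n) \<le> real ((n + 2) ^ k)"
proof (induction p)
  case 0
  show ?case by (intro exI[of _ 0]) simp
next
  case (pCons c p)
  then obtain k where k: "\<forall>n. poly p (real n) \<le> real ((n + 2) ^ k)" by blast
  define c' where "c' = nat \<lceil>\<bar>c\<bar>\<rceil>"
  have "poly (pCons c p) (real n) \<le> real ((n + 2) ^ (c' + (k + 1) + 1))" for n
  proof -
    have "c \<le> real c'" unfolding c'_def by linarith
    also have "\<dots> \<le> real ((n + 2) ^ c')" using const_le_power[of "n + 2" c'] by (simp only: of_nat_le_iff)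
    finally have 1: "c \<le> real ((n + 2) ^ c')" .
    have "real n * poly p (real n) \<le> real n * real ((n + 2) ^ k)" using k by (intro mult_left_mono) auto
    also have "\<dots> \<le> real (n + 2) * real ((n + 2) ^ k)" by (intro mult_right_mono) auto
    also have "\<dots> = real ((n + 2) ^ (k + 1))" by (simp add: algebra_simps)
    finally have "poly (pCons c p) (real n) \<le> real ((n + 2) ^ c' + (n + 2) ^ (k + 1))" using 1 by simp
    also have "\<dots> \<le> real ((n + 2) ^ (c' + (k + 1) + 1))"
      by (intro of_nat_mono sum_powers_le) simp
    finally show ?thesis .
  qed
  then show ?case by blast
qed

lemma poly_le_power_nat:
  fixes p :: "real poly"
  shows "\<exists>k. \<forall>n t. real t \<le> poly p (real n) \<longrightarrow> t \<le> (n + 2) ^ k"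
proof -
  obtain k where "\<forall>n. poly p (real n) \<le> real ((n + 2) ^ k)" using poly_le_power by blast
  then have "real t \<le> poly p (real n) \<longrightarrow> t \<le> (n + 2) ^ k" for n t
    by (meson of_nat_le_iff order_trans)
  then show ?thesis by blast
qed

lemma power_plus_1_le:
  fixes n :: nat
  assumes "2 \<le> n" shows "n ^ k + 1 \<le> n ^ (k + 1)"
  using sum_powers_le[OF assms, of k 0] by simp

text \<open>
  The output of the first program is not longer than its running time, so the second program
  runs on an input of polynomial length.
\<close>

lemma ptime_trans:
  assumes "ptime A e f" "ptime A f g" shows "ptime A e g"
proof -
  obtain P k where P: "\<forall>a\<in>A. \<exists>t. run P (e a) (f a) t \<and> t \<le> (len (e a) + 1) ^ k"
    using assms(1) unfolding ptime_def by blast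
  obtain Q l where Q: "\<forall>a\<in>A. \<exists>t. run Q (f a) (g a) t \<and> t \<le> (len (f a) + 1) ^ l"
    using assms(2) unfolding ptime_def by blast
  show ?thesis
  proof (rule ptimeI[where P = "Seq P Q" and k = "k + (k + 1) * l + 1"])
    fix a assume a: "a \<in> A"
    define n where "n = len (e a) + 1"
    have n: "2 \<le> n" unfolding n_def using len_ge_1[of "e a"] by simp
    obtain s where s: "run P (e a) (f a) s" "s \<le> n ^ k" using P a n_def by blast
    obtain t where t: "run Q (f a) (g a) t" "t \<le> (len (f a) + 1) ^ l" using Q a by blast
    have "len (f a) + 1 \<le> n ^ k + 1" using len_result_le_time[OF s(1)] s(2) by simp
    also have "\<dots> \<le> n ^ (k + 1)" using power_plus_1_le[OF n] .
    finally have "(len (f a) + 1) ^ l \<le> (n ^ (k + 1)) ^ l" by (intro power_mono) auto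
    with t have "t \<le> n ^ ((k + 1) * l)" by (simp only: power_mult)
    with s have "s + t \<le> n ^ k + n ^ ((k + 1) * l)" by simp
    also have "\<dots> \<le> n ^ (k + (k + 1) * l + 1)" by (rule sum_powers_le[OF n])
    finally show "\<exists>t. run (Seq P Q) (e a) (g a) t \<and> t \<le> (len (e a) + 1) ^ (k + (k + 1) * l + 1)"
      using run_Seq[OF s(1) t(1)] n_def by blast
  qed
qed

lemma ptime_subset: "ptime A e f \<Longrightarrow> B \<subseteq> A \<Longrightarrow> ptime B e f"
  unfolding ptime_def by (meson subsetD)

lemma ptime_cong:
  "ptime A e f \<Longrightarrow> (\<And>a. a \<in> A \<Longrightarrow> f a = g a) \<Longrightarrow> ptime A e g"
  unfolding ptime_def by metis

lemma ptime_reindex: "ptime A e f \<Longrightarrow> (\<And>b. b \<in> B \<Longrightarrow> h b \<in> A) \<Longrightarrow> ptime B (\<lambda>b. e (h b)) (\<lambda>b. f (h b))"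
  unfolding ptime_def by meson

lemma ptime_comp:
  assumes "ptime A e f" "\<And>b. b \<in> B \<Longrightarrow> h b \<in> A" "ptime B d (\<lambda>b. e (h b))"
  shows "ptime B d (\<lambda>b. f (h b))"
  using assms(3) ptime_reindex[OF assms(1,2)] by (rule ptime_trans)

subsection \<open>Straight-line programs\<close>

lemma bitlen_le:
  assumes "\<bar>x\<bar> < 2 ^ n" shows "nat (bitlen \<bar>x\<bar>) \<le> n"
proof -
  have "bitlen \<bar>x\<bar> \<le> int n" using assms by (simp add: bitlen_le_iff_power)
  then show ?thesis by simp
qed

lemma less_two_power_bitlen: "\<bar>x\<bar> < 2 ^ nat (bitlen \<bar>x\<bar>)"
  using bitlen_bounds[of "\<bar>x\<bar>"] by (cases "x = 0") auto

lemma nat_bitlen_mono: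
  assumes "\<bar>x\<bar> \<le> \<bar>y\<bar>" shows "nat (bitlen \<bar>x\<bar>) \<le> nat (bitlen \<bar>y\<bar>)"
  using assms less_two_power_bitlen[of y] by (intro bitlen_le) linarith

lemma abs_div_le:
  fixes i j :: int
  shows "\<bar>i div j\<bar> \<le> \<bar>i\<bar>"
proof -
  have pos: "\<bar>i div j\<bar> \<le> \<bar>i\<bar>" if j: "1 \<le> j" for i j :: int
  proof (cases "0 \<le> i")
    case True
    then have "i * 1 \<le> i * j" using j by (intro mult_left_mono) auto
    then have "i div j \<le> (i * j) div j" using j by (intro zdiv_mono1) auto
    moreover have "0 \<le> i div j" using True j by (simp add: pos_imp_zdiv_nonneg_iff)
    ultimately show ?thesis using j by simp
  next
    case False
    then have "i * j \<le> i * 1" using j by (intro mult_left_mono_neg) auto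
    then have "(i * j) div j \<le> i div j" using j by (intro zdiv_mono1) auto
    moreover have "i div j < 0" using False j by (intro div_neg_pos_less0) auto
    ultimately show ?thesis using j by simp
  qed
  consider "1 \<le> j" | "j = 0" | "1 \<le> - j" by linarith
  then show ?thesis
  proof cases
    case 3
    then show ?thesis using pos[of "- j" "- i"] by simp
  qed (use pos in auto)
qed

text \<open>
  The additive constant only serves \<open>Const\<close>; the arithmetic operations do not increase the length,
  because the code of a pair of numbers is longer than both numbers together.
\<close>

lemma len_prim_val: "\<exists>c. \<forall>v. len (prim_val f v) \<le> len v + c"
proof (intro exI allI)
  fix v
  show "len (prim_val f v) \<le> len v + len (prim_val f (Num 0))"
  proof (cases "(f, v)" rule: prim_val.cases)
    case (6 i j)
    define m where "m = max (nat (bitlen \<bar>i\<bar>)) (nat (bitlen \<bar>j\<bar>))"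
    have "\<bar>i\<bar> < 2 ^ m" "\<bar>j\<bar> < 2 ^ m"
      using less_two_power_bitlen[of i] less_two_power_bitlen[of j]
      by (auto simp: m_def intro: order.strict_trans2 power_increasing)
    then have "\<bar>i + j\<bar> < 2 ^ (m + 1)" by simp
    then have "nat (bitlen \<bar>i + j\<bar>) \<le> m + 1" by (rule bitlen_le)
    then show ?thesis using 6 by (simp add: m_def max_def split: if_splits)
  next
    case (7 i j)
    define m where "m = max (nat (bitlen \<bar>i\<bar>)) (nat (bitlen \<bar>j\<bar>))"
    have "\<bar>i\<bar> < 2 ^ m" "\<bar>j\<bar> < 2 ^ m"
      using less_two_power_bitlen[of i] less_two_power_bitlen[of j]
      by (auto simp: m_def intro: order.strict_trans2 power_increasing)
    then have "\<bar>i - j\<bar> < 2 ^ (m + 1)" by simp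
    then have "nat (bitlen \<bar>i - j\<bar>) \<le> m + 1" by (rule bitlen_le)
    then show ?thesis using 7 by (simp add: m_def max_def split: if_splits)
  next
    case (8 i j)
    have "\<bar>i * j\<bar> < 2 ^ nat (bitlen \<bar>i\<bar>) * 2 ^ nat (bitlen \<bar>j\<bar>)"
      unfolding abs_mult by (intro mult_strict_mono less_two_power_bitlen) auto
    then have "nat (bitlen \<bar>i * j\<bar>) \<le> nat (bitlen \<bar>i\<bar>) + nat (bitlen \<bar>j\<bar>)"
      by (intro bitlen_le) (simp add: power_add)
    then show ?thesis using 8 by simp
  next
    case (9 i j)
    then show ?thesis using nat_bitlen_mono[OF abs_div_le[of i j]] by simp
  next
    case (10 i j)
    have "bitlen 1 = 1" using bitlen_pow2[of 1 0] by (simp add: bitlen_alt_def)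
    then show ?thesis using 10 by simp
  qed (auto simp: bitlen_alt_def)
qed

lemma ptime_prim: "ptime A e (\<lambda>a. prim_val f (e a))"
proof -
  obtain c where c: "\<forall>v. len (prim_val f v) \<le> len v + c" using len_prim_val by blast
  show ?thesis
  proof (rule ptimeI[where P = "Prim f" and k = "2 + c + 1"], intro exI conjI)
    fix a
    define n where "n = len (e a) + 1"
    have n: "2 \<le> n" unfolding n_def using len_ge_1[of "e a"] by simp
    show "run (Prim f) (e a) (prim_val f (e a)) (len (e a) + len (prim_val f (e a)))" by (rule run_Prim)
    have "2 * n \<le> n ^ 2" unfolding power2_eq_square using n by (rule mult_right_mono) simp
    have "len (e a) + len (prim_val f (e a)) \<le> 2 * n + c" using c[rule_format, of "e a"] by (simp add: n_def)
    also have "\<dots> \<le> n ^ 2 + n ^ c" using const_le_power[OF n, of c] \<open>2 * n \<le> n ^ 2\<close> by (rule add_mono[rotated])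
    also have "\<dots> \<le> n ^ (2 + c + 1)" by (rule sum_powers_le[OF n])
    finally show "len (e a) + len (prim_val f (e a)) \<le> (len (e a) + 1) ^ (2 + c + 1)" by (simp add: n_def)
  qed
qed

lemma ptime_prim_comp: "ptime A e f \<Longrightarrow> ptime A e (\<lambda>a. prim_val p (f a))"
  by (rule ptime_trans[OF _ ptime_prim])

lemma ptime_id: "ptime A e e"
  using ptime_prim[of A e Id] by simp

lemma ptime_const_Num: "ptime A e (\<lambda>_. Num i)"
  using ptime_prim[of A e "Const i"] by simp

lemma ptime_Pr:
  assumes "ptime A e f" "ptime A e g" shows "ptime A e (\<lambda>a. Pr (f a) (g a))"
proof -
  obtain P k where P: "\<forall>a\<in>A. \<exists>t. run P (e a) (f a) t \<and> t \<le> (len (e a) + 1) ^ k"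
    using assms(1) unfolding ptime_def by blast
  obtain Q l where Q: "\<forall>a\<in>A. \<exists>t. run Q (e a) (g a) t \<and> t \<le> (len (e a) + 1) ^ l"
    using assms(2) unfolding ptime_def by blast
  show ?thesis
  proof (rule ptimeI[where P = "Fork P Q" and k = "(k + l + 1) + 2 + 1"])
    fix a assume a: "a \<in> A"
    define n where "n = len (e a) + 1"
    have n: "2 \<le> n" unfolding n_def using len_ge_1[of "e a"] by simp
    obtain s where s: "run P (e a) (f a) s" "s \<le> n ^ k" using P a n_def by blast
    obtain t where t: "run Q (e a) (g a) t" "t \<le> n ^ l" using Q a n_def by blast
    have "s + t + len (e a) + len (Pr (f a) (g a)) \<le> 2 * (s + t) + n"
      using len_result_le_time[OF s(1)] len_result_le_time[OF t(1)] by (simp add: n_def)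
    also have "\<dots> \<le> 2 * n ^ (k + l + 1) + n"
      using s(2) t(2) sum_powers_le[OF n, of k l] by simp
    also have "\<dots> \<le> n ^ (k + l + 1) * n + n ^ 1 * n" using n by (intro add_mono) auto
    also have "\<dots> = (n ^ (k + l + 1) + n ^ 1) * n" by (simp only: distrib_right)
    also have "\<dots> \<le> n ^ ((k + l + 1) + 1 + 1) * n" by (intro mult_right_mono sum_powers_le[OF n]) simp
    also have "\<dots> = n ^ ((k + l + 1) + 2 + 1)" by simp
    finally show "\<exists>t. run (Fork P Q) (e a) (Pr (f a) (g a)) t \<and> t \<le> (len (e a) + 1) ^ ((k + l + 1) + 2 + 1)"
      using run_Fork[OF s(1) t(1)] n_def by blast
  qed
qed

lemma ptime_If:
  assumes "ptime A e c" "ptime {a \<in> A. c a \<noteq> Num 0} e f" "ptime {a \<in> A. c a = Num 0} e g"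
  shows "ptime A e (\<lambda>a. if c a \<noteq> Num 0 then f a else g a)"
proof -
  obtain B j where B: "\<forall>a\<in>A. \<exists>t. run B (e a) (c a) t \<and> t \<le> (len (e a) + 1) ^ j"
    using assms(1) unfolding ptime_def by blast
  obtain P k where P: "\<forall>a\<in>{a \<in> A. c a \<noteq> Num 0}. \<exists>t. run P (e a) (f a) t \<and> t \<le> (len (e a) + 1) ^ k"
    using assms(2) unfolding ptime_def by blast
  obtain Q l where Q: "\<forall>a\<in>{a \<in> A. c a = Num 0}. \<exists>t. run Q (e a) (g a) t \<and> t \<le> (len (e a) + 1) ^ l"
    using assms(3) unfolding ptime_def by blast
  show ?thesis
  proof (rule ptimeI[where P = "If B P Q" and k = "(j + (k + l) + 1) + 1 + 1"])
    fix a assume a: "a \<in> A"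
    define n where "n = len (e a) + 1"
    have n: "2 \<le> n" unfolding n_def using len_ge_1[of "e a"] by simp
    obtain s where s: "run B (e a) (c a) s" "s \<le> n ^ j" using B a n_def by blast
    have bound: "s + t + len (e a) \<le> (len (e a) + 1) ^ ((j + (k + l) + 1) + 1 + 1)" if "t \<le> n ^ (k + l)" for t
    proof -
      have "s + t + len (e a) \<le> n ^ j + n ^ (k + l) + n ^ 1" using that s(2) by (simp add: n_def)
      also have "\<dots> \<le> n ^ (j + (k + l) + 1) + n ^ 1"
        using sum_powers_le[OF n, of j "k + l"] by simp
      also have "\<dots> \<le> n ^ ((j + (k + l) + 1) + 1 + 1)" by (rule sum_powers_le[OF n])
      finally show ?thesis by (simp add: n_def)
    qed
    show "\<exists>t. run (If B P Q) (e a) (if c a \<noteq> Num 0 then f a else g a) t \<and>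
        t \<le> (len (e a) + 1) ^ ((j + (k + l) + 1) + 1 + 1)"
    proof (cases "c a = Num 0")
      case True
      then obtain t where t: "run Q (e a) (g a) t" "t \<le> n ^ l" using Q a n_def by blast
      have "n ^ l \<le> n ^ (k + l)" using n by (intro power_increasing) auto
      then show ?thesis using run_If_false[OF _ t(1), of B s P] s(1) True bound[of t] t(2) by auto
    next
      case False
      then obtain t where t: "run P (e a) (f a) t" "t \<le> n ^ k" using P a n_def by blast
      have "n ^ k \<le> n ^ (k + l)" using n by (intro power_increasing) auto
      then show ?thesis using run_If_true[OF s(1) False t(1), of Q] False bound[of t] t(2) by auto
    qed
  qed
qed

subsection \<open>Loops\<close>

text \<open>
  The function \<open>m\<close> is a variant of the loop and \<open>T\<close> bounds the time of every single test and pass;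
  the state after the loop is some iterate of the pass that fails the test.
\<close>

lemma run_While:
  fixes m :: "'a \<Rightarrow> nat"
  assumes cond: "\<And>a. a \<in> A \<Longrightarrow> \<exists>t. run B (e a) (c a) t \<and> t \<le> T"
    and body: "\<And>a. a \<in> A \<Longrightarrow> c a \<noteq> Num 0 \<Longrightarrow> \<exists>t. run P (e a) (e (s a)) t \<and> t \<le> T"
    and inv: "\<And>a. a \<in> A \<Longrightarrow> c a \<noteq> Num 0 \<Longrightarrow> s a \<in> A \<and> m (s a) < m a"
    and len: "\<And>a. a \<in> A \<Longrightarrow> len (e a) \<le> T"
    and "a \<in> A"
  shows "\<exists>i t. run (While B P) (e a) (e ((s ^^ i) a)) t \<and> (s ^^ i) a \<in> A \<and> c ((s ^^ i) a) = Num 0 \<and>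
    t \<le> 3 * T * (m a + 1)"
  using \<open>a \<in> A\<close>
proof (induction "m a" arbitrary: a rule: less_induct)
  case less
  note a = less.prems
  obtain t1 where t1: "run B (e a) (c a) t1" "t1 \<le> T" using cond[OF a] by blast
  show ?case
  proof (cases "c a = Num 0")
    case True
    have "run (While B P) (e a) (e ((s ^^ 0) a)) (t1 + len (e a))"
      using run_While_stop[of B "e a" t1 P] t1(1) True by simp
    moreover have "t1 + len (e a) \<le> 3 * T * (m a + 1)" using t1(2) len[OF a] by simp
    ultimately show ?thesis using True a by (intro exI[of _ 0] exI[of _ "t1 + len (e a)"]) simp
  next
    case False
    obtain t2 where t2: "run P (e a) (e (s a)) t2" "t2 \<le> T" using body[OF a False] by blast
    have sa: "s a \<in> A" "m (s a) < m a" using inv[OF a False] by auto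
    obtain i t3 where t3: "run (While B P) (e (s a)) (e ((s ^^ i) (s a))) t3"
      "(s ^^ i) (s a) \<in> A" "c ((s ^^ i) (s a)) = Num 0" "t3 \<le> 3 * T * (m (s a) + 1)"
      using less.hyps[OF sa(2,1)] by blast
    have "3 * T * (m (s a) + 1) \<le> 3 * T * m a" using sa(2) by (intro mult_left_mono) auto
    then have "t1 + t2 + t3 + len (e a) \<le> 3 * T * (m a + 1)"
      using t1(2) t2(2) t3(4) len[OF a] by simp
    moreover have "run (While B P) (e a) (e ((s ^^ Suc i) a)) (t1 + t2 + t3 + len (e a))"
      using run_While_step[OF t1(1) False t2(1) t3(1)] by (simp add: funpow_swap1)
    ultimately show ?thesis using t3 by (intro exI[of _ "Suc i"] exI) (auto simp: funpow_swap1)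
  qed
qed

subsection \<open>Lists\<close>

lemma len_enc_list: "len (enc_list vs) = 1 + (\<Sum>v\<leftarrow>vs. len v + 1)"
  by (induction vs) auto

lemma enc_list_eq_0_iff [simp]: "enc_list vs = Num 0 \<longleftrightarrow> vs = []"
  by (cases vs) auto

lemma length_le_len_enc_list: "length vs \<le> len (enc_list vs)"
  by (induction vs) auto

lemma len_enc_list_drop: "len (enc_list (drop i vs)) \<le> len (enc_list vs)"
proof -
  have "len (enc_list vs) = len (enc_list (take i vs @ drop i vs))" by simp
  then show ?thesis unfolding len_enc_list map_append sum_list_append by linarith
qed

lemma len_le_len_enc_list: "v \<in> set vs \<Longrightarrow> len v \<le> len (enc_list vs)"
  by (induction vs) auto

lemma ptime_len:
  assumes "ptime A e f" shows "\<exists>k. \<forall>a\<in>A. len (f a) \<le> (len (e a) + 1) ^ k"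
  using assms len_result_le_time order_trans unfolding ptime_def by meson

lemma ptime_Fst: "ptime A e (\<lambda>a. Pr (f a) (g a)) \<Longrightarrow> ptime A e f"
  using ptime_prim_comp[of A e "\<lambda>a. Pr (f a) (g a)" Fst] by simp

lemma ptime_Snd: "ptime A e (\<lambda>a. Pr (f a) (g a)) \<Longrightarrow> ptime A e g"
  using ptime_prim_comp[of A e "\<lambda>a. Pr (f a) (g a)" Snd] by simp

lemma ptime_hd:
  assumes "ptime A e (\<lambda>a. enc_list (f a))" "\<And>a. a \<in> A \<Longrightarrow> f a \<noteq> []"
  shows "ptime A e (\<lambda>a. hd (f a))"
proof (rule ptime_cong[OF ptime_prim_comp[OF assms(1), of Fst]])
  show "prim_val Fst (enc_list (f a)) = hd (f a)" if "a \<in> A" for a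
    using assms(2)[OF that] by (cases "f a") auto
qed

lemma ptime_tl:
  assumes "ptime A e (\<lambda>a. enc_list (f a))"
  shows "ptime A e (\<lambda>a. enc_list (tl (f a)))"
proof (rule ptime_cong[OF ptime_prim_comp[OF assms, of Snd]])
  show "prim_val Snd (enc_list (f a)) = enc_list (tl (f a))" for a
    by (cases "f a") auto
qed

text \<open>
  The one loop behind all operations on lists. Polynomial steps alone would not suffice, as an
  accumulator could square itself in each step; hence the bound on all intermediate accumulators.
\<close>

lemma ptime_fold:
  fixes xs :: "'a \<Rightarrow> 'b list" and z :: "'a \<Rightarrow> 'c"
  assumes xs: "ptime A e (\<lambda>a. enc_list (map ex (xs a)))"
    and z: "ptime A e (\<lambda>a. ec (z a))"
    and step: "ptime {(a, x, c). a \<in> A \<and> x \<in> set (xs a)}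
      (\<lambda>(a, x, c). Pr (e a) (Pr (ex x) (ec c))) (\<lambda>(a, x, c). ec (s a x c))"
    and bound: "\<And>a i. a \<in> A \<Longrightarrow> len (ec (fold (s a) (take i (xs a)) (z a))) \<le> (len (e a) + 1) ^ k"
  shows "ptime A e (\<lambda>a. ec (fold (s a) (xs a) (z a)))"
proof -
  define E where "E = (\<lambda>(a, ys, c). Pr (e a) (Pr (enc_list (map ex ys)) (ec c)))"
  \<comment> \<open>A loop state consists of the context, the list still to be read and the accumulator.\<close>
  define S where "S = {(a, drop i (xs a), fold (s a) (take i (xs a)) (z a)) | a i. a \<in> A}"
  define S' where "S' = {\<sigma> \<in> S. fst (snd \<sigma>) \<noteq> []}"
  define nxt where "nxt = (\<lambda>(a, ys, c). (a, tl ys, s a (hd ys) c))"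
  have E: "ptime B E (\<lambda>\<sigma>. Pr (e (fst \<sigma>)) (Pr (enc_list (map ex (fst (snd \<sigma>)))) (ec (snd (snd \<sigma>)))))" for B
    using ptime_id[of B E] unfolding E_def by (simp add: case_prod_unfold)
  note Ea = ptime_Fst[OF E] and Ey = ptime_Fst[OF ptime_Snd[OF E]] and Ec = ptime_Snd[OF ptime_Snd[OF E]]
  have nxt_S: "nxt \<sigma> \<in> S" if \<sigma>S: "\<sigma> \<in> S'" for \<sigma>
  proof -
    obtain a i where a: "a \<in> A" and \<sigma>: "\<sigma> = (a, drop i (xs a), fold (s a) (take i (xs a)) (z a))"
      and ne: "drop i (xs a) \<noteq> []" using \<sigma>S unfolding S'_def S_def by force
    have "nxt \<sigma> = (a, drop (Suc i) (xs a), fold (s a) (take (Suc i) (xs a)) (z a))"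
      using ne unfolding \<sigma> nxt_def
      by (simp add: drop_Suc tl_drop take_Suc_conv_app_nth hd_drop_conv_nth)
    then show ?thesis using a unfolding S_def by blast
  qed
  have in_step: "(fst \<sigma>, hd (fst (snd \<sigma>)), snd (snd \<sigma>)) \<in> {(a, x, c). a \<in> A \<and> x \<in> set (xs a)}"
    if "\<sigma> \<in> S'" for \<sigma>
    using that unfolding S'_def S_def by (auto simp: hd_drop_conv_nth not_le)
  have hd: "ptime S' E (\<lambda>\<sigma>. ex (hd (fst (snd \<sigma>))))"
    by (rule ptime_cong[OF ptime_hd[OF Ey]]) (auto simp: S'_def hd_map)
  have "ptime S' E (\<lambda>\<sigma>. ec (s (fst \<sigma>) (hd (fst (snd \<sigma>))) (snd (snd \<sigma>))))"
    using ptime_comp[OF step, of S' "\<lambda>\<sigma>. (fst \<sigma>, hd (fst (snd \<sigma>)), snd (snd \<sigma>))" E]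
      in_step ptime_Pr[OF Ea ptime_Pr[OF hd Ec]] by simp
  then have "ptime S' E (\<lambda>\<sigma>. E (nxt \<sigma>))"
    using ptime_Pr[OF Ea ptime_Pr[OF ptime_tl[OF Ey]], of S']
    unfolding E_def nxt_def by (simp add: case_prod_unfold map_tl)
  then obtain P kP where P: "\<forall>\<sigma>\<in>S'. \<exists>t. run P (E \<sigma>) (E (nxt \<sigma>)) t \<and> t \<le> (len (E \<sigma>) + 1) ^ kP"
    unfolding ptime_def by blast
  obtain B kB where B: "\<forall>\<sigma>\<in>S. \<exists>t. run B (E \<sigma>) (enc_list (map ex (fst (snd \<sigma>)))) t \<and> t \<le> (len (E \<sigma>) + 1) ^ kB"
    using Ey[of S] unfolding ptime_def by blast
  define fin where "fin = (\<lambda>a. (a, [] :: 'b list, fold (s a) (xs a) (z a)))"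
  have "ptime A (\<lambda>a. E (a, xs a, z a)) (\<lambda>a. E (fin a))"
  proof (rule ptimeI[where P = "While B P" and k = "3 + (k + 4) * (kB + kP + 1)"])
    fix a assume a: "a \<in> A"
    define n where "n = len (E (a, xs a, z a)) + 1"
    define K where "K = kB + kP + 1"
    define T where "T = n ^ ((k + 4) * K)"
    have n: "2 \<le> n" unfolding n_def using len_ge_1 by simp
    have ea: "len (e a) + 1 \<le> n" unfolding n_def by (simp add: E_def)
    define S1 where "S1 = {\<sigma> \<in> S. fst \<sigma> = a}"
    have lenE: "len (E \<sigma>) + 1 \<le> n ^ (k + 4)" if \<sigma>: "\<sigma> \<in> S1" for \<sigma>
    proof -
      obtain i where i: "\<sigma> = (a, drop i (xs a), fold (s a) (take i (xs a)) (z a))"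
        using \<sigma> unfolding S1_def S_def by auto
      have "len (e a) + len (enc_list (map ex (drop i (xs a)))) + 2 \<le> n"
        using len_enc_list_drop[of i "map ex (xs a)"] len_ge_1 by (simp add: n_def E_def drop_map)
      moreover have "len (ec (fold (s a) (take i (xs a)) (z a))) \<le> n ^ k"
        using bound[OF a, of i] power_mono[OF ea, of k] by simp
      ultimately have "len (E \<sigma>) + 1 \<le> n ^ 1 + n ^ k + 1" unfolding i E_def by simp
      also have "\<dots> \<le> n ^ (1 + k + 1) + 1" using sum_powers_le[OF n, of 1 k] by simp
      also have "\<dots> \<le> n ^ (1 + k + 1 + 1)" by (rule power_plus_1_le[OF n])
      also have "\<dots> \<le> n ^ (k + 4)" using n by (intro power_increasing) auto
      finally show ?thesis .
    qed
    have T: "(len (E \<sigma>) + 1) ^ j \<le> T" if "\<sigma> \<in> S1" "j \<le> K" for \<sigma> j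
    proof -
      have "(len (E \<sigma>) + 1) ^ j \<le> (len (E \<sigma>) + 1) ^ K" using that by (intro power_increasing) auto
      also have "\<dots> \<le> (n ^ (k + 4)) ^ K" using lenE[OF that(1)] by (intro power_mono) auto
      finally show ?thesis by (simp only: T_def power_mult)
    qed
    let ?a = "(a, xs a, z a)"
    have "\<exists>i t. run (While B P) (E ?a) (E ((nxt ^^ i) ?a)) t \<and> (nxt ^^ i) ?a \<in> S1 \<and>
        enc_list (map ex (fst (snd ((nxt ^^ i) ?a)))) = Num 0 \<and> t \<le> 3 * T * (length (fst (snd ?a)) + 1)"
    proof (rule run_While[where m = "\<lambda>\<sigma>. length (fst (snd \<sigma>))" and c = "\<lambda>\<sigma>. enc_list (map ex (fst (snd \<sigma>)))"])
      fix \<sigma> assume \<sigma>: "\<sigma> \<in> S1"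
      have "\<sigma> \<in> S" using \<sigma> by (simp add: S1_def)
      then obtain t where "run B (E \<sigma>) (enc_list (map ex (fst (snd \<sigma>)))) t" "t \<le> (len (E \<sigma>) + 1) ^ kB"
        using B by blast
      then show "\<exists>t. run B (E \<sigma>) (enc_list (map ex (fst (snd \<sigma>)))) t \<and> t \<le> T"
        using T[OF \<sigma>, of kB] by (auto simp: K_def)
      show "len (E \<sigma>) \<le> T" using T[OF \<sigma>, of 1] by (auto simp: K_def)
      assume "enc_list (map ex (fst (snd \<sigma>))) \<noteq> Num 0"
      then have \<sigma>': "\<sigma> \<in> S'" using \<open>\<sigma> \<in> S\<close> by (simp add: S'_def)
      then obtain t where "run P (E \<sigma>) (E (nxt \<sigma>)) t" "t \<le> (len (E \<sigma>) + 1) ^ kP" using P by blast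
      then show "\<exists>t. run P (E \<sigma>) (E (nxt \<sigma>)) t \<and> t \<le> T" using T[OF \<sigma>, of kP] by (auto simp: K_def)
      show "nxt \<sigma> \<in> S1 \<and> length (fst (snd (nxt \<sigma>))) < length (fst (snd \<sigma>))"
        using nxt_S[OF \<sigma>'] \<sigma> \<sigma>' by (auto simp: S1_def nxt_def S'_def split: prod.splits)
    next
      have "?a = (a, drop 0 (xs a), fold (s a) (take 0 (xs a)) (z a))" by simp
      then have "?a \<in> S" unfolding S_def using a by blast
      then show "?a \<in> S1" by (simp add: S1_def)
    qed
    then obtain i t where t: "run (While B P) (E ?a) (E ((nxt ^^ i) ?a)) t" "(nxt ^^ i) ?a \<in> S1"
        "fst (snd ((nxt ^^ i) ?a)) = []" "t \<le> 3 * T * (length (xs a) + 1)" by auto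
    have "(nxt ^^ i) ?a = fin a" using t(2,3) unfolding S1_def S_def fin_def by auto
    moreover have "t \<le> n ^ (3 + (k + 4) * (kB + kP + 1))"
    proof -
      have "length (xs a) + 1 \<le> n" using length_le_len_enc_list[of "map ex (xs a)"] by (simp add: n_def E_def)
      then have "t \<le> 3 * T * n" using t(4) by (meson mult_le_mono2 order_trans)
      also have "\<dots> \<le> (n * n) * T * n" using mult_le_mono[OF n n] by (intro mult_right_mono) auto
      also have "\<dots> = n ^ (3 + (k + 4) * K)" by (simp add: T_def power_add eval_nat_numeral)
      finally show ?thesis by (simp add: K_def)
    qed
    ultimately show "\<exists>t. run (While B P) (E (a, xs a, z a)) (E (fin a)) t \<and>
        t \<le> (len (E (a, xs a, z a)) + 1) ^ (3 + (k + 4) * (kB + kP + 1))"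
      using t(1) unfolding n_def by auto
  qed
  moreover have "ptime A e (\<lambda>a. E (a, xs a, z a))"
    unfolding E_def using ptime_Pr[OF ptime_id ptime_Pr[OF xs z]] by simp
  ultimately have "ptime A e (\<lambda>a. E (fin a))" by (blast intro: ptime_trans)
  then show ?thesis unfolding E_def fin_def by (auto dest: ptime_Snd)
qed

text \<open>
  Folding with \<open>Cons\<close> reverses, so reversal comes before concatenation.
\<close>

lemma ptime_rev_append:
  assumes xs: "ptime A e (\<lambda>a. enc_list (map ex (xs a)))" and ys: "ptime A e (\<lambda>a. enc_list (map ex (ys a)))"
  shows "ptime A e (\<lambda>a. enc_list (map ex (rev (xs a) @ ys a)))"
proof -
  obtain k where k: "\<forall>a\<in>A. len (enc_list (map ex (xs a))) \<le> (len (e a) + 1) ^ k" using ptime_len[OF xs] by blast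
  obtain l where l: "\<forall>a\<in>A. len (enc_list (map ex (ys a))) \<le> (len (e a) + 1) ^ l" using ptime_len[OF ys] by blast
  have fold: "fold (#) us vs = rev us @ vs" for us vs :: "'b list"
    by (induction us arbitrary: vs) auto
  have "ptime A e (\<lambda>a. enc_list (map ex (fold (#) (xs a) (ys a))))"
  proof (rule ptime_fold[OF xs, of "\<lambda>ys. enc_list (map ex ys)" ys "\<lambda>_. (#)"])
    show "ptime {(a, x, c). a \<in> A \<and> x \<in> set (xs a)}
        (\<lambda>(a, x, c). Pr (e a) (Pr (ex x) (enc_list (map ex c)))) (\<lambda>(a, x, c). enc_list (map ex (x # c)))"
      (is "ptime ?S ?e _")
    proof -
      have "ptime ?S ?e (\<lambda>\<sigma>. Pr (e (fst \<sigma>)) (Pr (ex (fst (snd \<sigma>))) (enc_list (map ex (snd (snd \<sigma>))))))"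
        using ptime_id[of ?S ?e] by (simp add: case_prod_unfold)
      then show ?thesis by (auto dest: ptime_Snd simp: case_prod_unfold)
    qed
    fix a i assume a: "a \<in> A"
    have "len (enc_list (map ex (fold (#) (take i (xs a)) (ys a)))) \<le>
        len (enc_list (map ex (xs a))) + len (enc_list (map ex (ys a)))"
    proof -
      have "len (enc_list (map ex (xs a))) = len (enc_list (map ex (take i (xs a) @ drop i (xs a))))" by simp
      then show ?thesis unfolding fold len_enc_list map_append sum_list_append
        by (simp add: rev_map[symmetric])
    qed
    also have "\<dots> \<le> (len (e a) + 1) ^ k + (len (e a) + 1) ^ l" using k l a by (simp add: add_mono)
    also have "\<dots> \<le> (len (e a) + 1) ^ (k + l + 1)" using len_ge_1[of "e a"] by (intro sum_powers_le) simp
    finally show "len (enc_list (map ex (fold (#) (take i (xs a)) (ys a)))) \<le> (len (e a) + 1) ^ (k + l + 1)" .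
  qed (rule ys)
  then show ?thesis by (simp only: fold)
qed

lemma ptime_Nil: "ptime A e (\<lambda>a. enc_list (map ex []))"
  using ptime_const_Num[of A e 0] by simp

lemma ptime_rev:
  assumes xs: "ptime A e (\<lambda>a. enc_list (map ex (xs a)))"
  shows "ptime A e (\<lambda>a. enc_list (map ex (rev (xs a))))"
  using ptime_rev_append[OF xs ptime_Nil] by simp

lemma ptime_append:
  assumes xs: "ptime A e (\<lambda>a. enc_list (map ex (xs a)))" and ys: "ptime A e (\<lambda>a. enc_list (map ex (ys a)))"
  shows "ptime A e (\<lambda>a. enc_list (map ex (xs a @ ys a)))"
  using ptime_rev_append[OF ptime_rev[OF xs] ys] by simp

lemma sum_list_concat: "sum_list (concat xss) = (\<Sum>xs\<leftarrow>xss. sum_list (xs :: nat list))"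
  by (induction xss) auto

text \<open>
  List comprehension. The accumulator of the underlying fold only collects results that
  depend on the context and one list element, so its length stays polynomial. The function that is mapped
  is computed from the code of the context paired with that of the element.
\<close>

lemma ptime_concat_map:
  assumes xs: "ptime A e (\<lambda>a. enc_list (map ex (xs a)))"
    and h: "ptime (SIGMA a:A. set (xs a)) (\<lambda>\<sigma>. Pr (e (fst \<sigma>)) (ex (snd \<sigma>)))
      (\<lambda>\<sigma>. enc_list (map ey (h (fst \<sigma>) (snd \<sigma>))))"
  shows "ptime A e (\<lambda>a. enc_list (map ey (concat (map (h a) (xs a)))))"
proof -
  obtain k where k: "\<forall>a\<in>A. len (enc_list (map ex (xs a))) \<le> (len (e a) + 1) ^ k" using ptime_len[OF xs] by blast
  obtain l where l: "\<forall>\<sigma>\<in>(SIGMA a:A. set (xs a)). len (enc_list (map ey (h (fst \<sigma>) (snd \<sigma>)))) \<le>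
      (len (Pr (e (fst \<sigma>)) (ex (snd \<sigma>))) + 1) ^ l"
    using ptime_len[OF h] by blast
  have fold: "fold (\<lambda>x c. rev (h a x) @ c) us vs = rev (concat (map (h a) us)) @ vs" for a us vs
    by (induction us arbitrary: vs) auto
  have "ptime A e (\<lambda>a. enc_list (map ey (fold (\<lambda>x c. rev (h a x) @ c) (xs a) [])))"
  proof (rule ptime_fold[OF xs, of "\<lambda>ys. enc_list (map ey ys)"])
    let ?S = "{(a, x, c). a \<in> A \<and> x \<in> set (xs a)}"
    let ?e = "\<lambda>(a, x, c). Pr (e a) (Pr (ex x) (enc_list (map ey c)))"
    have id: "ptime ?S ?e (\<lambda>\<sigma>. Pr (e (fst \<sigma>)) (Pr (ex (fst (snd \<sigma>))) (enc_list (map ey (snd (snd \<sigma>))))))"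
      using ptime_id[of ?S ?e] by (simp add: case_prod_unfold)
    have "ptime ?S ?e (\<lambda>\<sigma>. Pr (e (fst \<sigma>)) (ex (fst (snd \<sigma>))))"
      by (rule ptime_Pr[OF ptime_Fst[OF id] ptime_Fst[OF ptime_Snd[OF id]]])
    then have "ptime ?S ?e (\<lambda>\<sigma>. enc_list (map ey (h (fst \<sigma>) (fst (snd \<sigma>)))))"
      using ptime_comp[OF h, of ?S "\<lambda>\<sigma>. (fst \<sigma>, fst (snd \<sigma>))" ?e] by (auto simp: case_prod_unfold)
    then have "ptime ?S ?e (\<lambda>\<sigma>. enc_list (map ey (rev (h (fst \<sigma>) (fst (snd \<sigma>))) @ snd (snd \<sigma>))))"
      by (rule ptime_rev_append) (rule ptime_Snd[OF ptime_Snd[OF id]])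
    then show "ptime ?S ?e (\<lambda>(a, x, c). enc_list (map ey (rev (h a x) @ c)))"
      by (simp add: case_prod_unfold)
    fix a i assume a: "a \<in> A"
    define n where "n = len (e a) + 1"
    have n: "2 \<le> n" unfolding n_def using len_ge_1[of "e a"] by simp
    have each: "len (enc_list (map ey (h a x))) \<le> n ^ ((k + 3) * l)" if x: "x \<in> set (xs a)" for x
    proof -
      have "len (ex x) \<le> len (enc_list (map ex (xs a)))" using x by (intro len_le_len_enc_list) simp
      then have "len (ex x) \<le> n ^ k" using k a unfolding n_def by fastforce
      then have "len (Pr (e a) (ex x)) + 1 \<le> n ^ 1 + n ^ k + 1" by (simp add: n_def)
      also have "\<dots> \<le> n ^ (1 + k + 1) + 1" using sum_powers_le[OF n, of 1 k] by simp
      also have "\<dots> \<le> n ^ (1 + k + 1 + 1)" by (rule power_plus_1_le[OF n])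
      also have "\<dots> = n ^ (k + 3)" by (simp add: eval_nat_numeral)
      finally have "(len (Pr (e a) (ex x)) + 1) ^ l \<le> (n ^ (k + 3)) ^ l" by (intro power_mono) auto
      moreover have "len (enc_list (map ey (h a x))) \<le> (len (Pr (e a) (ex x)) + 1) ^ l"
        using l[rule_format, of "(a, x)"] a x by simp
      ultimately show ?thesis by (simp only: power_mult)
    qed
    have "len (enc_list (map ey (fold (\<lambda>x c. rev (h a x) @ c) (take i (xs a)) []))) =
        1 + (\<Sum>x\<leftarrow>take i (xs a). \<Sum>y\<leftarrow>h a x. len (ey y) + 1)"
      unfolding fold len_enc_list append_Nil2
      by (simp add: rev_map[symmetric] o_def map_concat sum_list_concat)
    also have "\<dots> \<le> 1 + (\<Sum>x\<leftarrow>take i (xs a). n ^ ((k + 3) * l))"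
      by (intro add_left_mono sum_list_mono) (use each in \<open>force simp: len_enc_list o_def dest: in_set_takeD\<close>)
    also have "\<dots> \<le> 1 + n ^ k * n ^ ((k + 3) * l)"
    proof -
      have "length (take i (xs a)) \<le> length (map ex (xs a))" by simp
      also have "\<dots> \<le> n ^ k" using length_le_len_enc_list[of "map ex (xs a)"] k a unfolding n_def by fastforce
      finally show ?thesis by (simp add: sum_list_triv)
    qed
    also have "\<dots> \<le> n ^ (k + (k + 3) * l + 1)"
      using power_plus_1_le[OF n, of "k + (k + 3) * l"] by (simp add: power_add)
    finally show "len (enc_list (map ey (fold (\<lambda>x c. rev (h a x) @ c) (take i (xs a)) []))) \<le>
        (len (e a) + 1) ^ (k + (k + 3) * l + 1)" by (simp add: n_def)
  qed (rule ptime_Nil)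
  then show ?thesis using ptime_rev unfolding fold by fastforce
qed

subsection \<open>Integer arithmetic, tests and list comprehension\<close>

abbreviation pint :: "'a set \<Rightarrow> ('a \<Rightarrow> val) \<Rightarrow> ('a \<Rightarrow> int) \<Rightarrow> bool" where
  "pint A e f \<equiv> ptime A e (\<lambda>a. Num (f a))"

abbreviation pbool :: "'a set \<Rightarrow> ('a \<Rightarrow> val) \<Rightarrow> ('a \<Rightarrow> bool) \<Rightarrow> bool" where
  "pbool A e b \<equiv> pint A e (\<lambda>a. if b a then 1 else 0)"

lemma pint_add: "pint A e f \<Longrightarrow> pint A e g \<Longrightarrow> pint A e (\<lambda>a. f a + g a)"
  using ptime_prim_comp[OF ptime_Pr, of A e _ _ Add] by fastforce

lemma pint_diff: "pint A e f \<Longrightarrow> pint A e g \<Longrightarrow> pint A e (\<lambda>a. f a - g a)"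
  using ptime_prim_comp[OF ptime_Pr, of A e _ _ Sub] by fastforce

lemma pint_minus: "pint A e f \<Longrightarrow> pint A e (\<lambda>a. - f a)"
  using pint_diff[OF ptime_const_Num[of A e 0], of f] by simp

lemma pint_mult: "pint A e f \<Longrightarrow> pint A e g \<Longrightarrow> pint A e (\<lambda>a. f a * g a)"
  using ptime_prim_comp[OF ptime_Pr, of A e _ _ Mul] by fastforce

lemma pint_div: "pint A e f \<Longrightarrow> pint A e g \<Longrightarrow> pint A e (\<lambda>a. f a div g a)"
  using ptime_prim_comp[OF ptime_Pr, of A e _ _ Div] by fastforce

lemma pint_sum: "(\<And>i. i < n \<Longrightarrow> pint A e (\<lambda>a. f a i)) \<Longrightarrow> pint A e (\<lambda>a. \<Sum>i<(n::nat). f a i)"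
  by (induction n) (auto intro: ptime_const_Num pint_add)

lemma pint_prod: "(\<And>i. i < n \<Longrightarrow> pint A e (\<lambda>a. f a i)) \<Longrightarrow> pint A e (\<lambda>a. \<Prod>i<(n::nat). f a i)"
  by (induction n) (auto intro: ptime_const_Num pint_mult)

lemma pbool_le: "pint A e f \<Longrightarrow> pint A e g \<Longrightarrow> pbool A e (\<lambda>a. f a \<le> g a)"
  using ptime_prim_comp[OF ptime_Pr, of A e _ _ Leq] by fastforce

lemma pbool_less: "pint A e f \<Longrightarrow> pint A e g \<Longrightarrow> pbool A e (\<lambda>a. f a < g a)"
  using pbool_le[OF pint_add[OF _ ptime_const_Num[of A e 1]], of f g] by (simp add: zless_imp_add1_zle add1_zle_eq)

lemma ptime_ite:
  assumes "pbool A e b" "ptime {a \<in> A. b a} e f" "ptime {a \<in> A. \<not> b a} e g"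
  shows "ptime A e (\<lambda>a. if b a then f a else g a)"
proof -
  have [simp]: "(Num (if b a then 1 else 0) \<noteq> Num 0) = b a" "(Num (if b a then 1 else 0) = Num 0) = (\<not> b a)" for a
    by auto
  show ?thesis using ptime_If[of A e "\<lambda>a. Num (if b a then 1 else 0)" f g] assms by (simp del: val.inject)
qed

lemma pbool_not: "pbool A e b \<Longrightarrow> pbool A e (\<lambda>a. \<not> b a)"
  by (rule ptime_cong[OF ptime_ite[of A e b "\<lambda>_. Num 0" "\<lambda>_. Num 1"]]) (auto intro: ptime_const_Num)

lemma pbool_nonzero: "pint A e f \<Longrightarrow> pbool A e (\<lambda>a. f a \<noteq> 0)"
  by (rule ptime_cong[OF ptime_If[of A e "\<lambda>a. Num (f a)" "\<lambda>_. Num 1" "\<lambda>_. Num 0"]]) (auto intro: ptime_const_Num)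

lemma pbool_conj: "pbool A e b \<Longrightarrow> pbool A e c \<Longrightarrow> pbool A e (\<lambda>a. b a \<and> c a)"
  by (rule ptime_cong[OF ptime_ite[of A e b "\<lambda>a. Num (if c a then 1 else 0)" "\<lambda>_. Num 0"]])
    (auto intro: ptime_const_Num ptime_subset)

lemma pbool_Nil: "ptime A e (\<lambda>a. enc_list (map ex (xs a))) \<Longrightarrow> pbool A e (\<lambda>a. xs a = [])"
  by (rule ptime_cong[OF ptime_If[of A e "\<lambda>a. enc_list (map ex (xs a))" "\<lambda>_. Num 0" "\<lambda>_. Num 1"]])
    (auto intro: ptime_const_Num)

lemma ptime_Cons:
  "ptime A e (\<lambda>a. ex (x a)) \<Longrightarrow> ptime A e (\<lambda>a. enc_list (map ex (xs a))) \<Longrightarrow>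
    ptime A e (\<lambda>a. enc_list (map ex (x a # xs a)))"
  using ptime_Pr[of A e "\<lambda>a. ex (x a)" "\<lambda>a. enc_list (map ex (xs a))"] by simp

text \<open>
  Carries facts about the context into the body of a list comprehension, where the code of a list
  element is paired with it; \<open>ptime_elem\<close> gives access to the element.
\<close>

lemma ptime_lift:
  "ptime A e f \<Longrightarrow> ptime (Sigma A X) (\<lambda>\<sigma>. Pr (e (fst \<sigma>)) (ex (snd \<sigma>))) (\<lambda>\<sigma>. f (fst \<sigma>))"
  by (rule ptime_comp[of A e f "Sigma A X" fst, OF _ _ ptime_Fst[OF ptime_id]]) auto

lemma ptime_elem: "ptime B (\<lambda>\<sigma>. Pr (e (fst \<sigma>)) (ex (snd \<sigma>))) (\<lambda>\<sigma>. ex (snd \<sigma>))"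
  by (rule ptime_Snd[OF ptime_id])

lemma ptime_map:
  assumes "ptime A e (\<lambda>a. enc_list (map ex (xs a)))"
    and "ptime (SIGMA a:A. set (xs a)) (\<lambda>\<sigma>. Pr (e (fst \<sigma>)) (ex (snd \<sigma>))) (\<lambda>\<sigma>. ey (h (fst \<sigma>) (snd \<sigma>)))"
  shows "ptime A e (\<lambda>a. enc_list (map ey (map (h a) (xs a))))"
proof -
  have "ptime A e (\<lambda>a. enc_list (map ey (concat (map (\<lambda>x. [h a x]) (xs a)))))"
    by (rule ptime_concat_map[OF assms(1)] ptime_Cons assms(2) ptime_Nil)+
  moreover have "concat (map (\<lambda>x. [h a x]) ys) = map (h a) ys" for a ys by (induction ys) auto
  ultimately show ?thesis by (simp only:)
qed

lemma ptime_filter: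
  assumes "ptime A e (\<lambda>a. enc_list (map ex (xs a)))"
    and "pbool (SIGMA a:A. set (xs a)) (\<lambda>\<sigma>. Pr (e (fst \<sigma>)) (ex (snd \<sigma>))) (\<lambda>\<sigma>. b (fst \<sigma>) (snd \<sigma>))"
  shows "ptime A e (\<lambda>a. enc_list (map ex (filter (b a) (xs a))))"
proof -
  have "ptime (SIGMA a:A. set (xs a)) (\<lambda>\<sigma>. Pr (e (fst \<sigma>)) (ex (snd \<sigma>)))
      (\<lambda>\<sigma>. if b (fst \<sigma>) (snd \<sigma>) then enc_list (map ex [snd \<sigma>]) else enc_list (map ex []))"
    by (rule ptime_ite[OF assms(2)] ptime_Cons ptime_elem ptime_Nil)+
  then have "ptime (SIGMA a:A. set (xs a)) (\<lambda>\<sigma>. Pr (e (fst \<sigma>)) (ex (snd \<sigma>)))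
      (\<lambda>\<sigma>. enc_list (map ex (if b (fst \<sigma>) (snd \<sigma>) then [snd \<sigma>] else [])))"
    by (rule ptime_cong) simp
  then have "ptime A e (\<lambda>a. enc_list (map ex (concat (map (\<lambda>x. if b a x then [x] else []) (xs a)))))"
    by (rule ptime_concat_map[OF assms(1)])
  moreover have "concat (map (\<lambda>x. if b a x then [x] else []) ys) = filter (b a) ys" for a ys by (induction ys) auto
  ultimately show ?thesis by (simp only:)
qed

lemma pbool_ball:
  assumes "ptime A e (\<lambda>a. enc_list (map ex (xs a)))"
    and "pbool (SIGMA a:A. set (xs a)) (\<lambda>\<sigma>. Pr (e (fst \<sigma>)) (ex (snd \<sigma>))) (\<lambda>\<sigma>. b (fst \<sigma>) (snd \<sigma>))"
  shows "pbool A e (\<lambda>a. \<forall>x\<in>set (xs a). b a x)"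
  using pbool_Nil[OF ptime_filter[OF assms(1) pbool_not[OF assms(2)]]]
  by (rule ptime_cong) (auto simp: filter_empty_conv)

subsection \<open>Vectors of fixed length\<close>

lemma ptime_tuple: "(\<And>j. j \<in> set js \<Longrightarrow> ptime A e (\<lambda>a. f a j)) \<Longrightarrow> ptime A e (\<lambda>a. enc_list (map (f a) js))"
  by (induction js) (auto intro: ptime_const_Num ptime_Pr)

lemma ptime_component:
  assumes "ptime A e (\<lambda>a. enc_list (map (f a) [0..<n]))" "i < n"
  shows "ptime A e (\<lambda>a. f a i)"
proof -
  have "ptime A e (\<lambda>a. enc_list (drop i (map (f a) [0..<n])))"
  proof (induction i)
    case 0
    then show ?case using assms(1) by simp
  next
    case (Suc i)
    from ptime_tl[OF this] show ?case by (simp add: drop_Suc tl_drop)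
  qed
  from ptime_hd[OF this] assms(2) show ?thesis by (simp add: hd_drop_conv_nth)
qed

definition enc_ints :: "nat \<Rightarrow> (nat \<Rightarrow> int) \<Rightarrow> val" where
  "enc_ints n u = enc_list (map (\<lambda>i. Num (u i)) [0..<n])"

lemma ptime_enc_intsI:
  "(\<And>i. i < n \<Longrightarrow> pint A e (\<lambda>a. u a i)) \<Longrightarrow> ptime A e (\<lambda>a. enc_ints n (u a))"
  unfolding enc_ints_def by (rule ptime_tuple) auto

lemma ptime_enc_intsD:
  "ptime A e (\<lambda>a. enc_ints n (u a)) \<Longrightarrow> i < n \<Longrightarrow> pint A e (\<lambda>a. u a i)"
  unfolding enc_ints_def by (rule ptime_component)

definition dot :: "nat \<Rightarrow> (nat \<Rightarrow> int) \<Rightarrow> (nat \<Rightarrow> int) \<Rightarrow> int" where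
  "dot n u v = (\<Sum>i<n. u i * v i)"

lemma pint_dot:
  "ptime A e (\<lambda>a. enc_ints n (u a)) \<Longrightarrow> ptime A e (\<lambda>a. enc_ints n (v a)) \<Longrightarrow> pint A e (\<lambda>a. dot n (u a) (v a))"
  unfolding dot_def by (intro pint_sum pint_mult ptime_enc_intsD)

section \<open>Facets of upper hulls\<close>

text \<open>
  The homogenised generators of the upper hull of \<open>Y\<close>. A pair \<open>(w, - c)\<close> acts on them as the affine
  functional \<open>w \<bullet> z - c\<close> on points and as its linear part on directions.
\<close>

definition gens :: "(real ^ 'd) set \<Rightarrow> ((real ^ 'd) \<times> real) set" where
  "gens Y = (\<lambda>y. (y, 1)) ` Y \<union> range (\<lambda>i. (axis i 1, 0))"

text \<open>
  The halfspace \<open>w \<bullet> z \<ge> c\<close> supports the upper hull in a facet iff the generators that it makes tight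
  leave no freedom for the functional except a factor. This is the form of the facet condition that
  linear algebra can decide.
\<close>

definition facet_normal :: "(real ^ 'd) set \<Rightarrow> real ^ 'd \<Rightarrow> real \<Rightarrow> bool" where
  "facet_normal Y w c \<longleftrightarrow> w \<noteq> 0 \<and> (\<forall>g\<in>gens Y. 0 \<le> (w, - c) \<bullet> g) \<and>
     (\<forall>h. (\<forall>g\<in>gens Y. (w, - c) \<bullet> g = 0 \<longrightarrow> h \<bullet> g = 0) \<longrightarrow> h \<in> span {(w, - c)})"

lemma inner_ge_0:
  fixes w r :: "real ^ 'd"
  shows "0 \<le> w \<Longrightarrow> 0 \<le> r \<Longrightarrow> 0 \<le> w \<bullet> r"
  unfolding inner_vec_def by (intro sum_nonneg) (auto simp: less_eq_vec_def)

lemma gens_ge_0_iff: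
  fixes Y :: "(real ^ 'd) set"
  shows "(\<forall>g\<in>gens Y. 0 \<le> (w, - c) \<bullet> g) \<longleftrightarrow> 0 \<le> w \<and> (\<forall>y\<in>Y. c \<le> w \<bullet> y)"
  by (auto simp: gens_def ball_Un inner_axis less_eq_vec_def)

definition upper_hull :: "(real ^ 'd) set \<Rightarrow> (real ^ 'd) set" where
  "upper_hull Y = {y + r | y r. y \<in> convex hull Y \<and> 0 \<le> r}"

lemma subset_upper_hull: "Y \<subseteq> upper_hull Y"
  unfolding upper_hull_def using hull_subset[of Y convex] by force

lemma upper_hull_upward:
  assumes "z \<in> upper_hull Y" "z \<le> z'" shows "z' \<in> upper_hull Y"
proof -
  obtain y r where "z = y + r" "y \<in> convex hull Y" "0 \<le> r" using assms(1) unfolding upper_hull_def by blast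
  moreover have "0 \<le> z' - z" using assms(2) by (simp add: less_eq_vec_def)
  ultimately have "z' = y + (r + (z' - z))" "0 \<le> r + (z' - z)"
    by (simp, intro add_nonneg_nonneg)
  then show ?thesis using \<open>y \<in> convex hull Y\<close> unfolding upper_hull_def by blast
qed

lemma nonneg_axis: "0 \<le> t \<Longrightarrow> 0 \<le> (axis i t :: real ^ 'd)"
  by (simp add: less_eq_vec_def axis_def)

text \<open>
  A negative entry \<open>w $ i\<close> is impossible since the upper hull recedes in direction \<open>axis i 1\<close>.
\<close>

lemma upper_hull_subset_halfspace_iff:
  fixes Y :: "(real ^ 'd) set"
  assumes "Y \<noteq> {}"
  shows "upper_hull Y \<subseteq> halfspace w c \<longleftrightarrow> 0 \<le> w \<and> (\<forall>y\<in>Y. c \<le> w \<bullet> y)"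
proof
  assume sub: "upper_hull Y \<subseteq> halfspace w c"
  obtain y0 where y0: "y0 \<in> Y" using assms by blast
  have "0 \<le> w $ i" for i
  proof (rule ccontr)
    assume neg: "\<not> 0 \<le> w $ i"
    define t where "t = (\<bar>w \<bullet> y0 - c\<bar> + 1) / (- (w $ i))"
    have t: "0 \<le> t" unfolding t_def using neg by (intro divide_nonneg_nonneg) auto
    have "y0 \<le> y0 + axis i t" using nonneg_axis[OF t, of i] by simp
    then have "y0 + axis i t \<in> halfspace w c"
      using y0 subset_upper_hull upper_hull_upward sub by blast
    moreover have "w \<bullet> (y0 + axis i t) = w \<bullet> y0 - (\<bar>w \<bullet> y0 - c\<bar> + 1)"
      using neg by (simp add: inner_add_right inner_axis t_def)
    ultimately show False unfolding halfspace_def mem_Collect_eq by linarith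
  qed
  then show "0 \<le> w \<and> (\<forall>y\<in>Y. c \<le> w \<bullet> y)"
    using sub subset_upper_hull[of Y] by (auto simp: halfspace_def less_eq_vec_def)
next
  assume w: "0 \<le> w \<and> (\<forall>y\<in>Y. c \<le> w \<bullet> y)"
  have "convex hull Y \<subseteq> {z. w \<bullet> z \<ge> c}"
    using w by (intro hull_minimal convex_halfspace_ge) auto
  then show "upper_hull Y \<subseteq> halfspace w c"
    using w inner_ge_0[of w] by (force simp: upper_hull_def halfspace_def inner_add_right)
qed

lemma convex_upper_hull: "convex (upper_hull Y)"
proof -
  have "convex {r :: real ^ 'd. 0 \<le> r}"
    by (auto simp: convex_def less_eq_vec_def)
  moreover have "upper_hull Y = (\<Union>y\<in>convex hull Y. \<Union>r\<in>{r. 0 \<le> r}. {y + r})"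
    by (auto simp: upper_hull_def)
  ultimately show ?thesis using convex_sums[OF convex_convex_hull[of Y], of "{r. 0 \<le> r}"] by (simp only:)
qed

lemma aff_dim_upper_hull:
  fixes Y :: "(real ^ 'd) set"
  assumes "Y \<noteq> {}"
  shows "aff_dim (upper_hull Y) = DIM(real ^ 'd)"
proof (rule ccontr)
  assume "aff_dim (upper_hull Y) \<noteq> DIM(real ^ 'd)"
  then have "aff_dim (upper_hull Y) < DIM(real ^ 'd)"
    using aff_dim_le_DIM[of "upper_hull Y"] by linarith
  then obtain a b where a: "a \<noteq> 0" "upper_hull Y \<subseteq> {x. a \<bullet> x = b}"
    by (rule aff_lowdim_subset_hyperplane)
  obtain y0 where y0: "y0 \<in> upper_hull Y" using assms subset_upper_hull by blast
  have "a $ i = 0" for i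
  proof -
    have "y0 \<le> y0 + axis i 1" using nonneg_axis[of 1 i] by simp
    then have "y0 + axis i 1 \<in> upper_hull Y" using y0 upper_hull_upward by blast
    then have "a \<bullet> (y0 + axis i 1) = a \<bullet> y0" using y0 a(2) by auto
    then show ?thesis by (simp add: inner_add_right inner_axis)
  qed
  then show False using a(1) by (simp add: vec_eq_iff)
qed

text \<open>
  Points of a face are combinations of tight generators only: in \<open>w \<bullet> z - c\<close>, written as a
  combination of the values on the generators, all summands are nonnegative, so they vanish one by one. Hence a
  functional that vanishes on the tight generators vanishes on the face.
\<close>

lemma tight_decomposition:
  fixes Y :: "(real ^ 'd) set"
  assumes fin: "finite Y" and w: "0 \<le> w" "\<forall>y\<in>Y. c \<le> w \<bullet> y"
    and h: "\<forall>g\<in>gens Y. (w, - c) \<bullet> g = 0 \<longrightarrow> (w', - c') \<bullet> g = 0"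
    and z: "z \<in> upper_hull Y" "w \<bullet> z = c"
  shows "w' \<bullet> z = c'"
proof -
  obtain y r where y: "y \<in> convex hull Y" and r: "0 \<le> r" and zyr: "z = y + r"
    using z unfolding upper_hull_def by blast
  obtain u where u: "\<forall>x\<in>Y. 0 \<le> u x" "sum u Y = 1" "(\<Sum>x\<in>Y. u x *\<^sub>R x) = y"
    using y unfolding convex_hull_finite[OF fin] by blast
  have eq: "v \<bullet> z - e = (\<Sum>x\<in>Y. u x * (v \<bullet> x - e)) + (\<Sum>i\<in>UNIV. v $ i * r $ i)" for v e
  proof -
    have "v \<bullet> y = (\<Sum>x\<in>Y. u x * (v \<bullet> x))"
      unfolding u(3)[symmetric] by (simp add: inner_sum_right)
    moreover have "e = (\<Sum>x\<in>Y. u x * e)" using u(2) by (simp add: sum_distrib_right[symmetric])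
    moreover have "v \<bullet> r = (\<Sum>i\<in>UNIV. v $ i * r $ i)" by (simp add: inner_vec_def)
    ultimately show ?thesis unfolding zyr
      by (simp add: inner_add_right right_diff_distrib sum_subtractf)
  qed
  have nn: "\<forall>x\<in>Y. 0 \<le> u x * (w \<bullet> x - c)" "\<forall>i\<in>UNIV. 0 \<le> w $ i * r $ i"
    using u w r by (auto simp: less_eq_vec_def)
  have "(\<Sum>x\<in>Y. u x * (w \<bullet> x - c)) = 0" "(\<Sum>i\<in>UNIV. w $ i * r $ i) = 0"
    using eq[of w c] z(2) sum_nonneg[of Y "\<lambda>x. u x * (w \<bullet> x - c)"]
      sum_nonneg[of UNIV "\<lambda>i. w $ i * r $ i"] nn by auto
  then have z0: "\<forall>x\<in>Y. u x * (w \<bullet> x - c) = 0" "\<forall>i. w $ i * r $ i = 0"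
    using nn fin by (simp_all add: sum_nonneg_eq_0_iff)
  have "u x * (w' \<bullet> x - c') = 0" if x: "x \<in> Y" for x
  proof (cases "u x = 0")
    case False
    then have "(w, - c) \<bullet> (x, 1) = 0" using z0 x by auto
    moreover have "(x, 1) \<in> gens Y" using x by (auto simp: gens_def)
    ultimately have "(w', - c') \<bullet> (x, 1) = 0" using h by blast
    then show ?thesis by simp
  qed simp
  moreover have "w' $ i * r $ i = 0" for i
  proof (cases "r $ i = 0")
    case False
    then have "(w, - c) \<bullet> (axis i 1, 0) = 0" using z0(2)[rule_format, of i] by (simp add: inner_axis)
    moreover have "(axis i 1, 0) \<in> gens Y" by (auto simp: gens_def)
    ultimately have "(w', - c') \<bullet> (axis i 1, 0) = 0" using h by blast
    then show ?thesis by (simp add: inner_axis)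
  qed simp
  ultimately have "w' \<bullet> z - c' = 0" unfolding eq[of w' c'] by (simp only: sum.neutral_const sum.cong)
  then show ?thesis by simp
qed

lemma in_span_singleton_swap:
  fixes w w' :: "real ^ 'd"
  assumes "(w', c') \<in> span {(w, c)}"
  shows "(w', - c') \<in> span {(w, - c)}"
  using assms by (auto simp: span_singleton)

text \<open>
  A subset spans its hyperplane iff that is the only hyperplane through it. An affine hull is an
  intersection of hyperplanes, so a smaller hull would lie in a different one. The trivial equation
  \<open>w' = 0\<close>, \<open>c' = 0\<close> is the multiple by zero.
\<close>

lemma aff_dim_hyperplane_subset_iff:
  fixes T :: "'a :: euclidean_space set"
  assumes T: "T \<subseteq> {z. w \<bullet> z = c}" and w: "w \<noteq> 0"
  shows "aff_dim T = DIM('a) - 1 \<longleftrightarrow>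
    (\<forall>w' c'. T \<subseteq> {z. w' \<bullet> z = c'} \<longrightarrow> (w', c') \<in> span {(w, c)})"
proof
  assume dim: "aff_dim T = DIM('a) - 1"
  show "\<forall>w' c'. T \<subseteq> {z. w' \<bullet> z = c'} \<longrightarrow> (w', c') \<in> span {(w, c)}"
  proof (intro allI impI)
    fix w' c' assume T': "T \<subseteq> {z. w' \<bullet> z = c'}"
    have "T \<noteq> {}" using dim by auto
    then obtain t where t: "t \<in> T" by blast
    have "affine hull T = {z. w \<bullet> z = c}"
    proof (rule affine_dim_equal)
      show "affine hull T \<subseteq> {z. w \<bullet> z = c}" using T by (intro hull_minimal affine_hyperplane)
      show "aff_dim (affine hull T) = aff_dim {z. w \<bullet> z = c}" using dim w by simp
    qed (use t in \<open>auto simp: affine_hyperplane\<close>)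
    then have hyp: "{z. w \<bullet> z = c} \<subseteq> {z. w' \<bullet> z = c'}"
      using hull_minimal[of T "{z. w' \<bullet> z = c'}" affine] T' by (simp add: affine_hyperplane)
    define k where "k = (w' \<bullet> w) / (w \<bullet> w)"
    \<comment> \<open>The part of \<open>w'\<close> orthogonal to \<open>w\<close> is a direction of the hyperplane and hence orthogonal to \<open>w'\<close> too.\<close>
    define v where "v = w' - k *\<^sub>R w"
    have "w \<bullet> v = 0" using w by (simp add: v_def k_def inner_diff_right inner_commute)
    then have "t + v \<in> {z. w \<bullet> z = c}" using t T by (auto simp: inner_add_right)
    then have "t + v \<in> {z. w' \<bullet> z = c'}" using hyp by blast
    then have "w' \<bullet> v = 0" using t T' by (auto simp: inner_add_right)
    then have "v \<bullet> v = 0" using \<open>w \<bullet> v = 0\<close> by (simp add: v_def inner_diff_left)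
    then have "w' = k *\<^sub>R w" by (simp add: v_def)
    moreover have "c' = k * c" using t T T' calculation by auto
    ultimately show "(w', c') \<in> span {(w, c)}" by (auto simp: span_singleton)
  qed
next
  assume *: "\<forall>w' c'. T \<subseteq> {z. w' \<bullet> z = c'} \<longrightarrow> (w', c') \<in> span {(w, c)}"
  have "affine hull T = {z. w \<bullet> z = c}"
  proof (rule ccontr)
    assume neq: "affine hull T \<noteq> {z. w \<bullet> z = c}"
    have "affine hull T \<subseteq> {z. w \<bullet> z = c}" using T by (intro hull_minimal affine_hyperplane)
    then obtain p where p: "w \<bullet> p = c" "p \<notin> affine hull T" using neq by blast
    obtain \<F> where F: "affine hull T = \<Inter>\<F>" "\<And>h. h \<in> \<F> \<Longrightarrow> \<exists>a b. a \<noteq> 0 \<and> h = {x. a \<bullet> x = b}"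
      using affine_hull_finite_intersection_hyperplanes[of T] by metis
    obtain h where h: "h \<in> \<F>" "p \<notin> h" using F p by blast
    obtain a b where ab: "h = {x. a \<bullet> x = b}" using F h by blast
    have "T \<subseteq> {x. a \<bullet> x = b}" using F(1) h(1) ab hull_subset[of T affine] by blast
    then have "(a, b) \<in> span {(w, c)}" using * by blast
    then obtain k where "a = k *\<^sub>R w" "b = k * c" by (auto simp: span_singleton)
    then show False using h p ab by simp
  qed
  then have "aff_dim T = aff_dim {z. w \<bullet> z = c}" by (metis aff_dim_affine_hull)
  then show "aff_dim T = DIM('a) - 1" using w by simp
qed

lemma upper_hull_facet_halfspaceE:
  fixes Y :: "(real ^ 'd) set"
  assumes fin: "finite Y" and ne: "Y \<noteq> {}" and H: "H \<in> facet_halfspaces (upper_hull Y)"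
  obtains w c where "H = halfspace w c" "facet_normal Y w c"
proof -
  obtain w c F where w: "w \<noteq> 0" "H = halfspace w c" "upper_hull Y \<subseteq> halfspace w c"
    and F: "F facet_of upper_hull Y" "F \<subseteq> {z. w \<bullet> z = c}"
    using H unfolding facet_halfspaces_def by blast
  have w2: "0 \<le> w" "\<forall>y\<in>Y. c \<le> w \<bullet> y"
    using upper_hull_subset_halfspace_iff[OF ne] w(3) by blast+
  have F': "F \<subseteq> upper_hull Y" "F \<noteq> {}" using F(1) by (auto simp: facet_of_def dest: face_of_imp_subset)
  have "aff_dim F = DIM(real ^ 'd) - 1"
    using F(1) aff_dim_upper_hull[OF ne] by (simp add: facet_of_def)
  then have *: "\<forall>w' c'. F \<subseteq> {z. w' \<bullet> z = c'} \<longrightarrow> (w', c') \<in> span {(w, c)}"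
    using aff_dim_hyperplane_subset_iff[OF F(2) w(1)] by blast
  have "h \<in> span {(w, - c)}" if h: "\<forall>g\<in>gens Y. (w, - c) \<bullet> g = 0 \<longrightarrow> h \<bullet> g = 0" for h
  proof -
    obtain w' c' where [simp]: "h = (w', - c')" by (metis surj_pair minus_minus)
    have "w' \<bullet> z = c'" if "z \<in> F" for z
      using tight_decomposition[OF fin w2, of w' c' z] h F(2) F'(1) that by auto
    then have "(w', c') \<in> span {(w, c)}" using * by blast
    then show ?thesis by (simp add: in_span_singleton_swap)
  qed
  then have "facet_normal Y w c" unfolding facet_normal_def using w(1) w2 by (auto simp: gens_ge_0_iff)
  then show ?thesis using that w(2) by blast
qed

lemma upper_hull_facet_halfspaceI:
  fixes Y :: "(real ^ 'd) set"
  assumes ne: "Y \<noteq> {}" and w: "facet_normal Y w c"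
  shows "halfspace w c \<in> facet_halfspaces (upper_hull Y)"
proof -
  let ?S = "upper_hull Y" and ?F = "upper_hull Y \<inter> {z. w \<bullet> z = c}"
  have w0: "w \<noteq> 0" and w2: "0 \<le> w" "\<forall>y\<in>Y. c \<le> w \<bullet> y"
    and uniq: "\<And>h. (\<forall>g\<in>gens Y. (w, - c) \<bullet> g = 0 \<longrightarrow> h \<bullet> g = 0) \<Longrightarrow> h \<in> span {(w, - c)}"
    using w by (auto simp: facet_normal_def gens_ge_0_iff)
  have sub: "?S \<subseteq> halfspace w c" using upper_hull_subset_halfspace_iff[OF ne] w2 by blast
  \<comment> \<open>If only directions were tight, the functional \<open>(0, 1)\<close> would vanish on them as well.\<close>
  have "\<exists>y\<in>Y. w \<bullet> y = c"
  proof (rule ccontr)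
    assume "\<not> (\<exists>y\<in>Y. w \<bullet> y = c)"
    then have "\<forall>g\<in>gens Y. (w, - c) \<bullet> g = 0 \<longrightarrow> (0, 1) \<bullet> g = 0" by (auto simp: gens_def)
    then have "(0, 1) \<in> span {(w, - c)}" by (rule uniq)
    then show False using w0 by (auto simp: span_singleton)
  qed
  then obtain y0 where y0: "y0 \<in> Y" "w \<bullet> y0 = c" by blast
  have inF: "y0 \<in> ?F" using y0 subset_upper_hull by blast
  have "?F face_of ?S"
    using sub convex_upper_hull by (intro face_of_Int_supporting_hyperplane_ge) (auto simp: halfspace_def)
  moreover have "aff_dim ?F = DIM(real ^ 'd) - 1"
  proof (subst aff_dim_hyperplane_subset_iff[of _ w c])
    show "\<forall>w' c'. ?F \<subseteq> {z. w' \<bullet> z = c'} \<longrightarrow> (w', c') \<in> span {(w, c)}"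
    proof (intro allI impI)
      fix w' c' assume F: "?F \<subseteq> {z. w' \<bullet> z = c'}"
      have "(w', - c') \<in> span {(w, - c)}"
      proof (rule uniq, intro ballI impI)
        fix g assume g: "g \<in> gens Y" "(w, - c) \<bullet> g = 0"
        then consider y where "y \<in> Y" "g = (y, 1)" | i where "g = (axis i 1, 0)" by (auto simp: gens_def)
        then show "(w', - c') \<bullet> g = 0"
        proof cases
          case 1
          then have "y \<in> ?F" using g subset_upper_hull by auto
          then show ?thesis using F 1 by auto
        next
          case (2 i)
          have "y0 \<le> y0 + axis i 1" using nonneg_axis[of 1 i] by simp
          then have "y0 + axis i 1 \<in> ?F"
            using inF g(2) 2 upper_hull_upward[of y0 Y] by (simp add: inner_add_right)
          then have "w' \<bullet> (y0 + axis i 1) = c'" "w' \<bullet> y0 = c'" using F inF by blast+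
          then show ?thesis using 2 by (simp add: inner_add_right)
        qed
      qed
      then show "(w', c') \<in> span {(w, c)}" using in_span_singleton_swap[of w' "- c'" w "- c"] by simp
    qed
  qed (use w0 in auto)
  ultimately have "?F facet_of ?S"
    using inF aff_dim_upper_hull[OF ne] by (auto simp: facet_of_def)
  then show ?thesis unfolding facet_halfspaces_def using w0 sub by blast
qed

text \<open>
  The upper hull is the slice at height one of the cone over its generators, and finitely
  generated cones are polyhedra.
\<close>

lemma polyhedron_upper_hull:
  fixes Y :: "(real ^ 'd) set"
  assumes fin: "finite Y" and ne: "Y \<noteq> {}"
  shows "polyhedron (upper_hull Y)"
proof -
  let ?K = "convex_cone hull gens Y"
  \<comment> \<open>An explicit convex cone containing the generators, which bounds the generated cone from above.\<close>
  define C where "C = {(t *\<^sub>R y + r, t) | t y r. 0 \<le> t \<and> y \<in> convex hull Y \<and> 0 \<le> (r :: real ^ 'd)}"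
  have "convex_cone C" unfolding convex_cone_iff
  proof (intro conjI ballI allI impI)
    obtain y where "y \<in> convex hull Y" using ne by (metis convex_hull_eq_empty ex_in_conv)
    moreover have "0 = (0 *\<^sub>R y + 0, 0 :: real)" by (simp add: zero_prod_def)
    ultimately show "0 \<in> C" unfolding C_def by blast
  next
    fix a b assume "a \<in> C" "b \<in> C"
    then obtain t y r t' y' r' where a: "a = (t *\<^sub>R y + r, t)" "0 \<le> t" "y \<in> convex hull Y" "0 \<le> r"
      and b: "b = (t' *\<^sub>R y' + r', t')" "0 \<le> t'" "y' \<in> convex hull Y" "0 \<le> r'" unfolding C_def by blast
    obtain y'' where "y'' \<in> convex hull Y" "t *\<^sub>R y + t' *\<^sub>R y' = (t + t') *\<^sub>R y''"
    proof (cases "t + t' = 0")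
      case True
      then have "t = 0" "t' = 0" using a b by auto
      then show ?thesis using that a by auto
    next
      case False
      then have pos: "0 < t + t'" using a b by auto
      have "(t / (t + t')) *\<^sub>R y + (t' / (t + t')) *\<^sub>R y' \<in> convex hull Y"
        using a b pos by (intro convexD[OF convex_convex_hull]) (auto simp: add_divide_distrib[symmetric])
      then show ?thesis using that pos by (auto simp: scaleR_add_right)
    qed
    then have "a + b = ((t + t') *\<^sub>R y'' + (r + r'), t + t')" "y'' \<in> convex hull Y"
      using a(1) b(1) by (auto simp: algebra_simps)
    moreover have "0 \<le> r + r'" "0 \<le> t + t'" using a b by (auto intro: add_nonneg_nonneg)
    ultimately show "a + b \<in> C" unfolding C_def by blast
  next
    fix a c assume "a \<in> C" and c: "0 \<le> (c :: real)"
    then obtain t y r where a: "a = (t *\<^sub>R y + r, t)" "0 \<le> t" "y \<in> convex hull Y" "0 \<le> r" unfolding C_def by blast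
    have "c *\<^sub>R a = ((c * t) *\<^sub>R y + c *\<^sub>R r, c * t)" by (simp add: a(1) scaleR_add_right)
    moreover have "0 \<le> c * t" "0 \<le> c *\<^sub>R r" using a c by (auto simp: less_eq_vec_def)
    ultimately show "c *\<^sub>R a \<in> C" using a(3) unfolding C_def by blast
  qed
  moreover have "gens Y \<subseteq> C"
  proof
    fix g assume "g \<in> gens Y"
    then consider y where "y \<in> Y" "g = (y, 1)" | i where "g = (axis i 1, 0)" by (auto simp: gens_def)
    then show "g \<in> C"
    proof cases
      case 1
      then have "g = (1 *\<^sub>R y + 0, 1)" "y \<in> convex hull Y" by (simp_all add: hull_inc)
      moreover have "0 \<le> (1 :: real)" "0 \<le> (0 :: real ^ 'd)" by simp_all
      ultimately show ?thesis unfolding C_def by blast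
    next
      case 2
      obtain y where "y \<in> convex hull Y" using ne by (metis convex_hull_eq_empty ex_in_conv)
      moreover have "g = (0 *\<^sub>R y + axis i 1, 0)" "0 \<le> (axis i 1 :: real ^ 'd)"
        using 2 by (simp_all add: nonneg_axis)
      ultimately show ?thesis unfolding C_def by blast
    qed
  qed
  ultimately have KC: "?K \<subseteq> C" by (rule hull_minimal[rotated])
  have cone: "convex_cone ?K" by (rule convex_cone_convex_cone_hull)
  have K: "g \<in> gens Y \<Longrightarrow> g \<in> ?K" for g by (rule hull_inc)
  have slice: "(z, 1) \<in> ?K \<longleftrightarrow> z \<in> upper_hull Y" for z
  proof
    assume "(z, 1) \<in> ?K"
    then have "(z, 1) \<in> C" using KC by blast
    then obtain t y r where "(z, 1) = (t *\<^sub>R y + r, t)" "y \<in> convex hull Y" "0 \<le> r" unfolding C_def by blast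
    then have "z = y + r" "y \<in> convex hull Y" "0 \<le> r" by simp_all
    then show "z \<in> upper_hull Y" unfolding upper_hull_def by blast
  next
    assume "z \<in> upper_hull Y"
    then obtain y r where y: "y \<in> convex hull Y" and r: "0 \<le> r" and z: "z = y + r"
      unfolding upper_hull_def by blast
    obtain u where u: "\<forall>x\<in>Y. 0 \<le> u x" "sum u Y = 1" "(\<Sum>x\<in>Y. u x *\<^sub>R x) = y"
      using y unfolding convex_hull_finite[OF fin] by blast
    have sumK: "(\<Sum>x\<in>X. f x) \<in> ?K" if "finite X" "\<And>x. x \<in> X \<Longrightarrow> f x \<in> ?K" for f :: "'e \<Rightarrow> _" and X
      using that convex_cone_contains_0[OF cone]
      by (induction X rule: finite_induct) (simp_all add: convex_cone_add[OF cone])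
    have "(\<Sum>x\<in>Y. u x *\<^sub>R (x, 1)) \<in> ?K"
    proof (rule sumK[OF fin])
      fix x assume x: "x \<in> Y"
      then have "(x, 1) \<in> gens Y" unfolding gens_def by blast
      moreover have "0 \<le> u x" using u(1) x by blast
      ultimately show "u x *\<^sub>R (x, 1) \<in> ?K" by (rule convex_cone_scaleR[OF cone _ K, rotated])
    qed
    moreover have "(\<Sum>x\<in>Y. u x *\<^sub>R (x, 1 :: real)) = (y, 1)"
      using u(2,3) by (simp only: scaleR_Pair sum_prod real_scaleR_def mult_1_right)
    moreover have "(\<Sum>i\<in>UNIV. r $ i *\<^sub>R (axis i 1, 0)) \<in> ?K"
    proof (rule sumK)
      fix i :: 'd
      have "(axis i 1, 0) \<in> gens Y" unfolding gens_def by blast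
      moreover have "0 \<le> r $ i" using r by (simp add: less_eq_vec_def)
      ultimately show "r $ i *\<^sub>R (axis i 1, 0) \<in> ?K" by (rule convex_cone_scaleR[OF cone _ K, rotated])
    qed simp
    moreover have "(\<Sum>i\<in>UNIV. r $ i *\<^sub>R (axis i 1, 0 :: real)) = (r, 0)"
      using basis_expansion[of r]
      by (simp only: scaleR_Pair sum_prod real_scaleR_def mult_zero_right sum.neutral_const scalar_mult_eq_scaleR)
    ultimately have "(y, 1) + (r, 0) \<in> ?K" by (intro convex_cone_add[OF cone]) simp_all
    then show "(z, 1) \<in> ?K" using z by simp
  qed
  have "finite (gens Y)" using fin by (simp add: gens_def)
  then have "polyhedron ?K" by (rule polyhedron_convex_cone_hull)
  then obtain \<F> where F: "finite \<F>" "?K = \<Inter>\<F>" "\<forall>h\<in>\<F>. \<exists>a b. a \<noteq> 0 \<and> h = {x. a \<bullet> x \<le> b}"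
    unfolding polyhedron_def by blast
  have "z \<in> upper_hull Y \<longleftrightarrow> z \<in> \<Inter>((\<lambda>h. {z. (z, 1) \<in> h}) ` \<F>)" for z
    unfolding slice[symmetric] F(2) by simp
  then have "upper_hull Y = \<Inter>((\<lambda>h. {z. (z, 1) \<in> h}) ` \<F>)" by (intro set_eqI)
  moreover have "polyhedron (\<Inter>((\<lambda>h. {z. (z, 1) \<in> h}) ` \<F>))"
  proof (rule polyhedron_Inter)
    fix S assume "S \<in> (\<lambda>h. {z. (z, 1) \<in> h}) ` \<F>"
    then obtain h where h: "h \<in> \<F>" and S: "S = {z. (z, 1) \<in> h}" by blast
    obtain a b where "h = {x. a \<bullet> x \<le> b}" using F(3) h by blast
    then have "S = {z. fst a \<bullet> z \<le> b - snd a}" unfolding S by (simp add: inner_prod_def le_diff_eq)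
    then show "polyhedron S" by (simp only: polyhedron_halfspace_le)
  qed (simp add: F(1))
  ultimately show ?thesis by (simp only:)
qed

text \<open>
  In an irredundant description of a full-dimensional polyhedron every halfspace belongs to a facet.
\<close>

lemma Inter_facet_halfspaces_upper_hull:
  fixes Y :: "(real ^ 'd) set"
  assumes fin: "finite Y" and ne: "Y \<noteq> {}"
  shows "\<Inter>(facet_halfspaces (upper_hull Y)) \<subseteq> upper_hull Y"
proof -
  let ?S = "upper_hull Y"
  obtain \<F> where F: "finite \<F>" "?S = affine hull ?S \<inter> \<Inter>\<F>"
      "\<forall>h\<in>\<F>. \<exists>a b. a \<noteq> 0 \<and> h = {x. a \<bullet> x \<le> b}" "\<forall>F'. F' \<subset> \<F> \<longrightarrow> ?S \<subset> affine hull ?S \<inter> \<Inter>F'"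
    using polyhedron_upper_hull[OF assms] unfolding polyhedron_Int_affine_minimal by blast
  from F(3) obtain a b where ab: "\<And>h. h \<in> \<F> \<Longrightarrow> a h \<noteq> 0 \<and> h = {x. a h \<bullet> x \<le> b h}" by metis
  have "\<F> \<subseteq> facet_halfspaces ?S"
  proof
    fix h assume h: "h \<in> \<F>"
    have "?S \<inter> {x. a h \<bullet> x = b h} facet_of ?S"
      using facet_of_polyhedron_explicit[OF F(1,2) ab] F(4) h by blast
    moreover have "h = halfspace (- a h) (- b h)" using ab[OF h] by (auto simp: halfspace_def)
    moreover have "?S \<subseteq> h" using F(2) h by blast
    moreover have "?S \<inter> {x. a h \<bullet> x = b h} \<subseteq> {z. (- a h) \<bullet> z = - b h}" by auto
    moreover have "- a h \<noteq> 0" using ab[OF h] by simp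
    ultimately show "h \<in> facet_halfspaces ?S" unfolding facet_halfspaces_def by blast
  qed
  then have "\<Inter>(facet_halfspaces ?S) \<subseteq> \<Inter>\<F>" by blast
  moreover have "affine hull ?S = UNIV" using aff_dim_upper_hull[OF ne] aff_dim_eq_full[of ?S] by blast
  ultimately show ?thesis using F(2) by blast
qed

section \<open>Enumeration of facet normals\<close>

text \<open>
  Fraction-free elimination: the result is orthogonal to \<open>g\<close>, and the pivot \<open>p\<close> itself becomes zero.
  Keeping this zero vector leaves the number of vectors unchanged, so the lists only have to
  span the right space and need not be bases.
\<close>

definition eliminate :: "nat \<Rightarrow> (nat \<Rightarrow> int) \<Rightarrow> (nat \<Rightarrow> int) \<Rightarrow> (nat \<Rightarrow> int) \<Rightarrow> nat \<Rightarrow> int" where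
  "eliminate n g p b = (\<lambda>i. dot n p g * b i - dot n b g * p i)"

text \<open>
  Branches over the spanning lists produced so far, the generator \<open>g\<close> to be made tight next, and the pivot.
\<close>

definition elim_step :: "nat \<Rightarrow> (nat \<Rightarrow> int) list \<Rightarrow> (nat \<Rightarrow> int) list list \<Rightarrow> (nat \<Rightarrow> int) list list" where
  "elim_step n G Bs = concat (map (\<lambda>B. concat (map (\<lambda>g. map (\<lambda>p. map (eliminate n g p) B)
     (filter (\<lambda>p. dot n p g \<noteq> 0) B)) G)) Bs)"

definition unit_list :: "nat \<Rightarrow> (nat \<Rightarrow> int) list" where
  "unit_list m = map (\<lambda>j i. if i = j then 1 else 0) [0..<m]"

text \<open>
  Both signs of a solution are candidates. A positive sum of the first \<open>d\<close> entries excludes the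
  functional \<open>(0, 1)\<close>, which is nonnegative on all generators but belongs to no halfspace.
\<close>

definition normals :: "nat \<Rightarrow> (nat \<Rightarrow> int) list \<Rightarrow> (nat \<Rightarrow> int) list" where
  "normals d G = filter (\<lambda>h. (\<forall>g\<in>set G. 0 \<le> dot (Suc d) h g) \<and> 0 < (\<Sum>i<d. h i))
     (concat (map (\<lambda>b. [b, \<lambda>i. - b i]) (concat ((elim_step (Suc d) G ^^ d) [unit_list (Suc d)]))))"

lemma ptime_eliminate:
  "ptime A e (\<lambda>a. enc_ints n (g a)) \<Longrightarrow> ptime A e (\<lambda>a. enc_ints n (p a)) \<Longrightarrow> ptime A e (\<lambda>a. enc_ints n (b a)) \<Longrightarrow>
    ptime A e (\<lambda>a. enc_ints n (eliminate n (g a) (p a) (b a)))"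
  unfolding eliminate_def
  by (intro ptime_enc_intsI pint_diff pint_mult pint_dot) (auto intro: ptime_enc_intsD)

abbreviation enc_mat :: "nat \<Rightarrow> (nat \<Rightarrow> int) list \<Rightarrow> val" where
  "enc_mat n B \<equiv> enc_list (map (enc_ints n) B)"

lemma ptime_elim_step:
  assumes G: "ptime A e (\<lambda>a. enc_mat n (G a))" and Bs: "ptime A e (\<lambda>a. enc_list (map (enc_mat n) (Bs a)))"
  shows "ptime A e (\<lambda>a. enc_list (map (enc_mat n) (elim_step n (G a) (Bs a))))"
  unfolding elim_step_def
  apply (rule ptime_concat_map[OF Bs])
  apply (rule ptime_concat_map[OF ptime_lift[OF G]])
  apply (rule ptime_map[OF ptime_filter[OF ptime_lift[OF ptime_elem]]])
   apply (rule pbool_nonzero[OF pint_dot[OF ptime_elem ptime_lift[OF ptime_elem]]])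
  apply (rule ptime_map[OF ptime_lift[OF ptime_lift[OF ptime_elem]]])
  apply (rule ptime_eliminate[OF ptime_lift[OF ptime_lift[OF ptime_elem]] ptime_lift[OF ptime_elem] ptime_elem])
  done

lemma ptime_unit_list: "ptime A e (\<lambda>a. enc_mat n (unit_list m))"
  unfolding unit_list_def by (simp only: map_map o_def) (intro ptime_tuple ptime_enc_intsI ptime_const_Num)

lemma ptime_normals:
  assumes G: "ptime A e (\<lambda>a. enc_mat (Suc d) (G a))"
  shows "ptime A e (\<lambda>a. enc_mat (Suc d) (normals d (G a)))"
proof -
  define n where "n = Suc d"
  note G' = G[folded n_def]
  have "ptime A e (\<lambda>a. enc_list (map (enc_mat n) ((elim_step n (G a) ^^ k) [unit_list n])))" for k
  proof (induction k)
    case 0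
    show ?case
      using ptime_Cons[of A e "enc_mat n" "\<lambda>_. unit_list n" "\<lambda>_. []", OF ptime_unit_list ptime_Nil] by simp
  next
    case (Suc k)
    from ptime_elim_step[OF G' this] show ?case by simp
  qed
  then have "ptime A e (\<lambda>a. enc_mat n (concat (map (\<lambda>B. B) ((elim_step n (G a) ^^ d) [unit_list n]))))"
    by (rule ptime_concat_map) (rule ptime_elem)
  then have 1: "ptime A e (\<lambda>a. enc_mat n (concat ((elim_step n (G a) ^^ d) [unit_list n])))" by simp
  have 2: "ptime A e (\<lambda>a. enc_mat n (concat (map (\<lambda>b. [b, \<lambda>i. - b i])
      (concat ((elim_step n (G a) ^^ d) [unit_list n])))))"
    by (rule ptime_concat_map[OF 1])
      (intro ptime_Cons ptime_elem ptime_Nil ptime_enc_intsI pint_minus ptime_enc_intsD[OF ptime_elem])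
  show ?thesis unfolding normals_def n_def[symmetric]
  proof (rule ptime_filter[OF 2], rule pbool_conj)
    show "pbool B (\<lambda>\<sigma>. Pr (e (fst \<sigma>)) (enc_ints n (snd \<sigma>))) (\<lambda>\<sigma>. 0 < sum (snd \<sigma>) {..<d})" for B
      by (intro pbool_less ptime_const_Num pint_sum ptime_enc_intsD[OF ptime_elem]) (simp add: n_def)
    show "pbool (SIGMA a:A. X a) (\<lambda>\<sigma>. Pr (e (fst \<sigma>)) (enc_ints n (snd \<sigma>)))
        (\<lambda>\<sigma>. \<forall>g\<in>set (G (fst \<sigma>)). 0 \<le> dot n (snd \<sigma>) g)" for X
      by (rule pbool_ball[OF ptime_lift[OF G']])
        (intro pbool_le ptime_const_Num pint_dot ptime_elem ptime_lift)
  qed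
qed

text \<open>
  Integer vectors as functionals: entry \<open>CARD('d)\<close> is the homogenising coordinate.
\<close>

definition hvec :: "(nat \<Rightarrow> int) \<Rightarrow> (real ^ 'd) \<times> real" where
  "hvec u = ((\<chi> i. of_int (u (to_nat_on UNIV i))), of_int (u (CARD('d :: finite))))"

lemma sum_coordinates:
  fixes f :: "nat \<Rightarrow> 'b :: comm_monoid_add"
  shows "(\<Sum>j<CARD('d :: finite). f j) = (\<Sum>i\<in>(UNIV :: 'd set). f (to_nat_on UNIV i))"
  by (rule sum.reindex_bij_betw[OF to_nat_on_finite, symmetric]) simp

lemma hvec_inner: "hvec u \<bullet> (hvec v :: (real ^ ('d :: finite)) \<times> real) = of_int (dot (Suc CARD('d)) u v)"
  by (simp add: hvec_def dot_def inner_prod_def inner_vec_def sum_coordinates[where 'd = 'd])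

lemma hvec_minus: "hvec (\<lambda>i. - u i) = - hvec u"
  by (simp add: hvec_def vec_eq_iff)

lemma hvec_eliminate:
  "hvec (eliminate (Suc CARD('d)) g p b) =
    (hvec p \<bullet> (hvec g :: (real ^ ('d :: finite)) \<times> real)) *\<^sub>R hvec b -
    (hvec b \<bullet> (hvec g :: (real ^ 'd) \<times> real)) *\<^sub>R (hvec p :: (real ^ 'd) \<times> real)"
  unfolding hvec_inner by (simp add: hvec_def eliminate_def vec_eq_iff)

text \<open>
  Elimination is a linear map; on vectors that are already orthogonal to \<open>g\<close> it is the multiplication by
  the nonzero number \<open>p \<bullet> g\<close>, so nothing of the orthogonal part is lost.
\<close>

lemma span_eliminate:
  fixes p g :: "'v :: euclidean_space"
  assumes p: "p \<in> B" and pg: "p \<bullet> g \<noteq> 0"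
  shows "span ((\<lambda>b. (p \<bullet> g) *\<^sub>R b - (b \<bullet> g) *\<^sub>R p) ` B) = span B \<inter> {x. x \<bullet> g = 0}"
proof -
  let ?f = "\<lambda>b. (p \<bullet> g) *\<^sub>R b - (b \<bullet> g) *\<^sub>R p"
  have "linear ?f" by (intro linearI) (simp_all add: algebra_simps)
  then have "span (?f ` B) = ?f ` span B" by (rule linear_span_image)
  also have "\<dots> = span B \<inter> {x. x \<bullet> g = 0}"
  proof (intro subset_antisym subsetI)
    fix y assume "y \<in> ?f ` span B"
    then obtain x where x: "x \<in> span B" "y = ?f x" by blast
    then have "y \<in> span B" using span_base[OF p] by (auto intro: span_diff span_scale)
    then show "y \<in> span B \<inter> {x. x \<bullet> g = 0}" using x(2) by (simp add: inner_diff_left)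
  next
    fix y assume y: "y \<in> span B \<inter> {x. x \<bullet> g = 0}"
    then have "y = ?f ((1 / (p \<bullet> g)) *\<^sub>R y)" using pg by simp
    moreover have "(1 / (p \<bullet> g)) *\<^sub>R y \<in> span B" using y by (auto intro: span_scale)
    ultimately show "y \<in> ?f ` span B" by blast
  qed
  finally show ?thesis .
qed

lemma dim_orthogonal_ge:
  "DIM('v :: euclidean_space) \<le> dim {x :: 'v. \<forall>g\<in>set gs. x \<bullet> g = 0} + length gs"
proof -
  have "dim {y \<in> UNIV. \<forall>x\<in>span (set gs). orthogonal x y} + dim (span (set gs)) = dim (UNIV :: 'v set)"
    by (rule dim_subspace_orthogonal_to_vectors) auto
  moreover have "{y \<in> UNIV. \<forall>x\<in>span (set gs). orthogonal x y} \<subseteq> {x. \<forall>g\<in>set gs. x \<bullet> g = 0}"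
    by (auto simp: orthogonal_def inner_commute intro: span_base)
  then have "dim {y \<in> UNIV. \<forall>x\<in>span (set gs). orthogonal x y} \<le> dim {x. \<forall>g\<in>set gs. x \<bullet> g = 0}"
    by (rule dim_subset)
  moreover have "dim (span (set gs)) \<le> length gs"
    using dim_le_card[of "set gs" "set gs"] card_length[of gs] span_superset by fastforce
  ultimately show ?thesis by simp
qed

abbreviation elim_stage :: "nat \<Rightarrow> (nat \<Rightarrow> int) list \<Rightarrow> nat \<Rightarrow> (nat \<Rightarrow> int) list list" where
  "elim_stage n G k \<equiv> (elim_step n G ^^ k) [unit_list n]"

lemma set_elim_step:
  "set (elim_step n G Bs) =
    {map (eliminate n g p) B | B g p. B \<in> set Bs \<and> g \<in> set G \<and> p \<in> set B \<and> dot n p g \<noteq> 0}"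
  unfolding elim_step_def by auto

lemma span_unit_list:
  "span (hvec ` set (unit_list (Suc CARD('d)))) = (UNIV :: ((real ^ ('d :: finite)) \<times> real) set)"
proof -
  let ?U = "hvec ` set (unit_list (Suc CARD('d))) :: ((real ^ 'd) \<times> real) set"
  have bij: "bij_betw (to_nat_on (UNIV :: 'd set)) UNIV {..<CARD('d)}" by (rule to_nat_on_finite) simp
  have lt: "to_nat_on UNIV i < CARD('d)" for i :: 'd using bij by (auto simp: bij_betw_def)
  have inj: "to_nat_on UNIV i = to_nat_on UNIV j \<longleftrightarrow> i = j" for i j :: 'd
    using bij by (auto simp: bij_betw_def inj_on_def)
  have "Basis \<subseteq> ?U"
  proof
    fix b :: "(real ^ 'd) \<times> real" assume "b \<in> Basis"
    then consider i where "b = (axis i 1, 0)" | "b = (0, 1)"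
      by (auto simp: Basis_prod_def Basis_vec_def)
    then show "b \<in> ?U"
    proof cases
      case (1 i)
      have "b = hvec (\<lambda>j. if j = to_nat_on UNIV i then 1 else 0)"
        using lt[of i] by (auto simp: 1 hvec_def vec_eq_iff axis_def inj)
      then show ?thesis using lt[of i] by (force simp: unit_list_def)
    next
      case 2
      have "b = hvec (\<lambda>j. if j = CARD('d) then 1 else 0)"
        using lt by (auto simp: 2 hvec_def vec_eq_iff dest: less_imp_neq)
      then show ?thesis by (force simp: unit_list_def)
    qed
  qed
  then have "span Basis \<subseteq> span ?U" by (rule span_mono)
  then show ?thesis by (simp add: top.extremum_unique)
qed

text \<open>
  After \<open>k\<close> steps a list spans the orthogonal complement of the \<open>k\<close> chosen generators. The dimension falls
  in each step because the pivot is lost, and by one only because \<open>k\<close> equations cannot cut down the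
  dimension by more than \<open>k\<close>; so after \<open>d\<close> steps a line remains.
\<close>

lemma elim_stage_span:
  fixes G :: "(nat \<Rightarrow> int) list"
  defines "n \<equiv> Suc CARD('d :: finite)"
  assumes "B \<in> set (elim_stage n G k)"
  shows "\<exists>gs. set gs \<subseteq> set G \<and> length gs = k \<and>
    span (hvec ` set B) = {x :: (real ^ 'd) \<times> real. \<forall>g\<in>set gs. x \<bullet> hvec g = 0} \<and>
    dim (span (hvec ` set B :: ((real ^ 'd) \<times> real) set)) + k = n"
  using assms(2)
proof (induction k arbitrary: B)
  case 0
  then show ?case by (intro exI[of _ "[]"]) (simp add: n_def span_unit_list)
next
  case (Suc k)
  from Suc.prems obtain B0 u p where B0: "B0 \<in> set (elim_stage n G k)" and u: "u \<in> set G"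
    and p: "p \<in> set B0" "dot n p u \<noteq> 0" and B: "B = map (eliminate n u p) B0"
    unfolding funpow.simps o_def set_elim_step by blast
  let ?U = "span (hvec ` set B0) :: ((real ^ 'd) \<times> real) set"
  let ?W = "span (hvec ` set B) :: ((real ^ 'd) \<times> real) set"
  obtain gs where gs: "set gs \<subseteq> set G" "?U = {x. \<forall>g\<in>set gs. x \<bullet> hvec g = 0}" "dim ?U + k = n"
    "length gs = k"
    using Suc.IH[OF B0] by blast
  have pu: "hvec p \<bullet> (hvec u :: (real ^ 'd) \<times> real) \<noteq> 0" using p(2) by (simp add: hvec_inner n_def)
  have W: "?W = ?U \<inter> {x. x \<bullet> hvec u = 0}"
    using span_eliminate[of "hvec p" "hvec ` set B0" "hvec u :: (real ^ 'd) \<times> real"] p(1) pu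
    by (simp add: B n_def image_image hvec_eliminate)
  then have W': "?W = {x. \<forall>g\<in>set (u # gs). x \<bullet> hvec g = 0}" using gs(2) by auto
  have "hvec p \<in> ?U" using p(1) by (intro span_base) blast
  then have "?W \<noteq> ?U" using W pu by blast
  moreover have "?W \<subseteq> ?U" using W by blast
  ultimately have "dim ?W < dim ?U"
    using subspace_dim_equal[OF subspace_span subspace_span] by (metis not_less)
  moreover have "n \<le> dim ?W + Suc k"
    using dim_orthogonal_ge[of "map hvec (u # gs) :: ((real ^ 'd) \<times> real) list"] gs(4)
    unfolding W' by (simp add: n_def)
  ultimately have "dim ?W + Suc k = n" using gs(3) by simp
  then show ?case using W' gs(1,4) u by (intro exI[of _ "u # gs"]) auto
qed

text \<open>
  The program works with integral multiples of the generators; only their directions matter.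
\<close>

definition represents :: "(nat \<Rightarrow> int) list \<Rightarrow> (real ^ ('d :: finite)) set \<Rightarrow> bool" where
  "represents G Y \<longleftrightarrow> (\<forall>u\<in>set G. \<exists>c>0. \<exists>g\<in>gens Y. hvec u = c *\<^sub>R g) \<and>
     (\<forall>g\<in>gens Y. \<exists>c>0. \<exists>u\<in>set G. hvec u = c *\<^sub>R g)"

lemma set_normals:
  "set (normals d G) = {h. \<exists>B\<in>set (elim_stage (Suc d) G d). \<exists>b\<in>set B. (h = b \<or> h = (\<lambda>i. - b i)) \<and>
     (\<forall>g\<in>set G. 0 \<le> dot (Suc d) h g) \<and> 0 < (\<Sum>i<d. h i)}"
  unfolding normals_def by auto

text \<open>
  The \<open>d\<close> generators chosen on the way to a candidate are tight for it, and their complement is the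
  line spanned by the candidate.
\<close>

lemma normals_sound:
  fixes Y :: "(real ^ ('d :: finite)) set"
  assumes rep: "represents G Y" and h: "h \<in> set (normals CARD('d) G)" and wc: "hvec h = (w, - c)"
  shows "facet_normal Y w c"
proof -
  let ?v = "hvec h :: (real ^ 'd) \<times> real"
  obtain B b where B: "B \<in> set (elim_stage (Suc CARD('d)) G CARD('d))" "b \<in> set B"
    and hb: "h = b \<or> h = (\<lambda>i. - b i)"
    and nonneg: "\<forall>g\<in>set G. 0 \<le> dot (Suc CARD('d)) h g" and pos: "0 < (\<Sum>i<CARD('d). h i)"
    using h unfolding set_normals by auto
  obtain gs where gs: "set gs \<subseteq> set G"
      "span (hvec ` set B) = {x :: (real ^ 'd) \<times> real. \<forall>g\<in>set gs. x \<bullet> hvec g = 0}"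
      "dim (span (hvec ` set B :: ((real ^ 'd) \<times> real) set)) + CARD('d) = Suc CARD('d)"
    using elim_stage_span[where 'd = 'd, OF B(1)] by blast
  have "fst ?v \<noteq> 0"
  proof
    assume "fst ?v = 0"
    then have "h (to_nat_on UNIV i) = 0" for i :: 'd by (simp add: hvec_def vec_eq_iff)
    then show False using pos unfolding sum_coordinates[where 'd = 'd] by simp
  qed
  then have "?v \<noteq> 0" by auto
  have "hvec b \<in> span (hvec ` set B :: ((real ^ 'd) \<times> real) set)" using B(2) by (intro span_base) blast
  then have v: "?v \<in> span (hvec ` set B)" using hb by (auto simp: hvec_minus span_neg)
  have span: "span (hvec ` set B) = span {?v}"
  proof (rule subspace_dim_equal[symmetric])
    show "span {?v} \<subseteq> span (hvec ` set B)" using v by (intro span_minimal) auto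
    show "dim (span (hvec ` set B :: ((real ^ 'd) \<times> real) set)) \<le> dim (span {?v})" using gs(3) \<open>?v \<noteq> 0\<close> by simp
  qed auto
  have "0 \<le> ?v \<bullet> g" if g: "g \<in> gens Y" for g
  proof -
    obtain c u where u: "0 < c" "u \<in> set G" "hvec u = c *\<^sub>R g" using rep g unfolding represents_def by blast
    have "0 \<le> ?v \<bullet> hvec u" using nonneg u(2) by (simp add: hvec_inner)
    then show ?thesis using u by (simp add: zero_le_mult_iff)
  qed
  moreover have "x \<in> span {?v}" if x: "\<forall>g\<in>gens Y. ?v \<bullet> g = 0 \<longrightarrow> x \<bullet> g = 0" for x
  proof -
    have "x \<bullet> hvec u = 0" if uG: "u \<in> set gs" for u
    proof -
      obtain c g where g: "0 < c" "g \<in> gens Y" "hvec u = c *\<^sub>R g"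
        using rep gs(1) uG unfolding represents_def by blast
      have "?v \<bullet> hvec u = 0" using v gs(2) uG by blast
      then have "?v \<bullet> g = 0" using g by simp
      then show ?thesis using x g by simp
    qed
    then show ?thesis using gs(2) span by blast
  qed
  ultimately show ?thesis using \<open>fst ?v \<noteq> 0\<close> unfolding wc facet_normal_def fst_conv by blast
qed

text \<open>
  Starting from a facet normal \<open>(w, - c)\<close>, it suffices to choose tight generators: then
  \<open>(w, - c)\<close> stays in the span. As long as the span has dimension at least two, some tight
  generator is not orthogonal to it, because the functionals vanishing on all tight generators form a
  line; so \<open>d\<close> steps can be made, and the line that is left contains \<open>(w, - c)\<close>.
\<close>

lemma normals_complete:
  fixes Y :: "(real ^ ('d :: finite)) set"
  assumes rep: "represents G Y" and w: "facet_normal Y w c"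
  shows "\<exists>h\<in>set (normals CARD('d) G). \<exists>k>0. hvec h = k *\<^sub>R (w, - c)"
proof -
  define n where "n = Suc CARD('d)"
  let ?v = "(w, - c)"
  have v: "?v \<noteq> 0" using w by (simp add: facet_normal_def zero_prod_def)
  have uniq: "x \<in> span {?v}" if "\<forall>u\<in>set G. ?v \<bullet> hvec u = 0 \<longrightarrow> x \<bullet> hvec u = 0" for x
  proof -
    have "x \<bullet> g = 0" if "g \<in> gens Y" "?v \<bullet> g = 0" for g
    proof -
      obtain c u where u: "0 < c" "u \<in> set G" "hvec u = c *\<^sub>R g"
        using rep \<open>g \<in> gens Y\<close> unfolding represents_def by blast
      then have "?v \<bullet> hvec u = 0" using \<open>?v \<bullet> g = 0\<close> by simp
      then have "x \<bullet> hvec u = 0" using \<open>\<forall>u\<in>set G. _ u\<close> u by blast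
      then show ?thesis using u by simp
    qed
    then show ?thesis using w unfolding facet_normal_def by blast
  qed
  have "\<exists>B\<in>set (elim_stage n G k). ?v \<in> span (hvec ` set B)" if "k \<le> CARD('d)" for k
    using that
  proof (induction k)
    case 0
    then show ?case by (simp add: n_def span_unit_list)
  next
    case (Suc k)
    then obtain B where B: "B \<in> set (elim_stage n G k)" "?v \<in> span (hvec ` set B)" by auto
    have "dim (span (hvec ` set B :: ((real ^ 'd) \<times> real) set)) + k = n"
      using elim_stage_span[where 'd = 'd, OF B(1)[unfolded n_def]] by (auto simp: n_def)
    then have dim: "2 \<le> dim (span (hvec ` set B :: ((real ^ 'd) \<times> real) set))" using Suc.prems by (simp add: n_def)
    have "\<exists>b\<in>set B. \<exists>u\<in>set G. ?v \<bullet> hvec u = 0 \<and> hvec b \<bullet> (hvec u :: (real ^ 'd) \<times> real) \<noteq> 0"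
    proof (rule ccontr)
      assume "\<not> ?thesis"
      then have "hvec ` set B \<subseteq> span {?v}" using uniq by blast
      then have "dim (span (hvec ` set B :: ((real ^ 'd) \<times> real) set)) \<le> dim (span {?v})"
        by (intro dim_subset span_minimal) auto
      then show False using dim v by simp
    qed
    then obtain p u where p: "p \<in> set B" "u \<in> set G" "?v \<bullet> hvec u = 0" "hvec p \<bullet> (hvec u :: (real ^ 'd) \<times> real) \<noteq> 0"
      by blast
    let ?B' = "map (eliminate n u p) B"
    have "?B' \<in> set (elim_stage n G (Suc k))"
      using B(1) p unfolding funpow.simps o_def set_elim_step n_def by (auto simp: hvec_inner)
    moreover have "span (hvec ` set ?B') = span (hvec ` set B) \<inter> {x :: (real ^ 'd) \<times> real. x \<bullet> hvec u = 0}"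
      using span_eliminate[of "hvec p" "hvec ` set B" "hvec u :: (real ^ 'd) \<times> real"] p
      by (simp add: n_def image_image hvec_eliminate)
    ultimately show ?case using B(2) p(3) by blast
  qed
  then obtain B where B: "B \<in> set (elim_stage n G CARD('d))" "?v \<in> span (hvec ` set B)" by blast
  have dim1: "dim (span (hvec ` set B :: ((real ^ 'd) \<times> real) set)) = 1"
    using elim_stage_span[where 'd = 'd, OF B(1)[unfolded n_def]] by auto
  have span: "span {?v} = span (hvec ` set B)"
  proof (rule subspace_dim_equal)
    show "span {?v} \<subseteq> span (hvec ` set B)" using B(2) by (intro span_minimal) auto
    show "dim (span (hvec ` set B :: ((real ^ 'd) \<times> real) set)) \<le> dim (span {?v})" using dim1 v by simp
  qed auto
  have "\<exists>b\<in>set B. hvec b \<noteq> (0 :: (real ^ 'd) \<times> real)"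
  proof (rule ccontr)
    assume "\<not> ?thesis"
    then have "hvec ` set B \<subseteq> {0 :: (real ^ 'd) \<times> real}" by auto
    then have "dim (hvec ` set B :: ((real ^ 'd) \<times> real) set) \<le> dim {0 :: (real ^ 'd) \<times> real}" by (rule dim_subset)
    also have "dim {0 :: (real ^ 'd) \<times> real} = 0" by simp
    finally show False using dim1 unfolding dim_span by linarith
  qed
  then obtain b where b: "b \<in> set B" "hvec b \<noteq> (0 :: (real ^ 'd) \<times> real)" by blast
  have "hvec b \<in> span {?v}" unfolding span using b(1) by (intro span_base) blast
  then obtain k where k: "hvec b = k *\<^sub>R ?v" unfolding span_singleton by blast
  then have "k \<noteq> 0" using b(2) by (metis scaleR_zero_left)
  define h where "h = (if 0 < k then b else (\<lambda>i. - b i))"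
  have h: "hvec h = \<bar>k\<bar> *\<^sub>R ?v" using k \<open>k \<noteq> 0\<close> by (cases "0 < k") (simp_all add: h_def hvec_minus)
  have "0 \<le> dot n h u" if uG: "u \<in> set G" for u
  proof -
    obtain c' g where g: "0 < c'" "g \<in> gens Y" "hvec u = c' *\<^sub>R g"
      using rep uG unfolding represents_def by blast
    have "0 \<le> ?v \<bullet> g" using w g unfolding facet_normal_def by blast
    then have "0 \<le> hvec h \<bullet> (hvec u :: (real ^ 'd) \<times> real)"
      unfolding h g(3) inner_scaleR_left inner_scaleR_right using g(1) by simp
    then show ?thesis by (simp add: hvec_inner n_def)
  qed
  moreover have "0 < (\<Sum>i<CARD('d). h i)"
  proof -
    have "0 \<le> w" "w \<noteq> 0" using w unfolding facet_normal_def gens_ge_0_iff by auto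
    moreover obtain i where "w $ i \<noteq> 0" using \<open>w \<noteq> 0\<close> unfolding vec_eq_iff by auto
    ultimately have "0 < w $ i" by (simp add: less_eq_vec_def order_less_le)
    then have "0 < (\<Sum>i\<in>UNIV. w $ i)"
      using \<open>0 \<le> w\<close> by (intro sum_pos2[of UNIV i]) (auto simp: less_eq_vec_def)
    moreover have "of_int (\<Sum>i<CARD('d). h i) = \<bar>k\<bar> * (\<Sum>i\<in>UNIV. w $ i)"
    proof -
      have "of_int (h (to_nat_on UNIV i)) = \<bar>k\<bar> * w $ i" for i :: 'd
        using arg_cong[OF h, of "\<lambda>x. fst x $ i"] by (simp add: hvec_def)
      then show ?thesis unfolding sum_coordinates[where 'd = 'd] by (simp add: sum_distrib_left)
    qed
    ultimately have "0 < (of_int (\<Sum>i<CARD('d). h i) :: real)" using \<open>k \<noteq> 0\<close> by simp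
    then show ?thesis by (simp only: of_int_0_less_iff)
  qed
  ultimately have "h \<in> set (normals CARD('d) G)"
    unfolding set_normals using B(1) b(1) n_def by (auto simp: h_def)
  then show ?thesis using h \<open>k \<noteq> 0\<close> by (intro bexI[of _ h] exI[of _ "\<bar>k\<bar>"]) auto
qed

section \<open>Integer arithmetic with rational vectors\<close>

text \<open>
  The integral multiple of \<open>(y, 1)\<close> by the product of all denominators of \<open>y\<close>.
\<close>

definition homog :: "rat ^ ('d :: finite) \<Rightarrow> nat \<Rightarrow> int" where
  "homog y = (let p = (\<lambda>j. fst (quotient_of (y $ from_nat_into UNIV j)));
                q = (\<lambda>j. snd (quotient_of (y $ from_nat_into UNIV j)));
                D = \<Prod>j<CARD('d). q j
            in (\<lambda>i. if i < CARD('d) then p i * (D div q i) else D))"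

text \<open>
  The normal \<open>w\<close> of a functional; its entries are integers, so its code is written down without
  computing greatest common divisors.
\<close>

definition weight :: "(nat \<Rightarrow> int) \<Rightarrow> rat ^ ('d :: finite)" where
  "weight h = (\<chi> i. of_int (h (to_nat_on UNIV i)))"

lemma from_nat_into_to_nat_on_UNIV [simp]: "from_nat_into UNIV (to_nat_on UNIV (i :: 'd :: finite)) = i"
  by (simp add: countable_finite)

lemma to_nat_on_less_CARD: "to_nat_on UNIV (i :: 'd :: finite) < CARD('d)"
  using to_nat_on_finite[of "UNIV :: 'd set"] by (auto simp: bij_betw_def)

lemma to_nat_on_from_nat_into_UNIV: "j < CARD('d) \<Longrightarrow> to_nat_on UNIV (from_nat_into UNIV j :: 'd :: finite) = j"
  using to_nat_on_finite[of "UNIV :: 'd set"] by (intro to_nat_on_from_nat_into) (auto simp: bij_betw_def)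

lemma hvec_homog:
  fixes y :: "rat ^ ('d :: finite)"
  shows "0 < homog y CARD('d)" "hvec (homog y) = of_int (homog y CARD('d)) *\<^sub>R (real_vec y, 1)"
proof -
  define p where "p = (\<lambda>j. fst (quotient_of (y $ from_nat_into UNIV j)))"
  define q where "q = (\<lambda>j. snd (quotient_of (y $ from_nat_into UNIV j)))"
  define D where "D = (\<Prod>j<CARD('d). q j)"
  have homog: "homog y = (\<lambda>i. if i < CARD('d) then p i * (D div q i) else D)"
    unfolding homog_def p_def q_def D_def by (simp add: Let_def)
  have q: "0 < q j" for j unfolding q_def by (rule quotient_of_denom_pos')
  show "0 < homog y CARD('d)" unfolding homog D_def using q by (simp add: prod_pos)
  have "of_int (homog y (to_nat_on UNIV i)) = of_int D * (of_rat (y $ i) :: real)" for i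
  proof -
    let ?j = "to_nat_on UNIV i"
    have "y $ i = of_int (p ?j) / of_int (q ?j)"
      unfolding p_def q_def by (simp add: quotient_of_div)
    then have y: "of_rat (y $ i) = (of_int (p ?j) / of_int (q ?j) :: real)" by (simp add: of_rat_divide)
    have "q ?j dvd D" unfolding D_def using to_nat_on_less_CARD[of i] by (intro dvd_prodI) auto
    then have "of_int (D div q ?j) = (of_int D / of_int (q ?j) :: real)" by (rule real_of_int_div)
    then show ?thesis unfolding homog y using to_nat_on_less_CARD[of i] by simp
  qed
  then show "hvec (homog y) = of_int (homog y CARD('d)) *\<^sub>R (real_vec y, 1)"
    by (simp add: hvec_def real_vec_def vec_eq_iff) (simp add: homog)
qed

lemma hvec_weight: "(hvec h :: (real ^ ('d :: finite)) \<times> real) = (real_vec (weight h), of_int (h CARD('d)))"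
  by (simp add: hvec_def real_vec_def weight_def vec_eq_iff)

lemma enc_rat_eq: "enc_rat r = Pr (Num (fst (quotient_of r))) (Num (snd (quotient_of r)))"
  by (simp add: enc_rat_def case_prod_unfold)

lemma ptime_enc_vec:
  fixes y :: "'a \<Rightarrow> rat ^ ('d :: finite)"
  assumes "ptime A e (\<lambda>a. enc_vec (y a))" "i < CARD('d)"
  shows "pint A e (\<lambda>a. fst (quotient_of (y a $ from_nat_into UNIV i)))"
    "pint A e (\<lambda>a. snd (quotient_of (y a $ from_nat_into UNIV i)))"
  using ptime_component[OF assms(1)[unfolded enc_vec_def] assms(2)] unfolding enc_rat_eq
  by (auto dest: ptime_Fst ptime_Snd)

lemma ptime_homog:
  fixes y :: "'a \<Rightarrow> rat ^ ('d :: finite)"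
  assumes "ptime A e (\<lambda>a. enc_vec (y a))"
  shows "ptime A e (\<lambda>a. enc_ints (Suc CARD('d)) (homog (y a)))"
proof (rule ptime_enc_intsI)
  fix i assume "i < Suc CARD('d)"
  have D: "pint A e (\<lambda>a. \<Prod>j<CARD('d). snd (quotient_of (y a $ from_nat_into UNIV j)))"
    by (intro pint_prod ptime_enc_vec(2)[OF assms])
  show "pint A e (\<lambda>a. homog (y a) i)"
  proof (cases "i < CARD('d)")
    case True
    then show ?thesis unfolding homog_def Let_def
      using pint_mult[OF ptime_enc_vec(1)[OF assms True] pint_div[OF D ptime_enc_vec(2)[OF assms True]]] by simp
  next
    case False
    then show ?thesis unfolding homog_def Let_def using D by simp
  qed
qed

lemma ptime_weight:
  assumes "ptime A e (\<lambda>a. enc_ints (Suc CARD('d)) (h a))"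
  shows "ptime A e (\<lambda>a. enc_vec (weight (h a) :: rat ^ ('d :: finite)))"
  unfolding enc_vec_def
proof (rule ptime_tuple)
  fix j assume j: "j \<in> set [0..<CARD('d)]"
  then have eq: "enc_rat ((weight (h a) :: rat ^ 'd) $ from_nat_into UNIV j) = Pr (Num (h a j)) (Num 1)" for a
    by (simp add: weight_def to_nat_on_from_nat_into_UNIV enc_rat_eq)
  show "ptime A e (\<lambda>a. enc_rat ((weight (h a) :: rat ^ 'd) $ from_nat_into UNIV j))"
    unfolding eq using j by (intro ptime_Pr ptime_const_Num ptime_enc_intsD[OF assms]) auto
qed

text \<open>
  The negated oracle test \<open>(1 + \<epsilon>) w \<bullet> y < c\<close> for \<open>h = (w, - c)\<close>, multiplied by the denominator of \<open>\<epsilon>\<close> and the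
  denominators of \<open>y\<close> so that only integers occur.
\<close>

definition violated :: "nat \<Rightarrow> rat \<Rightarrow> (nat \<Rightarrow> int) \<Rightarrow> (nat \<Rightarrow> int) \<Rightarrow> bool" where
  "violated d \<epsilon> h u \<longleftrightarrow>
     (fst (quotient_of \<epsilon>) + snd (quotient_of \<epsilon>)) * dot d h u + snd (quotient_of \<epsilon>) * (h d * u d) < 0"

lemma pbool_violated:
  assumes \<epsilon>: "ptime A e (\<lambda>a. enc_rat (\<epsilon> a))"
    and h: "ptime A e (\<lambda>a. enc_ints (Suc d) (h a))" and u: "ptime A e (\<lambda>a. enc_ints (Suc d) (u a))"
  shows "pbool A e (\<lambda>a. violated d (\<epsilon> a) (h a) (u a))"
  unfolding violated_def dot_def
  by (intro pbool_less pint_add pint_mult pint_sum ptime_const_Num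
      ptime_enc_intsD[OF h] ptime_enc_intsD[OF u] ptime_Fst[OF \<epsilon>[unfolded enc_rat_eq]] ptime_Snd[OF \<epsilon>[unfolded enc_rat_eq]]) auto

lemma violated_homog_iff:
  fixes y :: "rat ^ ('d :: finite)"
  shows "violated CARD('d) \<epsilon> h (homog y) \<longleftrightarrow>
    of_rat (1 + \<epsilon>) * (real_vec (weight h) \<bullet> real_vec y) < - (of_int (h CARD('d)) :: real)"
proof -
  define p q where "p = fst (quotient_of \<epsilon>)" and "q = snd (quotient_of \<epsilon>)"
  define D where "D = (of_int (homog y CARD('d)) :: real)"
  define s where "s = real_vec (weight h) \<bullet> real_vec y"
  have q: "0 < q" unfolding q_def by (rule quotient_of_denom_pos')
  have D: "0 < D" unfolding D_def using hvec_homog(1)[of y] by simp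
  have "\<epsilon> = of_int p / of_int q" unfolding p_def q_def by (simp add: quotient_of_div)
  then have "of_rat \<epsilon> = (of_int p / of_int q :: real)" by (simp add: of_rat_divide)
  then have \<epsilon>: "of_int (p + q) = of_int q * (of_rat (1 + \<epsilon>) :: real)"
    using q by (simp add: of_rat_add distrib_left)
  have "hvec h \<bullet> (hvec (homog y) :: (real ^ 'd) \<times> real) = D * (s + of_int (h CARD('d)))"
    unfolding hvec_homog(2) by (simp add: hvec_weight D_def s_def distrib_left)
  then have "of_int (dot CARD('d) h (homog y)) + of_int (h CARD('d)) * D = D * (s + of_int (h CARD('d)))"
    unfolding hvec_inner by (simp add: dot_def D_def)
  then have dot: "of_int (dot CARD('d) h (homog y)) = D * s" by (simp add: algebra_simps)
  have "violated CARD('d) \<epsilon> h (homog y) \<longleftrightarrow>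
      of_int ((p + q) * dot CARD('d) h (homog y) + q * (h CARD('d) * homog y CARD('d))) < (0 :: real)"
    unfolding violated_def p_def q_def of_int_less_0_iff by (rule refl)
  also have "of_int ((p + q) * dot CARD('d) h (homog y) + q * (h CARD('d) * homog y CARD('d))) =
      (of_int q * D) * (of_rat (1 + \<epsilon>) * s + of_int (h CARD('d)))"
    unfolding of_int_add[of "_ * _"] of_int_mult \<epsilon> dot D_def by (simp add: algebra_simps)
  also have "\<dots> < 0 \<longleftrightarrow> of_rat (1 + \<epsilon>) * s + of_int (h CARD('d)) < 0"
    using q D by (simp add: mult_less_0_iff)
  finally show ?thesis unfolding s_def by linarith
qed

section \<open>The number of rounds\<close>

text \<open>
  Class 0 is reserved for the value zero, which has no logarithm; the factor \<open>2 ^ L\<close> makes the logarithm of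
  every other value of encoding length at most \<open>L\<close> nonnegative, so that \<open>nat\<close> does not identify values.
\<close>

definition cell :: "rat \<Rightarrow> nat \<Rightarrow> rat ^ ('d :: finite) \<Rightarrow> 'd \<Rightarrow> nat" where
  "cell \<epsilon> L y i = (if y $ i = 0 then 0 else Suc (nat \<lfloor>log (of_rat (1 + \<epsilon>)) (of_rat (y $ i) * 2 ^ L)\<rfloor>))"

lemma rat_bounds_of_len:
  assumes "len (enc_rat r) \<le> L" "0 < r"
  shows "1 \<le> of_rat r * (2 :: real) ^ L" "of_rat r \<le> (2 :: real) ^ L"
proof -
  define p q where "p = fst (quotient_of r)" and "q = snd (quotient_of r)"
  have q: "0 < q" unfolding q_def by (rule quotient_of_denom_pos')
  have "r = of_int p / of_int q" unfolding p_def q_def by (simp add: quotient_of_div)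
  then have r: "of_rat r = (of_int p / of_int q :: real)" by (simp add: of_rat_divide)
  have p: "0 < p" using assms(2) \<open>r = _\<close> q by (simp add: zero_less_divide_iff)
  have "nat (bitlen \<bar>p\<bar>) \<le> L" "nat (bitlen \<bar>q\<bar>) \<le> L"
    using assms(1) unfolding enc_rat_eq p_def q_def by auto
  then have "(2 :: int) ^ nat (bitlen \<bar>p\<bar>) \<le> 2 ^ L" "(2 :: int) ^ nat (bitlen \<bar>q\<bar>) \<le> 2 ^ L"
    by (auto intro: power_increasing)
  then have "p \<le> 2 ^ L" "q \<le> 2 ^ L"
    using less_two_power_bitlen[of p] less_two_power_bitlen[of q] by linarith+
  then have "of_int p \<le> (of_int (2 ^ L) :: real)" "of_int q \<le> (of_int (2 ^ L) :: real)"
    by (simp_all only: of_int_le_iff)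
  then have pL: "of_int p \<le> (2 :: real) ^ L" and qL: "of_int q \<le> (2 :: real) ^ L" by simp_all
  have p1: "1 \<le> (of_int p :: real)" and q1: "1 \<le> (of_int q :: real)" using p q by simp_all
  have "of_int q * 1 \<le> (2 :: real) ^ L * of_int p" using qL p1 by (intro mult_mono) auto
  then show "1 \<le> of_rat r * (2 :: real) ^ L" unfolding r using q1 by (simp add: field_simps)
  have "of_int p * 1 \<le> (2 :: real) ^ L * of_int q" using pL q1 by (intro mult_mono) auto
  then show "of_rat r \<le> (2 :: real) ^ L" unfolding r using q1 by (simp add: field_simps)
qed

text \<open>
  The values range over a factor \<open>4 ^ L\<close>. Dividing its logarithm by \<open>ln (1 + \<epsilon>) \<ge> \<epsilon> / (1 + \<epsilon>)\<close> gives
  a bound in terms of \<open>1 + 1 / \<epsilon>\<close> that is valid for large and small \<open>\<epsilon>\<close> alike.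
\<close>

lemma cell_le:
  assumes \<epsilon>: "0 < \<epsilon>" and y: "0 \<le> y $ i" "len (enc_rat (y $ i)) \<le> L"
  shows "cell \<epsilon> L y i \<le> 2 * L * (1 + nat \<lceil>1 / \<epsilon>\<rceil>) + 1"
proof (cases "y $ i = 0")
  case False
  define b where "b = (of_rat (1 + \<epsilon>) :: real)"
  define v where "v = of_rat (y $ i) * (2 :: real) ^ L"
  have e: "0 < (of_rat \<epsilon> :: real)" using \<epsilon> by simp
  have b: "b = 1 + of_rat \<epsilon>" unfolding b_def by (simp add: of_rat_add)
  have b0: "0 < b" using b e by linarith
  have v: "1 \<le> v" "v \<le> 2 ^ L * 2 ^ L"
    using rat_bounds_of_len[OF y(2)] y(1) False unfolding v_def by (auto intro: mult_right_mono)
  have "ln (1 / b) \<le> 1 / b - 1" using b0 by (intro ln_le_minus_one) simp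
  then have lnb: "of_rat \<epsilon> / b \<le> ln b" using b0 by (simp add: b ln_div field_simps)
  have "ln v \<le> ln (2 ^ (2 * L))" using v by (intro ln_mono) (auto simp: power_add mult_2)
  also have "\<dots> = real (2 * L) * ln 2" by (simp add: ln_realpow)
  also have "\<dots> \<le> real (2 * L) * 1" using ln_le_minus_one[of 2] by (intro mult_left_mono) auto
  finally have "ln v \<le> real (2 * L)" by simp
  then have "log b v \<le> real (2 * L) / (of_rat \<epsilon> / b)"
    unfolding log_def using lnb divide_pos_pos[OF e b0] v(1) by (intro frac_le) auto
  also have "\<dots> = real (2 * L) * (1 + 1 / of_rat \<epsilon>)" using e by (simp add: b field_simps)
  also have "\<dots> \<le> real (2 * L) * real (1 + nat \<lceil>1 / \<epsilon>\<rceil>)"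
  proof (intro mult_left_mono)
    have "1 / of_rat \<epsilon> = (of_rat (1 / \<epsilon>) :: real)" by (simp add: of_rat_divide)
    also have "\<dots> \<le> of_rat (of_int \<lceil>1 / \<epsilon>\<rceil>)" by (simp only: of_rat_less_eq le_of_int_ceiling)
    also have "\<dots> = real (nat \<lceil>1 / \<epsilon>\<rceil>)" using \<epsilon> by simp
    finally show "1 + 1 / of_rat \<epsilon> \<le> real (1 + nat \<lceil>1 / \<epsilon>\<rceil>)" by simp
  qed simp
  finally have "log b v \<le> real (2 * L * (1 + nat \<lceil>1 / \<epsilon>\<rceil>))" by (simp only: of_nat_mult)
  then have "nat \<lfloor>log b v\<rfloor> \<le> 2 * L * (1 + nat \<lceil>1 / \<epsilon>\<rceil>)" by linarith
  then show ?thesis unfolding cell_def using False b_def v_def by simp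
qed (simp add: cell_def)

text \<open>
  Equal integral parts of logarithms mean that the logarithms differ by less than one.
\<close>

lemma le_of_cell_eq:
  fixes y y' :: "rat ^ ('d :: finite)"
  assumes \<epsilon>: "0 < \<epsilon>" and y: "0 \<le> y" "0 \<le> y'"
    and len: "\<And>i. len (enc_rat (y $ i)) \<le> L" "\<And>i. len (enc_rat (y' $ i)) \<le> L"
    and eq: "cell \<epsilon> L y = cell \<epsilon> L y'"
  shows "real_vec y \<le> of_rat (1 + \<epsilon>) *\<^sub>R real_vec y'"
proof -
  define b where "b = (of_rat (1 + \<epsilon>) :: real)"
  have b: "1 < b" using \<epsilon> by (simp add: b_def of_rat_add)
  have "of_rat (y $ i) \<le> b * of_rat (y' $ i)" for i
  proof (cases "y $ i = 0 \<or> y' $ i = 0")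
    case True
    then have "y $ i = 0" using fun_cong[OF eq, of i] by (auto simp: cell_def split: if_splits)
    then show ?thesis using y b by (simp add: less_eq_vec_def)
  next
    case False
    define v v' where "v = of_rat (y $ i) * (2 :: real) ^ L" and "v' = of_rat (y' $ i) * (2 :: real) ^ L"
    have "0 < y $ i" "0 < y' $ i" using False y by (auto simp: less_eq_vec_def order_less_le)
    then have v: "1 \<le> v" "1 \<le> v'" using rat_bounds_of_len(1) len unfolding v_def v'_def by auto
    then have log: "0 \<le> log b v" "0 \<le> log b v'" using b by (simp_all add: zero_le_log_cancel_iff)
    have "nat \<lfloor>log b v\<rfloor> = nat \<lfloor>log b v'\<rfloor>"
      using fun_cong[OF eq, of i] False by (simp add: cell_def b_def v_def v'_def)
    then have "\<lfloor>log b v\<rfloor> = \<lfloor>log b v'\<rfloor>" using log by (simp add: eq_nat_nat_iff)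
    then have "log b v \<le> 1 + log b v'" by linarith
    also have "\<dots> = log b (b * v')" using b v by (simp add: log_mult)
    finally have "v \<le> b * v'" using b v by (simp add: log_le_cancel_iff)
    then show ?thesis unfolding v_def v'_def by simp
  qed
  then show ?thesis by (simp add: less_eq_vec_def real_vec_def b_def)
qed

lemma card_le_of_inj_on_cell:
  assumes "finite Y" "inj_on (cell \<epsilon> L) Y" "0 < \<epsilon>"
    and "\<And>y i. y \<in> Y \<Longrightarrow> 0 \<le> y $ i \<and> len (enc_rat (y $ i)) \<le> L"
  shows "card (Y :: (rat ^ ('d :: finite)) set) \<le> (2 * L * (1 + nat \<lceil>1 / \<epsilon>\<rceil>) + 2) ^ CARD('d)"
proof -
  define K where "K = 2 * L * (1 + nat \<lceil>1 / \<epsilon>\<rceil>) + 1"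
  have sub: "cell \<epsilon> L ` Y \<subseteq> PiE UNIV (\<lambda>_. {..K})"
    using assms(3,4) cell_le[of \<epsilon> _ _ L] by (auto simp: K_def)
  have "card Y = card (cell \<epsilon> L ` Y)" using assms(2) by (rule card_image[symmetric])
  also have "\<dots> \<le> card (PiE (UNIV :: 'd set) (\<lambda>_. {..K}))" using sub by (intro card_mono finite_PiE) auto
  also have "\<dots> = Suc K ^ CARD('d)" by (simp add: card_PiE)
  finally show ?thesis by (simp add: K_def)
qed

section \<open>One round of the algorithm\<close>

definition image_vec :: "('d :: finite) momilp \<Rightarrow> rat list \<Rightarrow> rat ^ 'd" where
  "image_vec M x = (\<chi> i. \<Sum>j<num_vars M. Qmat M i j * x ! j)"

lemma real_vec_image_vec:
  assumes "real_sol x \<in> feasible M"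
  shows "real_vec (image_vec M x) = objective M (real_sol x)"
proof -
  have "length x = num_vars M" using assms by (simp add: feasible_def)
  then show ?thesis by (simp add: image_vec_def objective_def real_vec_def of_rat_sum of_rat_mult)
qed

lemma inj_real_vec: "real_vec x = real_vec y \<longleftrightarrow> x = y"
  by (simp add: real_vec_def vec_eq_iff)

lemma real_vec_ge_0_iff: "0 \<le> real_vec y \<longleftrightarrow> 0 \<le> y"
  by (simp add: real_vec_def less_eq_vec_def)

lemma real_vec_scale: "real_vec (k *s w) = of_rat k *\<^sub>R real_vec w"
  by (simp add: real_vec_def vec_eq_iff of_rat_mult)

lemma halfspace_scale: "0 < k \<Longrightarrow> halfspace (k *\<^sub>R w) (k * c) = halfspace w c"
  by (simp add: halfspace_def)

lemma inner_set_eq_upper_hull: "inner_set f R = upper_hull (f ` R)"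
  by (simp add: inner_set_def upper_hull_def)

definition enc_point :: "nat \<Rightarrow> rat list \<times> (nat \<Rightarrow> int) \<Rightarrow> val" where
  "enc_point n = (\<lambda>(x, u). Pr (enc_sol x) (enc_ints n u))"

lemma hvec_unit:
  assumes "j < CARD('d :: finite)"
  shows "hvec (\<lambda>i. if i = j then 1 else 0) = (axis (from_nat_into UNIV j :: 'd) 1, 0)"
  using assms to_nat_on_from_nat_into_UNIV[where 'd = 'd, OF assms]
  by (auto simp: hvec_def vec_eq_iff axis_def)

text \<open>
  The unit vectors of the first \<open>CARD('d)\<close> coordinates are the directions of the orthant.
\<close>

definition gen_list :: "(rat ^ ('d :: finite)) list \<Rightarrow> (nat \<Rightarrow> int) list" where
  "gen_list ys = map homog ys @ unit_list CARD('d)"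

lemma represents_gen_list: "represents (gen_list ys) (real_vec ` set ys)"
  unfolding represents_def
proof (intro conjI ballI)
  fix u assume "u \<in> set (gen_list ys)"
  then consider y where "y \<in> set ys" "u = homog y"
    | j where "j < CARD('a)" "u = (\<lambda>i. if i = j then 1 else 0)"
    by (auto simp: gen_list_def unit_list_def)
  then show "\<exists>c>0. \<exists>g\<in>gens (real_vec ` set ys). hvec u = c *\<^sub>R g"
  proof cases
    case 1
    then have "(real_vec y, 1) \<in> gens (real_vec ` set ys)" unfolding gens_def by blast
    moreover have "0 < (of_int (homog y CARD('a)) :: real)" using hvec_homog(1)[of y] by simp
    ultimately show ?thesis using hvec_homog(2)[of y] 1 by blast
  next
    case 2
    then have "hvec u \<in> gens (real_vec ` set ys)" unfolding 2(2) hvec_unit[OF 2(1)] gens_def by blast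
    then show ?thesis by (intro exI[of _ 1]) auto
  qed
next
  fix g assume "g \<in> gens (real_vec ` set ys)"
  then consider y where "y \<in> set ys" "g = (real_vec y, 1)" | i where "g = (axis i 1, 0)"
    unfolding gens_def by blast
  then show "\<exists>c>0. \<exists>u\<in>set (gen_list ys). hvec u = c *\<^sub>R g"
  proof cases
    case 1
    then have "homog y \<in> set (gen_list ys)" by (simp add: gen_list_def)
    moreover have "0 < (of_int (homog y CARD('a)) :: real)" using hvec_homog(1)[of y] by simp
    ultimately show ?thesis using hvec_homog(2)[of y] 1 by blast
  next
    case (2 i)
    let ?u = "\<lambda>k. if k = to_nat_on UNIV i then 1 else 0 :: int"
    have "?u \<in> set (gen_list ys)" using to_nat_on_less_CARD[of i] by (auto simp: gen_list_def unit_list_def)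
    moreover have "hvec ?u = 1 *\<^sub>R g" using hvec_unit[OF to_nat_on_less_CARD[of i]] 2 by simp
    ultimately show ?thesis by (intro exI[of _ 1]) auto
  qed
qed

locale weighted_sum_class =
  fixes D :: "val set"
    and mip :: "val \<Rightarrow> ('d :: finite) momilp"
    and WS :: "val \<Rightarrow> rat ^ 'd \<Rightarrow> rat list"
  assumes encoding: "momilp_encoding D mip"
    and algorithm: "WS_algorithm D mip WS"
    and poly_time: "poly_time_WS D WS"
begin

abbreviation img :: "val \<Rightarrow> rat list \<Rightarrow> rat ^ 'd" where
  "img I \<equiv> image_vec (mip I)"

abbreviation obj :: "val \<Rightarrow> real list \<Rightarrow> real ^ 'd" where
  "obj I \<equiv> objective (mip I)"

abbreviation hpO :: "val \<Rightarrow> rat ^ 'd \<Rightarrow> real \<Rightarrow> real list option" where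
  "hpO I \<equiv> hpO_WS (obj I) (\<lambda>w. real_sol (WS I w))"

definition outputs :: "val \<Rightarrow> rat list set" where
  "outputs I = WS I ` {w. 0 \<le> w}"

text \<open>
  A solution is stored together with its homogenised image, which saves evaluating the objective again in
  later rounds.
\<close>

definition point :: "val \<Rightarrow> rat list \<Rightarrow> rat list \<times> (nat \<Rightarrow> int)" where
  "point I x = (x, homog (img I x))"

definition candidates :: "val \<Rightarrow> rat list list \<Rightarrow> (nat \<Rightarrow> int) list" where
  "candidates I xs = normals CARD('d) (gen_list (map (img I) xs))"

text \<open>
  All answers \<open>not inside\<close> that the oracle gives on the facets of the current approximation.
\<close>

definition violators :: "val \<Rightarrow> rat \<Rightarrow> rat list list \<Rightarrow> (rat list \<times> (nat \<Rightarrow> int)) list" where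
  "violators I \<epsilon> xs = concat (map (\<lambda>h. let p = point I (WS I (weight h)) in
     if violated CARD('d) \<epsilon> h (snd p) then [p] else []) (candidates I xs))"

lemma WS_optimal: "I \<in> D \<Longrightarrow> 0 \<le> w \<Longrightarrow> solves_weighted_sum (mip I) (real_vec w) (real_sol (WS I w))"
  using algorithm unfolding WS_algorithm_def by blast

lemma outputs_feasible: "I \<in> D \<Longrightarrow> x \<in> outputs I \<Longrightarrow> real_sol x \<in> feasible (mip I)"
  using WS_optimal unfolding outputs_def solves_weighted_sum_def by blast

lemma real_vec_img: "I \<in> D \<Longrightarrow> x \<in> outputs I \<Longrightarrow> real_vec (img I x) = obj I (real_sol x)"
  by (simp add: real_vec_image_vec outputs_feasible)

lemma img_nonneg: "I \<in> D \<Longrightarrow> x \<in> outputs I \<Longrightarrow> 0 \<le> img I x"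
  using encoding outputs_feasible[of I x] real_vec_img[of I x]
  unfolding momilp_encoding_def admissible_def images_def by (simp flip: real_vec_ge_0_iff)

lemma weight_nonneg:
  assumes "h \<in> set (candidates I xs)" shows "0 \<le> (weight h :: rat ^ 'd)"
proof -
  have "0 \<le> h j" if j: "j < CARD('d)" for j
  proof -
    let ?u = "\<lambda>i. if i = j then 1 else 0 :: int"
    have "?u \<in> set (gen_list (map (img I) xs))" using j by (auto simp: gen_list_def unit_list_def)
    then have "0 \<le> dot (Suc CARD('d)) h ?u" using assms unfolding candidates_def set_normals by blast
    also have "dot (Suc CARD('d)) h ?u = h j" using j by (simp add: dot_def if_distrib cong: if_cong)
    finally show ?thesis .
  qed
  then show ?thesis using to_nat_on_less_CARD[where 'd = 'd] by (simp add: weight_def less_eq_vec_def)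
qed

context
  fixes I :: val and \<epsilon> :: rat and xs :: "rat list list"
  assumes I: "I \<in> D" and \<epsilon>: "0 < \<epsilon>" and xs: "set xs \<subseteq> outputs I" "xs \<noteq> []"
begin

abbreviation "R \<equiv> real_sol ` set xs"

lemma obj_R: "obj I ` R = real_vec ` set (map (img I) xs)"
  using real_vec_img[OF I] xs(1) by (force simp: image_image)

lemma fin_ne_R: "finite (obj I ` R)" "obj I ` R \<noteq> {}"
  using xs(2) by auto

lemma candidate_facet_normal:
  "h \<in> set (candidates I xs) \<Longrightarrow> facet_normal (obj I ` R) (real_vec (weight h)) (- of_int (h CARD('d)))"
  unfolding obj_R candidates_def by (rule normals_sound[OF represents_gen_list]) (auto simp: hvec_weight)

text \<open>
  For a candidate \<open>h = (w, - c)\<close> the halfspace is represented by \<open>w / (1 + \<epsilon>)\<close> and \<open>c / (1 + \<epsilon>)\<close>. The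
  algorithm multiplies this normal by \<open>1 + \<epsilon>\<close> again, so the oracle is called with the integral weight \<open>w\<close>.
\<close>

lemma candidate_step:
  assumes h: "h \<in> set (candidates I xs)"
  defines "x \<equiv> WS I (weight h)"
  defines "H \<equiv> halfspace (real_vec (weight h)) (- of_int (h CARD('d)))"
  shows "H \<in> facet_halfspaces (inner_set (obj I) R)"
    and "violated CARD('d) \<epsilon> h (homog (img I x)) \<Longrightarrow>
      inner_step (obj I) (hpO I) \<epsilon> (R, {}) (insert (real_sol x) R, {})"
    and "\<not> violated CARD('d) \<epsilon> h (homog (img I x)) \<Longrightarrow> H \<notin> F \<Longrightarrow>
      inner_step (obj I) (hpO I) \<epsilon> (R, F) (R, insert H F)"
proof -
  define c where "c = - (of_int (h CARD('d)) :: real)"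
  define e where "e = (of_rat (1 + \<epsilon>) :: real)"
  define w where "w = (1 / (1 + \<epsilon>)) *s (weight h :: rat ^ 'd)"
  have e: "0 < e" using \<epsilon> by (simp add: e_def)
  have w: "(1 + \<epsilon>) *s w = weight h" using \<epsilon> by (simp add: w_def vec_eq_iff)
  have "real_vec w = (1 / e) *\<^sub>R real_vec (weight h)"
    unfolding w_def real_vec_scale e_def by (simp add: of_rat_divide)
  then have H: "H = halfspace (real_vec w) (1 / e * c)"
    unfolding H_def c_def[symmetric] using e by (simp only: halfspace_scale zero_less_divide_1_iff)
  show facet: "H \<in> facet_halfspaces (inner_set (obj I) R)"
    unfolding inner_set_eq_upper_hull H_def
    by (rule upper_hull_facet_halfspaceI[OF fin_ne_R(2) candidate_facet_normal[OF h]])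
  have x: "x \<in> outputs I" unfolding x_def outputs_def using weight_nonneg[OF h] by blast
  then have "violated CARD('d) \<epsilon> h (homog (img I x)) \<longleftrightarrow> real_vec (weight h) \<bullet> obj I (real_sol x) < 1 / e * c"
    using e unfolding violated_homog_iff real_vec_img[OF I x, symmetric] c_def[symmetric] e_def[symmetric]
    by (simp add: pos_less_divide_eq mult.commute)
  then have answer: "hpO I ((1 + \<epsilon>) *s w) (1 / e * c) =
      (if violated CARD('d) \<epsilon> h (homog (img I x)) then Some (real_sol x) else None)"
    unfolding hpO_WS_def w x_def[symmetric] Let_def by (simp add: not_less)
  show "inner_step (obj I) (hpO I) \<epsilon> (R, {}) (insert (real_sol x) R, {})"
    if "violated CARD('d) \<epsilon> h (homog (img I x))"
    by (rule inner_step.not_inside[of H _ _ _ w "1 / e * c"]) (use that facet H answer in auto)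
  show "inner_step (obj I) (hpO I) \<epsilon> (R, F) (R, insert H F)"
    if "\<not> violated CARD('d) \<epsilon> h (homog (img I x))" "H \<notin> F"
    by (rule inner_step.inside[of H _ _ _ w "1 / e * c"]) (use that facet H answer in auto)
qed

text \<open>
  The last claim makes the grid argument work: the approximation is contained in the violated facet
  halfspace, so an earlier image below \<open>(1 + \<epsilon>) f(x\<^sup>*)\<close> would force that point into the halfspace.
\<close>

lemma violator_step:
  assumes "p \<in> set (violators I \<epsilon> xs)"
  shows "fst p \<in> outputs I" "p = point I (fst p)"
    "inner_step (obj I) (hpO I) \<epsilon> (R, {}) (insert (real_sol (fst p)) R, {})"
    "y \<in> img I ` set xs \<Longrightarrow> \<not> real_vec y \<le> of_rat (1 + \<epsilon>) *\<^sub>R real_vec (img I (fst p))"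
proof -
  obtain h where h: "h \<in> set (candidates I xs)" "p = point I (WS I (weight h))"
      "violated CARD('d) \<epsilon> h (homog (img I (WS I (weight h))))"
    using assms unfolding violators_def by (auto simp: Let_def point_def split: if_splits)
  show "fst p \<in> outputs I" using weight_nonneg[OF h(1)] by (simp add: h(2) point_def outputs_def)
  show "p = point I (fst p)" by (simp add: h(2) point_def)
  show "inner_step (obj I) (hpO I) \<epsilon> (R, {}) (insert (real_sol (fst p)) R, {})"
    using candidate_step(2)[OF h(1,3)] by (simp add: h(2) point_def)
  show "\<not> real_vec y \<le> of_rat (1 + \<epsilon>) *\<^sub>R real_vec (img I (fst p))" if y: "y \<in> img I ` set xs"
  proof
    assume le: "real_vec y \<le> of_rat (1 + \<epsilon>) *\<^sub>R real_vec (img I (fst p))"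
    have "real_vec y \<in> obj I ` R" unfolding obj_R using y by auto
    then have "- of_int (h CARD('d)) \<le> real_vec (weight h) \<bullet> real_vec y" "0 \<le> real_vec (weight h :: rat ^ 'd)"
      using candidate_facet_normal[OF h(1)] unfolding facet_normal_def gens_ge_0_iff by auto
    moreover from this(2) le have "0 \<le> real_vec (weight h) \<bullet> (of_rat (1 + \<epsilon>) *\<^sub>R real_vec (img I (fst p)) - real_vec y)"
      by (intro inner_ge_0) (auto simp: less_eq_vec_def)
    ultimately show False
      using h(3) unfolding violated_homog_iff h(2) point_def fst_conv by (simp add: inner_diff_right)
  qed
qed

lemma facet_halfspace_candidate:
  assumes "H \<in> facet_halfspaces (inner_set (obj I) R)"
  shows "\<exists>h\<in>set (candidates I xs). H = halfspace (real_vec (weight h)) (- of_int (h CARD('d)))"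
proof -
  obtain w c where H: "H = halfspace w c" and w: "facet_normal (obj I ` R) w c"
    using assms unfolding inner_set_eq_upper_hull by (rule upper_hull_facet_halfspaceE[OF fin_ne_R])
  obtain h k where h: "h \<in> set (candidates I xs)" "0 < k" "hvec h = k *\<^sub>R (w, - c)"
    using normals_complete[OF represents_gen_list w[unfolded obj_R]] unfolding candidates_def by blast
  have "real_vec (weight h) = k *\<^sub>R w" "- of_int (h CARD('d)) = k * c"
    using h(3) unfolding hvec_weight by auto
  then have "H = halfspace (real_vec (weight h)) (- of_int (h CARD('d)))"
    using h(2) by (simp only: halfspace_scale H)
  then show ?thesis using h(1) by blast
qed

text \<open>
  With all oracle answers \<open>inside\<close>, the algorithm can move the facets to \<open>F\<close> one by one. The
  optimality of \<open>WS\<close> turns each answer into an inequality valid for all feasible solutions, whence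
  \<open>(1 + \<epsilon>) f(x)\<close> satisfies all facet inequalities.
\<close>

lemma no_violators:
  assumes none: "violators I \<epsilon> xs = []"
  shows "(inner_step (obj I) (hpO I) \<epsilon>)\<^sup>*\<^sup>* (R, {}) (R, facet_halfspaces (inner_set (obj I) R))"
    and "convex_approx_set (mip I) \<epsilon> R"
proof -
  let ?FH = "facet_halfspaces (inner_set (obj I) R)"
  have inside: "\<not> violated CARD('d) \<epsilon> h (homog (img I (WS I (weight h))))" if "h \<in> set (candidates I xs)" for h
    using none that unfolding violators_def by (auto simp: Let_def point_def split: if_splits)
  have "?FH \<subseteq> (\<lambda>h. halfspace (real_vec (weight h)) (- of_int (h CARD('d)))) ` set (candidates I xs)"
    using facet_halfspace_candidate by blast
  then have "finite ?FH" by (rule finite_subset) simp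
  moreover have "(inner_step (obj I) (hpO I) \<epsilon>)\<^sup>*\<^sup>* (R, {}) (R, F)" if "finite F" "F \<subseteq> ?FH" for F
    using that
  proof (induction F rule: finite_induct)
    case (insert H F)
    obtain h where h: "h \<in> set (candidates I xs)" "H = halfspace (real_vec (weight h)) (- of_int (h CARD('d)))"
      using facet_halfspace_candidate insert.prems by blast
    have "inner_step (obj I) (hpO I) \<epsilon> (R, F) (R, insert H F)"
      using candidate_step(3)[OF h(1) inside[OF h(1)]] insert.hyps h(2) by simp
    with insert.IH insert.prems show ?case by (auto intro: rtranclp.rtrancl_into_rtrancl)
  qed simp
  ultimately show "(inner_step (obj I) (hpO I) \<epsilon>)\<^sup>*\<^sup>* (R, {}) (R, ?FH)" by blast
  show "convex_approx_set (mip I) \<epsilon> R" unfolding convex_approx_set_def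
  proof (intro conjI ballI)
    show "R \<subseteq> feasible (mip I)" using outputs_feasible[OF I] xs(1) by auto
    fix x assume x: "x \<in> feasible (mip I)"
    let ?z = "of_rat (1 + \<epsilon>) *\<^sub>R obj I x"
    have "?z \<in> H" if H: "H \<in> ?FH" for H
    proof -
      obtain h where h: "h \<in> set (candidates I xs)" "H = halfspace (real_vec (weight h)) (- of_int (h CARD('d)))"
        using facet_halfspace_candidate[OF H] by blast
      let ?w = "weight h :: rat ^ 'd"
      have w: "0 \<le> ?w" using weight_nonneg[OF h(1)] .
      have "real_vec ?w \<bullet> obj I (real_sol (WS I ?w)) \<le> real_vec ?w \<bullet> obj I x"
        using WS_optimal[OF I w] x unfolding solves_weighted_sum_def by blast
      then have "of_rat (1 + \<epsilon>) * (real_vec ?w \<bullet> obj I (real_sol (WS I ?w))) \<le> of_rat (1 + \<epsilon>) * (real_vec ?w \<bullet> obj I x)"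
        using \<epsilon> by (intro mult_left_mono) auto
      moreover have "WS I ?w \<in> outputs I" using w unfolding outputs_def by blast
      then have "- of_int (h CARD('d)) \<le> of_rat (1 + \<epsilon>) * (real_vec ?w \<bullet> obj I (real_sol (WS I ?w)))"
        using inside[OF h(1)] unfolding violated_homog_iff by (simp add: real_vec_img[OF I])
      ultimately show ?thesis unfolding h(2) halfspace_def by simp
    qed
    then have "?z \<in> upper_hull (obj I ` R)"
      using Inter_facet_halfspaces_upper_hull[OF fin_ne_R] unfolding inner_set_eq_upper_hull by blast
    then obtain v r where v: "?z = v + r" "v \<in> convex hull (obj I ` R)" "0 \<le> r" unfolding upper_hull_def by blast
    then have "v \<le> ?z" by (simp add: less_eq_vec_def)
    then show "\<exists>v\<in>convex hull (obj I ` R). v \<le> ?z" using v(2) by blast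
  qed
qed

end

end

section \<open>The running time\<close>

text \<open>
  The bookkeeping for the main loop, whose iteration count depends on \<open>1 / \<epsilon>\<close> and not
  only on the length of the input; \<open>N\<close> is the size measure.
\<close>

definition poly_bounded :: "'a set \<Rightarrow> ('a \<Rightarrow> nat) \<Rightarrow> ('a \<Rightarrow> nat) \<Rightarrow> bool" where
  "poly_bounded A N f \<longleftrightarrow> (\<exists>k. \<forall>a\<in>A. f a \<le> (N a + 2) ^ k)"

lemma poly_bounded_mono: "poly_bounded A N g \<Longrightarrow> (\<And>a. a \<in> A \<Longrightarrow> f a \<le> g a) \<Longrightarrow> poly_bounded A N f"
  unfolding poly_bounded_def by (meson order_trans)

lemma poly_bounded_const: "poly_bounded A N (\<lambda>_. c)"
  unfolding poly_bounded_def by (intro exI[of _ c] ballI const_le_power) simp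

lemma poly_bounded_self: "(\<And>a. a \<in> A \<Longrightarrow> f a \<le> N a) \<Longrightarrow> poly_bounded A N f"
  unfolding poly_bounded_def by (intro exI[of _ 1]) (simp add: le_SucI)

lemma poly_bounded_add:
  assumes "poly_bounded A N f" "poly_bounded A N g" shows "poly_bounded A N (\<lambda>a. f a + g a)"
proof -
  obtain k l where "\<forall>a\<in>A. f a \<le> (N a + 2) ^ k" "\<forall>a\<in>A. g a \<le> (N a + 2) ^ l"
    using assms unfolding poly_bounded_def by blast
  then have "f a + g a \<le> (N a + 2) ^ (k + l + 1)" if "a \<in> A" for a
    using that by (intro order_trans[OF add_mono sum_powers_le]) auto
  then show ?thesis unfolding poly_bounded_def by blast
qed

lemma poly_bounded_mult:
  assumes "poly_bounded A N f" "poly_bounded A N g" shows "poly_bounded A N (\<lambda>a. f a * g a)"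
proof -
  obtain k l where "\<forall>a\<in>A. f a \<le> (N a + 2) ^ k" "\<forall>a\<in>A. g a \<le> (N a + 2) ^ l"
    using assms unfolding poly_bounded_def by blast
  then have "f a * g a \<le> (N a + 2) ^ (k + l)" if "a \<in> A" for a
    using that by (simp add: power_add mult_le_mono)
  then show ?thesis unfolding poly_bounded_def by blast
qed

lemma poly_bounded_power: "poly_bounded A N f \<Longrightarrow> poly_bounded A N (\<lambda>a. f a ^ k)"
  by (induction k) (simp_all add: poly_bounded_const poly_bounded_mult)

lemmas poly_bounded_intros = poly_bounded_const poly_bounded_add poly_bounded_mult poly_bounded_power

lemma poly_bounded_ptime:
  assumes "ptime A e f" "poly_bounded A N (\<lambda>a. len (e a))"
  shows "poly_bounded A N (\<lambda>a. len (f a))"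
proof -
  obtain k where "\<forall>a\<in>A. len (f a) \<le> (len (e a) + 1) ^ k" using ptime_len[OF assms(1)] by blast
  moreover have "poly_bounded A N (\<lambda>a. (len (e a) + 1) ^ k)" by (intro poly_bounded_intros assms(2))
  ultimately show ?thesis by (blast intro: poly_bounded_mono)
qed

lemma ptimeI_poly:
  fixes p :: "real poly"
  assumes "\<And>a. a \<in> A \<Longrightarrow> \<exists>t. run P (Pr (f a) (g a)) (h a) t \<and> real t \<le> poly p (real (len (f a) + len (g a)))"
  shows "ptime A (\<lambda>a. Pr (f a) (g a)) h"
proof -
  obtain k where k: "\<forall>n t. real t \<le> poly p (real n) \<longrightarrow> t \<le> (n + 2) ^ k" using poly_le_power_nat by blast
  have "\<exists>t. run P (Pr (f a) (g a)) (h a) t \<and> t \<le> (len (Pr (f a) (g a)) + 1) ^ k" if "a \<in> A" for a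
  proof -
    obtain t where t: "run P (Pr (f a) (g a)) (h a) t" "real t \<le> poly p (real (len (f a) + len (g a)))"
      using assms[OF \<open>a \<in> A\<close>] by blast
    then have "t \<le> (len (f a) + len (g a) + 2) ^ k" using k by blast
    with t(1) show ?thesis by auto
  qed
  then show ?thesis by (rule ptimeI)
qed

lemma len_component_le: "len (enc_rat (y $ i)) \<le> len (enc_vec (y :: rat ^ ('d :: finite)))"
  unfolding enc_vec_def
proof (rule len_le_len_enc_list)
  show "enc_rat (y $ i) \<in> set (map (\<lambda>j. enc_rat (y $ from_nat_into UNIV j)) [0..<CARD('d)])"
    unfolding set_map
    by (rule image_eqI[of _ _ "to_nat_on UNIV i"]) (simp_all add: to_nat_on_less_CARD)
qed

context weighted_sum_class
begin

lemma ptime_WS: "ptime {(I, w). I \<in> D \<and> 0 \<le> w} (\<lambda>\<sigma>. Pr (fst \<sigma>) (enc_vec (snd \<sigma>))) (\<lambda>\<sigma>. enc_sol (WS (fst \<sigma>) (snd \<sigma>)))"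
proof -
  obtain P and p :: "real poly" where P: "\<forall>I\<in>D. \<forall>w\<ge>0. \<exists>t. run P (Pr I (enc_vec w)) (enc_sol (WS I w)) t \<and>
      real t \<le> poly p (real (len I + len (enc_vec w)))"
    using poly_time unfolding poly_time_WS_def by (elim exE) (rule that)
  show ?thesis by (rule ptimeI_poly[where P = P and p = p]) (use P in auto)
qed

lemma ptime_img:
  "ptime {(I, x). I \<in> D \<and> x \<in> outputs I} (\<lambda>\<sigma>. Pr (fst \<sigma>) (enc_sol (snd \<sigma>))) (\<lambda>\<sigma>. enc_vec (img (fst \<sigma>) (snd \<sigma>)))"
proof -
  obtain P and p :: "real poly" where P: "\<forall>I\<in>D. \<forall>x. real_sol x \<in> feasible (mip I) \<longrightarrow>
      (\<exists>y t. real_vec y = objective (mip I) (real_sol x) \<and> run P (Pr I (enc_sol x)) (enc_vec y) t \<and>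
        real t \<le> poly p (real (len I + len (enc_sol x))))"
    using encoding unfolding momilp_encoding_def by blast
  show ?thesis
  proof (rule ptimeI_poly)
    fix \<sigma> assume "\<sigma> \<in> {(I, x). I \<in> D \<and> x \<in> outputs I}"
    then obtain I x where \<sigma>: "\<sigma> = (I, x)" and x: "I \<in> D" "x \<in> outputs I" by auto
    obtain y t where y: "real_vec y = objective (mip I) (real_sol x)" "run P (Pr I (enc_sol x)) (enc_vec y) t"
      "real t \<le> poly p (real (len I + len (enc_sol x)))"
      using P x outputs_feasible[OF x] by blast
    have "y = img I x" using y(1) real_vec_img[OF x] by (metis inj_real_vec)
    then show "\<exists>t. run P (Pr (fst \<sigma>) (enc_sol (snd \<sigma>))) (enc_vec (img (fst \<sigma>) (snd \<sigma>))) t \<and>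
        real t \<le> poly p (real (len (fst \<sigma>) + len (enc_sol (snd \<sigma>))))" using y \<sigma> by auto
  qed
qed

lemma enc_point_eq: "enc_point k p = Pr (enc_sol (fst p)) (enc_ints k (snd p))"
  by (simp add: enc_point_def case_prod_unfold)

lemma ptime_enc_pointD:
  assumes "ptime A e (\<lambda>a. enc_point k (p a))"
  shows "ptime A e (\<lambda>a. enc_sol (fst (p a)))" "ptime A e (\<lambda>a. enc_ints k (snd (p a)))"
  using assms unfolding enc_point_eq by (rule ptime_Fst, rule ptime_Snd)

lemma ptime_singleton: "ptime A e (\<lambda>a. ex (x a)) \<Longrightarrow> ptime A e (\<lambda>a. enc_list (map ex [x a]))"
  by (rule ptime_Cons[OF _ ptime_Nil])

text \<open>
  Evaluating the objective is only possible at feasible solutions, so the domain is restricted to answers of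
  the weighted sum oracle.
\<close>

lemma ptime_point:
  assumes "ptime A e f" "ptime A e (\<lambda>a. enc_sol (x a))" "\<And>a. a \<in> A \<Longrightarrow> f a \<in> D \<and> x a \<in> outputs (f a)"
  shows "ptime A e (\<lambda>a. enc_point (Suc CARD('d)) (point (f a) (x a)))"
proof -
  have "ptime A e (\<lambda>a. enc_vec (img (f a) (x a)))"
    using ptime_comp[OF ptime_img, of A "\<lambda>a. (f a, x a)" e] ptime_Pr[OF assms(1,2)] assms(3) by simp
  then show ?thesis unfolding enc_point_eq point_def by (simp add: ptime_Pr assms(2) ptime_homog)
qed

lemma ptime_WS_point:
  assumes "ptime A e f" "ptime A e (\<lambda>a. enc_vec (w a))" "\<And>a. a \<in> A \<Longrightarrow> f a \<in> D \<and> 0 \<le> w a"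
  shows "ptime A e (\<lambda>a. enc_point (Suc CARD('d)) (point (f a) (WS (f a) (w a))))"
proof (rule ptime_point[OF assms(1)])
  show "ptime A e (\<lambda>a. enc_sol (WS (f a) (w a)))"
    using ptime_comp[OF ptime_WS, of A "\<lambda>a. (f a, w a)" e] ptime_Pr[OF assms(1,2)] assms(3) by simp
qed (use assms(3) in \<open>auto simp: outputs_def\<close>)

definition states :: "(val \<times> rat \<times> rat list list) set" where
  "states = {(I, \<epsilon>, xs). I \<in> D \<and> 0 < \<epsilon> \<and> set xs \<subseteq> outputs I}"

definition enc_state :: "val \<times> rat \<times> rat list list \<Rightarrow> val" where
  "enc_state \<sigma> = Pr (Pr (fst \<sigma>) (enc_rat (fst (snd \<sigma>))))
     (enc_list (map (enc_point (Suc CARD('d))) (map (point (fst \<sigma>)) (snd (snd \<sigma>)))))"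

lemma ptime_state:
  "ptime S enc_state fst"
  "ptime S enc_state (\<lambda>\<sigma>. enc_rat (fst (snd \<sigma>)))"
  "ptime S enc_state (\<lambda>\<sigma>. enc_list (map (enc_point (Suc CARD('d))) (map (point (fst \<sigma>)) (snd (snd \<sigma>)))))"
proof -
  have id: "ptime S enc_state (\<lambda>\<sigma>. Pr (Pr (fst \<sigma>) (enc_rat (fst (snd \<sigma>))))
     (enc_list (map (enc_point (Suc CARD('d))) (map (point (fst \<sigma>)) (snd (snd \<sigma>))))))"
    using ptime_id[of S enc_state] unfolding enc_state_def .
  show "ptime S enc_state fst" by (rule ptime_Fst[OF ptime_Fst[OF id]])
  show "ptime S enc_state (\<lambda>\<sigma>. enc_rat (fst (snd \<sigma>)))" by (rule ptime_Snd[OF ptime_Fst[OF id]])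
  show "ptime S enc_state (\<lambda>\<sigma>. enc_list (map (enc_point (Suc CARD('d))) (map (point (fst \<sigma>)) (snd (snd \<sigma>)))))"
    by (rule ptime_Snd[OF id])
qed

lemma ptime_candidates: "ptime S enc_state (\<lambda>\<sigma>. enc_mat (Suc CARD('d)) (candidates (fst \<sigma>) (snd (snd \<sigma>))))"
proof -
  have "ptime S enc_state (\<lambda>\<sigma>. enc_mat (Suc CARD('d)) (map snd (map (point (fst \<sigma>)) (snd (snd \<sigma>)))))"
    by (rule ptime_map[OF ptime_state(3)]) (rule ptime_enc_pointD(2)[OF ptime_elem])
  then have "ptime S enc_state (\<lambda>\<sigma>. enc_mat (Suc CARD('d)) (map snd (map (point (fst \<sigma>)) (snd (snd \<sigma>))) @ unit_list CARD('d)))"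
    by (rule ptime_append) (rule ptime_unit_list)
  then have "ptime S enc_state (\<lambda>\<sigma>. enc_mat (Suc CARD('d)) (gen_list (map (img (fst \<sigma>)) (snd (snd \<sigma>)))))"
    by (simp add: gen_list_def point_def o_def)
  then show ?thesis unfolding candidates_def by (rule ptime_normals)
qed

lemma ptime_violators:
  "ptime states enc_state (\<lambda>\<sigma>. enc_list (map (enc_point (Suc CARD('d))) (violators (fst \<sigma>) (fst (snd \<sigma>)) (snd (snd \<sigma>)))))"
  unfolding violators_def Let_def
proof (rule ptime_concat_map[OF ptime_candidates])
  let ?B = "SIGMA \<sigma>:states. set (candidates (fst \<sigma>) (snd (snd \<sigma>)))"
  let ?e = "\<lambda>\<tau>. Pr (enc_state (fst \<tau>)) (enc_ints (Suc CARD('d)) (snd \<tau>))"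
  let ?p = "\<lambda>\<tau>. point (fst (fst \<tau>)) (WS (fst (fst \<tau>)) (weight (snd \<tau>)))"
  have p: "ptime ?B ?e (\<lambda>\<tau>. enc_point (Suc CARD('d)) (?p \<tau>))"
    by (rule ptime_WS_point[OF ptime_lift[OF ptime_state(1)] ptime_weight[OF ptime_elem]])
      (auto simp: states_def intro: weight_nonneg)
  have "pbool ?B ?e (\<lambda>\<tau>. violated CARD('d) (fst (snd (fst \<tau>))) (snd \<tau>) (snd (?p \<tau>)))"
    by (rule pbool_violated[OF ptime_lift[OF ptime_state(2)] ptime_elem ptime_enc_pointD(2)[OF p]])
  then have "ptime ?B ?e (\<lambda>\<tau>. if violated CARD('d) (fst (snd (fst \<tau>))) (snd \<tau>) (snd (?p \<tau>))
      then enc_list (map (enc_point (Suc CARD('d))) [?p \<tau>]) else enc_list (map (enc_point (Suc CARD('d))) []))"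
    by (rule ptime_ite) (rule ptime_subset[OF ptime_singleton[where ex = "enc_point (Suc CARD('d))", OF p]] ptime_Nil, blast?)+
  then show "ptime ?B ?e (\<lambda>\<tau>. enc_list (map (enc_point (Suc CARD('d)))
      (if violated CARD('d) (fst (snd (fst \<tau>))) (snd \<tau>) (snd (?p \<tau>)) then [?p \<tau>] else [])))"
    by (rule ptime_cong) simp
qed

text \<open>
  One pass of the program adds the first of the violating solutions.
\<close>

definition next_state :: "val \<times> rat \<times> rat list list \<Rightarrow> val \<times> rat \<times> rat list list" where
  "next_state = (\<lambda>(I, \<epsilon>, xs). (I, \<epsilon>, fst (hd (violators I \<epsilon> xs)) # xs))"

lemma violators_eq_point: "p \<in> set (violators I \<epsilon> xs) \<Longrightarrow> p = point I (fst p)"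
  unfolding violators_def by (auto simp: Let_def point_def split: if_splits)

lemma ptime_next_state:
  "ptime {\<sigma> \<in> states. violators (fst \<sigma>) (fst (snd \<sigma>)) (snd (snd \<sigma>)) \<noteq> []} enc_state (\<lambda>\<sigma>. enc_state (next_state \<sigma>))"
  (is "ptime ?S _ _")
proof -
  let ?violators = "\<lambda>\<sigma>. violators (fst \<sigma>) (fst (snd \<sigma>)) (snd (snd \<sigma>))"
  have "ptime ?S enc_state (\<lambda>\<sigma>. hd (map (enc_point (Suc CARD('d))) (?violators \<sigma>)))"
    by (rule ptime_hd[OF ptime_subset[OF ptime_violators]]) auto
  then have "ptime ?S enc_state (\<lambda>\<sigma>. enc_point (Suc CARD('d)) (point (fst \<sigma>) (fst (hd (?violators \<sigma>)))))"
  proof (rule ptime_cong)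
    fix \<sigma> assume "\<sigma> \<in> ?S"
    then have "hd (?violators \<sigma>) = point (fst \<sigma>) (fst (hd (?violators \<sigma>)))"
      by (intro violators_eq_point[of _ _ "fst (snd \<sigma>)" "snd (snd \<sigma>)"]) auto
    then show "hd (map (enc_point (Suc CARD('d))) (?violators \<sigma>)) = enc_point (Suc CARD('d)) (point (fst \<sigma>) (fst (hd (?violators \<sigma>))))"
      using \<open>\<sigma> \<in> ?S\<close> by (simp add: hd_map)
  qed
  from ptime_Pr[OF ptime_Pr[OF ptime_state(1,2)] ptime_Cons[OF this ptime_state(3)]]
  show ?thesis unfolding enc_state_def next_state_def by (simp add: case_prod_unfold)
qed

lemma ptime_solutions: "ptime S enc_state (\<lambda>\<sigma>. enc_list (map enc_sol (snd (snd \<sigma>))))"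
proof -
  have "ptime S enc_state (\<lambda>\<sigma>. enc_list (map enc_sol (map fst (map (point (fst \<sigma>)) (snd (snd \<sigma>))))))"
    by (rule ptime_map[OF ptime_state(3)]) (rule ptime_enc_pointD(1)[OF ptime_elem])
  then show ?thesis by (simp add: point_def o_def)
qed

abbreviation inputs :: "(val \<times> rat) set" where
  "inputs \<equiv> {(I, \<epsilon>). I \<in> D \<and> 0 < \<epsilon>}"

definition start :: "val \<times> rat \<Rightarrow> val \<times> rat \<times> rat list list" where
  "start = (\<lambda>(I, \<epsilon>). (I, \<epsilon>, [WS I 0]))"

text \<open>
  The initial solution is the answer to the weight zero.
\<close>

lemma ptime_start: "ptime inputs (\<lambda>a. Pr (fst a) (enc_rat (snd a))) (\<lambda>a. enc_state (start a))"
  (is "ptime _ ?e _")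
proof -
  have id: "ptime inputs ?e (\<lambda>a. Pr (fst a) (enc_rat (snd a)))" by (rule ptime_id)
  have "ptime inputs ?e (\<lambda>a. enc_vec (weight (\<lambda>_. 0) :: rat ^ 'd))"
    by (intro ptime_weight ptime_enc_intsI ptime_const_Num)
  moreover have "weight (\<lambda>_. 0) = (0 :: rat ^ 'd)" by (simp add: weight_def vec_eq_iff)
  ultimately have "ptime inputs ?e (\<lambda>a. enc_point (Suc CARD('d)) (point (fst a) (WS (fst a) 0)))"
    using ptime_WS_point[OF ptime_Fst[OF id], of "\<lambda>_. 0"] by auto
  from ptime_Pr[OF id ptime_singleton[where ex = "enc_point (Suc CARD('d))", OF this]] show ?thesis
    unfolding enc_state_def start_def by (simp add: case_prod_unfold)
qed

text \<open>
  The solutions have polynomial length by assumption on \<open>WS\<close>, independently of the weight; their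
  images inherit this from the time in which they are computed. The exponent depends neither on \<open>\<epsilon>\<close> nor on the round.
\<close>

lemma output_length: "\<exists>k. \<forall>I\<in>D. \<forall>x\<in>outputs I.
  len (enc_vec (img I x)) \<le> (len I + 2) ^ k \<and> len (enc_point (Suc CARD('d)) (point I x)) \<le> (len I + 2) ^ k"
proof -
  let ?Z = "{(I, x). I \<in> D \<and> x \<in> outputs I}"
  let ?e = "\<lambda>\<sigma>. Pr (fst \<sigma>) (enc_sol (snd \<sigma>))"
  let ?N = "\<lambda>\<sigma>. len (fst \<sigma>)"
  obtain p :: "real poly" where p: "\<forall>I\<in>D. \<forall>w\<ge>0. real (len (enc_sol (WS I w))) \<le> poly p (real (len I))"
    using algorithm unfolding WS_algorithm_def by (elim conjE exE) (rule that)
  obtain k where "\<forall>n t. real t \<le> poly p (real n) \<longrightarrow> t \<le> (n + 2) ^ k" using poly_le_power_nat by blast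
  then have x: "poly_bounded ?Z ?N (\<lambda>\<sigma>. len (enc_sol (snd \<sigma>)))"
    using p unfolding poly_bounded_def outputs_def by (intro exI[of _ k]) auto
  have e: "poly_bounded ?Z ?N (\<lambda>\<sigma>. len (?e \<sigma>))"
    unfolding len.simps
    by (intro poly_bounded_add poly_bounded_const x poly_bounded_self[where f = "\<lambda>\<sigma>. len (fst \<sigma>)"]) auto
  have id: "ptime ?Z ?e (\<lambda>\<sigma>. Pr (fst \<sigma>) (enc_sol (snd \<sigma>)))" by (rule ptime_id)
  have "ptime ?Z ?e (\<lambda>\<sigma>. enc_point (Suc CARD('d)) (point (fst \<sigma>) (snd \<sigma>)))"
    by (rule ptime_point[OF ptime_Fst[OF id] ptime_Snd[OF id]]) auto
  from poly_bounded_add[OF poly_bounded_ptime[OF ptime_img e] poly_bounded_ptime[OF this e]]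
  obtain l where l: "\<forall>\<sigma>\<in>?Z. len (enc_vec (img (fst \<sigma>) (snd \<sigma>))) + len (enc_point (Suc CARD('d)) (point (fst \<sigma>) (snd \<sigma>))) \<le> (len (fst \<sigma>) + 2) ^ l"
    unfolding poly_bounded_def by blast
  have "len (enc_vec (img I x)) \<le> (len I + 2) ^ l \<and> len (enc_point (Suc CARD('d)) (point I x)) \<le> (len I + 2) ^ l"
    if "I \<in> D" "x \<in> outputs I" for I x
    using l[rule_format, of "(I, x)"] that by simp
  then show ?thesis by blast
qed

abbreviation input_size :: "val \<times> rat \<Rightarrow> nat" where
  "input_size a \<equiv> len (fst a) + len (enc_rat (snd a)) + nat \<lceil>1 / snd a\<rceil>"

text \<open>
  The main loop. Along it the cells of the images stay distinct, so the number of solutions is at most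
  \<open>M\<close>, the states have length at most \<open>Z\<close>, and each test and pass takes time at most \<open>T\<close>.
\<close>

lemma inner_approximation_program:
  "\<exists>P k. \<forall>I\<in>D. \<forall>\<epsilon>>0. \<exists>xs t. run P (Pr I (enc_rat \<epsilon>)) (enc_list (map enc_sol xs)) t \<and>
     t \<le> (input_size (I, \<epsilon>) + 2) ^ k \<and>
     inner_approx_output (obj I) (hpO I) \<epsilon> (real_sol (WS I 0)) (real_sol ` set xs) \<and>
     convex_approx_set (mip I) \<epsilon> (real_sol ` set xs)"
proof -
  let ?violators = "\<lambda>\<sigma>. violators (fst \<sigma>) (fst (snd \<sigma>)) (snd (snd \<sigma>))"
  obtain P0 k0 where P0: "\<forall>a\<in>inputs. \<exists>t. run P0 (Pr (fst a) (enc_rat (snd a))) (enc_state (start a)) t \<and>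
      t \<le> (len (Pr (fst a) (enc_rat (snd a))) + 1) ^ k0"
    using ptime_start unfolding ptime_def by blast
  obtain B kB where B: "\<forall>\<sigma>\<in>states. \<exists>t. run B (enc_state \<sigma>) (enc_list (map (enc_point (Suc CARD('d))) (?violators \<sigma>))) t \<and>
      t \<le> (len (enc_state \<sigma>) + 1) ^ kB"
    using ptime_violators unfolding ptime_def by blast
  obtain P kP where P: "\<forall>\<sigma>\<in>{\<sigma> \<in> states. ?violators \<sigma> \<noteq> []}. \<exists>t. run P (enc_state \<sigma>) (enc_state (next_state \<sigma>)) t \<and>
      t \<le> (len (enc_state \<sigma>) + 1) ^ kP"
    using ptime_next_state unfolding ptime_def by blast
  obtain Q kQ where Q: "\<forall>\<sigma>\<in>states. \<exists>t. run Q (enc_state \<sigma>) (enc_list (map enc_sol (snd (snd \<sigma>)))) t \<and>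
      t \<le> (len (enc_state \<sigma>) + 1) ^ kQ"
    using ptime_solutions unfolding ptime_def by blast
  obtain l where l: "\<forall>I\<in>D. \<forall>x\<in>outputs I. len (enc_vec (img I x)) \<le> (len I + 2) ^ l \<and>
      len (enc_point (Suc CARD('d)) (point I x)) \<le> (len I + 2) ^ l"
    using output_length by blast
  define L where "L = (\<lambda>a :: val \<times> rat. (len (fst a) + 2) ^ l)"
  define M where "M = (\<lambda>a. (2 * L a * (1 + nat \<lceil>1 / snd a\<rceil>) + 2) ^ CARD('d))"
  define Z where "Z = (\<lambda>a. len (fst a) + len (enc_rat (snd a)) + 3 + M a * (L a + 1))"
  define K where "K = kB + kP + kQ + 1"
  define T where "T = (\<lambda>a. (Z a + 1) ^ K)"
  define time where "time = (\<lambda>a. (len (fst a) + len (enc_rat (snd a)) + 2) ^ k0 + (3 * T a * (M a + 1) + T a))"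
  have L: "poly_bounded inputs input_size L"
    unfolding L_def by (intro poly_bounded_intros poly_bounded_self) auto
  have M: "poly_bounded inputs input_size M"
    unfolding M_def by (intro poly_bounded_intros L poly_bounded_self) auto
  have "poly_bounded inputs input_size Z"
    unfolding Z_def by (intro poly_bounded_intros L M poly_bounded_self) auto
  then have T: "poly_bounded inputs input_size T" unfolding T_def by (intro poly_bounded_intros)
  have "poly_bounded inputs input_size time"
    unfolding time_def by (intro poly_bounded_intros T M poly_bounded_self) auto
  then obtain k where k: "\<forall>a\<in>inputs. time a \<le> (input_size a + 2) ^ k" unfolding poly_bounded_def by blast
  show ?thesis
  proof (intro exI[of _ "Seq P0 (Seq (While B P) Q)"] exI[of _ k] ballI allI impI)
    fix I :: val and \<epsilon> :: rat
    assume I: "I \<in> D" and \<epsilon>: "0 < \<epsilon>"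
    let ?a = "(I, \<epsilon>)" and ?init = "WS I 0"
    define L' where "L' = L ?a"
    have x0: "?init \<in> outputs I" unfolding outputs_def by blast
    have len_vec: "len (enc_vec (img I x)) \<le> L'" and len_pt: "len (enc_point (Suc CARD('d)) (point I x)) \<le> L'"
      if "x \<in> outputs I" for x
      using l I that by (auto simp: L'_def L_def)
    have len_comp: "len (enc_rat (img I x $ i)) \<le> L'" if "x \<in> outputs I" for x i
      using len_component_le[of "img I x" i] len_vec[OF that] by simp
    \<comment> \<open>The loop invariant; its last part is the run of the abstract algorithm with \<open>F\<close> still empty.\<close>
    define S where "S = {(I, \<epsilon>, xs) | xs. xs \<noteq> [] \<and> set xs \<subseteq> outputs I \<and>
      distinct (map (\<lambda>x. cell \<epsilon> L' (img I x)) xs) \<and>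
      (inner_step (obj I) (hpO I) \<epsilon>)\<^sup>*\<^sup>* ({real_sol ?init}, {}) (real_sol ` set xs, {})}"
    have states: "S \<subseteq> states" unfolding S_def states_def using I \<epsilon> by auto
    have few: "length (snd (snd \<sigma>)) \<le> M ?a" if \<sigma>S: "\<sigma> \<in> S" for \<sigma>
    proof -
      obtain xs where \<sigma>: "\<sigma> = (I, \<epsilon>, xs)" "set xs \<subseteq> outputs I" "distinct (map (\<lambda>x. cell \<epsilon> L' (img I x)) xs)"
        using \<sigma>S unfolding S_def by blast
      have d: "distinct (map (cell \<epsilon> L') (map (img I) xs))" using \<sigma>(3) by (simp add: o_def)
      have "length xs = card (set (map (img I) xs))"
        using d distinct_card[of "map (img I) xs"] inj_on_imageI2[of "cell \<epsilon> L'" "img I" "set xs"]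
        by (simp add: distinct_map)
      also have "\<dots> \<le> (2 * L' * (1 + nat \<lceil>1 / \<epsilon>\<rceil>) + 2) ^ CARD('d)"
      proof (rule card_le_of_inj_on_cell)
        show "inj_on (cell \<epsilon> L') (set (map (img I) xs))" using d unfolding distinct_map by blast
        fix y i assume "y \<in> set (map (img I) xs)"
        then obtain x where "x \<in> outputs I" "y = img I x" using \<sigma>(2) by auto
        then show "0 \<le> y $ i \<and> len (enc_rat (y $ i)) \<le> L'"
          using len_comp img_nonneg[OF I] by (auto simp: less_eq_vec_def)
      qed (use \<epsilon> in auto)
      finally show ?thesis unfolding M_def \<sigma>(1) L'_def by simp
    qed
    have len_state: "len (enc_state \<sigma>) \<le> Z ?a" if \<sigma>S: "\<sigma> \<in> S" for \<sigma>
    proof -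
      obtain xs where \<sigma>: "\<sigma> = (I, \<epsilon>, xs)" "set xs \<subseteq> outputs I" using \<sigma>S unfolding S_def by blast
      have "(\<Sum>x\<leftarrow>xs. len (enc_point (Suc CARD('d)) (point I x)) + 1) \<le> (\<Sum>x\<leftarrow>xs. L' + 1)"
        using len_pt \<sigma>(2) by (intro sum_list_mono) auto
      also have "\<dots> = length xs * (L' + 1)" by (simp only: sum_list_triv of_nat_id)
      also have "\<dots> \<le> M ?a * (L' + 1)" using few[OF \<sigma>S] by (intro mult_right_mono) (simp_all add: \<sigma>(1))
      finally show ?thesis unfolding \<sigma>(1) enc_state_def Z_def L'_def by (simp add: len_enc_list o_def)
    qed
    have le_T: "(len (enc_state \<sigma>) + 1) ^ j \<le> T ?a" if "\<sigma> \<in> S" "j \<le> K" for \<sigma> j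
    proof -
      have "(len (enc_state \<sigma>) + 1) ^ j \<le> (len (enc_state \<sigma>) + 1) ^ K" using that by (intro power_increasing) auto
      also have "\<dots> \<le> T ?a" unfolding T_def using len_state[OF that(1)] by (intro power_mono) auto
      finally show ?thesis .
    qed
    have next_state: "next_state \<sigma> \<in> S \<and> length (snd (snd (next_state \<sigma>))) = Suc (length (snd (snd \<sigma>)))"
      if \<sigma>S: "\<sigma> \<in> S" and ne: "?violators \<sigma> \<noteq> []" for \<sigma>
    proof -
      obtain xs where \<sigma>: "\<sigma> = (I, \<epsilon>, xs)" "xs \<noteq> []" "set xs \<subseteq> outputs I"
        "distinct (map (\<lambda>x. cell \<epsilon> L' (img I x)) xs)"
        "(inner_step (obj I) (hpO I) \<epsilon>)\<^sup>*\<^sup>* ({real_sol ?init}, {}) (real_sol ` set xs, {})"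
        using \<sigma>S unfolding S_def by blast
      let ?x = "fst (hd (violators I \<epsilon> xs))"
      have hd: "hd (violators I \<epsilon> xs) \<in> set (violators I \<epsilon> xs)" using ne \<sigma>(1) by simp
      note step = violator_step[OF I \<epsilon> \<sigma>(3,2) hd]
      have "cell \<epsilon> L' (img I ?x) \<noteq> cell \<epsilon> L' (img I x)" if "x \<in> set xs" for x
      proof
        assume eq: "cell \<epsilon> L' (img I ?x) = cell \<epsilon> L' (img I x)"
        have "x \<in> outputs I" using \<sigma>(3) that by blast
        then have "real_vec (img I x) \<le> of_rat (1 + \<epsilon>) *\<^sub>R real_vec (img I ?x)"
          using step(1) by (intro le_of_cell_eq[OF \<epsilon> _ _ _ _ eq[symmetric]] img_nonneg[OF I] len_comp)
        then show False using step(4) that by blast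
      qed
      then have "cell \<epsilon> L' (img I ?x) \<notin> (\<lambda>x. cell \<epsilon> L' (img I x)) ` set xs" by blast
      then have "distinct (map (\<lambda>x. cell \<epsilon> L' (img I x)) (?x # xs))" using \<sigma>(4) by simp
      moreover have "(inner_step (obj I) (hpO I) \<epsilon>)\<^sup>*\<^sup>* ({real_sol ?init}, {}) (real_sol ` set (?x # xs), {})"
        using rtranclp.rtrancl_into_rtrancl[OF \<sigma>(5) step(3)] by simp
      ultimately have "(I, \<epsilon>, ?x # xs) \<in> S" unfolding S_def using step(1) \<sigma>(3) by simp
      then show ?thesis unfolding next_state_def \<sigma>(1) by simp
    qed
    have start: "start ?a \<in> S" unfolding S_def start_def using x0 by auto
    obtain t0 where t0: "run P0 (Pr I (enc_rat \<epsilon>)) (enc_state (start ?a)) t0"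
        "t0 \<le> (len I + len (enc_rat \<epsilon>) + 2) ^ k0"
      using P0[rule_format, of ?a] I \<epsilon> by auto
    have "\<exists>i t. run (While B P) (enc_state (start ?a)) (enc_state ((next_state ^^ i) (start ?a))) t \<and>
        (next_state ^^ i) (start ?a) \<in> S \<and>
        enc_list (map (enc_point (Suc CARD('d))) (?violators ((next_state ^^ i) (start ?a)))) = Num 0 \<and>
        t \<le> 3 * T ?a * (M ?a - length (snd (snd (start ?a))) + 1)"
    proof (rule run_While[where m = "\<lambda>\<sigma>. M ?a - length (snd (snd \<sigma>))" and
          c = "\<lambda>\<sigma>. enc_list (map (enc_point (Suc CARD('d))) (?violators \<sigma>))"])
      fix \<sigma> assume \<sigma>: "\<sigma> \<in> S"
      obtain t where "run B (enc_state \<sigma>) (enc_list (map (enc_point (Suc CARD('d))) (?violators \<sigma>))) t" "t \<le> (len (enc_state \<sigma>) + 1) ^ kB"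
        using B \<sigma> states by blast
      then show "\<exists>t. run B (enc_state \<sigma>) (enc_list (map (enc_point (Suc CARD('d))) (?violators \<sigma>))) t \<and> t \<le> T ?a"
        using le_T[OF \<sigma>, of kB] by (auto simp: K_def)
      show "len (enc_state \<sigma>) \<le> T ?a" using le_T[OF \<sigma>, of 1] by (auto simp: K_def)
      assume "enc_list (map (enc_point (Suc CARD('d))) (?violators \<sigma>)) \<noteq> Num 0"
      then have ne: "?violators \<sigma> \<noteq> []" by simp
      obtain t where "run P (enc_state \<sigma>) (enc_state (next_state \<sigma>)) t" "t \<le> (len (enc_state \<sigma>) + 1) ^ kP"
        using P \<sigma> states ne by blast
      then show "\<exists>t. run P (enc_state \<sigma>) (enc_state (next_state \<sigma>)) t \<and> t \<le> T ?a"
        using le_T[OF \<sigma>, of kP] by (auto simp: K_def)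
      show "next_state \<sigma> \<in> S \<and> M ?a - length (snd (snd (next_state \<sigma>))) < M ?a - length (snd (snd \<sigma>))"
        using next_state[OF \<sigma> ne] few[of "next_state \<sigma>"] by auto
    qed (rule start)
    then obtain i t1 where t1: "run (While B P) (enc_state (start ?a)) (enc_state ((next_state ^^ i) (start ?a))) t1"
        "(next_state ^^ i) (start ?a) \<in> S" "?violators ((next_state ^^ i) (start ?a)) = []"
        "t1 \<le> 3 * T ?a * (M ?a - length (snd (snd (start ?a))) + 1)" by auto
    obtain xs where \<sigma>: "(next_state ^^ i) (start ?a) = (I, \<epsilon>, xs)" "xs \<noteq> []" "set xs \<subseteq> outputs I"
        "(inner_step (obj I) (hpO I) \<epsilon>)\<^sup>*\<^sup>* ({real_sol ?init}, {}) (real_sol ` set xs, {})"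
      using t1(2) unfolding S_def by blast
    have none: "violators I \<epsilon> xs = []" using t1(3) \<sigma>(1) by simp
    have "(I, \<epsilon>, xs) \<in> S" using t1(2) \<sigma>(1) by simp
    then obtain t2 where t2: "run Q (enc_state (I, \<epsilon>, xs)) (enc_list (map enc_sol xs)) t2" "t2 \<le> T ?a"
      using Q[rule_format, of "(I, \<epsilon>, xs)"] states le_T[of "(I, \<epsilon>, xs)" kQ] by (fastforce simp: K_def)
    have "run (Seq P0 (Seq (While B P) Q)) (Pr I (enc_rat \<epsilon>)) (enc_list (map enc_sol xs)) (t0 + (t1 + t2))"
      using t0(1) t1(1) t2(1) unfolding \<sigma>(1) by (intro run_Seq)
    moreover have "t0 + (t1 + t2) \<le> (input_size ?a + 2) ^ k"
    proof -
      have "t1 \<le> 3 * T ?a * (M ?a + 1)" by (rule order_trans[OF t1(4)]) (intro mult_left_mono, auto)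
      then have "t0 + (t1 + t2) \<le> time ?a"
        unfolding time_def fst_conv snd_conv by (intro add_mono t0(2) t2(2))
      also have "\<dots> \<le> (input_size ?a + 2) ^ k" using k I \<epsilon> by blast
      finally show ?thesis .
    qed
    moreover have "inner_approx_output (obj I) (hpO I) \<epsilon> (real_sol ?init) (real_sol ` set xs)"
      unfolding inner_approx_output_def
      using rtranclp_trans[OF \<sigma>(4) no_violators(1)[OF I \<epsilon> \<sigma>(3,2) none]] by blast
    ultimately show "\<exists>xs t. run (Seq P0 (Seq (While B P) Q)) (Pr I (enc_rat \<epsilon>)) (enc_list (map enc_sol xs)) t \<and>
       t \<le> (input_size (I, \<epsilon>) + 2) ^ k \<and>
       inner_approx_output (obj I) (hpO I) \<epsilon> (real_sol (WS I 0)) (real_sol ` set xs) \<and>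
       convex_approx_set (mip I) \<epsilon> (real_sol ` set xs)"
      using no_violators(2)[OF I \<epsilon> \<sigma>(3,2) none] by blast
  qed
qed

end

lemma power_add_le:
  fixes x y :: real
  assumes "0 \<le> x" "0 \<le> y" shows "(x + y) ^ k \<le> 2 ^ k * (x ^ k + y ^ k)"
proof -
  have "(x + y) ^ k \<le> (2 * max x y) ^ k" using assms by (intro power_mono) auto
  also have "\<dots> = 2 ^ k * max x y ^ k" by (simp add: power_mult_distrib)
  also have "\<dots> \<le> 2 ^ k * (x ^ k + y ^ k)" using assms by (intro mult_left_mono) (auto simp: max_def)
  finally show ?thesis .
qed

theorem corollary9:
  fixes D :: "val set"
    and mip :: "val \<Rightarrow> ('d::finite) momilp"
    and WS :: "val \<Rightarrow> rat ^ 'd \<Rightarrow> rat list"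
  assumes "momilp_encoding D mip"
    and "WS_algorithm D mip WS"
    and "poly_time_WS D WS"
  shows "\<exists>P. implements_inner_approx D mip WS P \<and> cFPTAS D mip P"
proof -
  interpret weighted_sum_class D mip WS using assms by unfold_locales
  obtain P k where P: "\<And>I \<epsilon>. I \<in> D \<Longrightarrow> 0 < \<epsilon> \<Longrightarrow> \<exists>xs t. run P (Pr I (enc_rat \<epsilon>)) (enc_list (map enc_sol xs)) t \<and>
     t \<le> (input_size (I, \<epsilon>) + 2) ^ k \<and>
     inner_approx_output (obj I) (hpO I) \<epsilon> (real_sol (WS I 0)) (real_sol ` set xs) \<and>
     convex_approx_set (mip I) \<epsilon> (real_sol ` set xs)"
    using inner_approximation_program by blast
  have "implements_inner_approx D mip WS P"
  proof -
    obtain p :: "real poly" where p: "\<forall>I\<in>D. \<forall>w\<ge>0. real (len (enc_sol (WS I w))) \<le> poly p (real (len I))"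
      using assms(2) unfolding WS_algorithm_def by (elim conjE exE) (rule that)
    show ?thesis unfolding implements_inner_approx_def
    proof (intro exI[of _ p] ballI allI impI)
      fix I \<epsilon> assume I: "I \<in> D" and \<epsilon>: "0 < (\<epsilon> :: rat)"
      have "WS I 0 \<in> outputs I" unfolding outputs_def by blast
      then show "\<exists>x_init Rs t. real_sol x_init \<in> feasible (mip I) \<and>
          real (len (enc_sol x_init)) \<le> poly p (real (len I)) \<and>
          run P (Pr I (enc_rat \<epsilon>)) (enc_list (map enc_sol Rs)) t \<and>
          inner_approx_output (obj I) (hpO I) \<epsilon> (real_sol x_init) (real_sol ` set Rs)"
        using P[OF I \<epsilon>] p I outputs_feasible[OF I] by (metis order_refl)
    qed
  qed
  moreover have "cFPTAS D mip P" unfolding cFPTAS_def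
  proof (intro conjI exI ballI allI impI)
    show "convex_approx_scheme D mip P" unfolding convex_approx_scheme_def using P by blast
    fix I \<epsilon> u t assume I: "I \<in> D" and \<epsilon>: "0 < (\<epsilon> :: rat)" and run: "run P (Pr I (enc_rat \<epsilon>)) u t"
    let ?X = "real (len I) + 1 / of_rat \<epsilon>" and ?Y = "real (len (enc_rat \<epsilon>))"
    obtain t' where "run P (Pr I (enc_rat \<epsilon>)) u t'" "t' \<le> (input_size (I, \<epsilon>) + 2) ^ k"
      using P[OF I \<epsilon>] run_deterministic[OF run] by blast
    then have "t \<le> (input_size (I, \<epsilon>) + 2) ^ k" using run_deterministic[OF run] by blast
    then have "real t \<le> real ((input_size (I, \<epsilon>) + 2) ^ k)" by (simp only: of_nat_le_iff)
    also have "\<dots> = (real (input_size (I, \<epsilon>) + 2)) ^ k" by (simp only: of_nat_power)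
    also have "\<dots> \<le> ((?X + 3) + ?Y) ^ k"
    proof (intro power_mono)
      have e: "1 / of_rat \<epsilon> = (of_rat (1 / \<epsilon>) :: real)" by (simp add: of_rat_divide)
      have "of_rat (of_int \<lceil>1 / \<epsilon>\<rceil>) \<le> (of_rat (1 / \<epsilon> + 1) :: real)"
        by (simp only: of_rat_less_eq of_int_ceiling_le_add_one)
      then have "real (nat \<lceil>1 / \<epsilon>\<rceil>) \<le> 1 / of_rat \<epsilon> + 1"
        unfolding e using \<epsilon> by (simp add: of_rat_add)
      then show "real (input_size (I, \<epsilon>) + 2) \<le> (?X + 3) + ?Y" by simp
    qed simp
    \<comment> \<open>Separates the length of \<open>\<epsilon>\<close> from the length of the instance and \<open>1 / \<epsilon>\<close>.\<close>
    also have "\<dots> \<le> 2 ^ k * ((?X + 3) ^ k + ?Y ^ k)" using \<epsilon> by (intro power_add_le) auto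
    also have "\<dots> = poly (smult (2 ^ k) ([:3, 1:] ^ k)) ?X + poly (smult (2 ^ k) ([:0, 1:] ^ k)) ?Y"
      by (simp add: poly_power distrib_left add.commute)
    finally show "real t \<le> poly (smult (2 ^ k) ([:3, 1:] ^ k)) ?X + poly (smult (2 ^ k) ([:0, 1:] ^ k)) ?Y" .
  qed
  ultimately show ?thesis by blast
qed

end
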